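(* Let $X$ be a locally compact Hausdorff space such that the rank map is an isomorphism $\mathrm{Cu}(C_0(X))\cong \mathrm{Lsc}_\sigma(X,\overline{\mathbb N})$, and let $\mu$ be a faithful densely defined lower semicontinuous trace on $C_0(X)$. Then the functional $d_\mu:\mathrm{Cu}(C_0(X))\to[0,\infty]$ preserves compact containment if and only if $X$ does not contain any non-empty compact open subset.
   Context: A trace on a C$^*$-algebra $A$ is a lower semicontinuous map $\tau:A_+\to[0,\infty]$ that is additive, positively homogeneous, sends $0$ to $0$, and satisfies $\tau(a^*a)=\tau(aa^* )$; it is faithful if $\tau(a^*a)=0$ implies $a=0$, and densely defined if it is finite on a dense subset of $A_+$. $\mathrm{Cu}(A)$ is the ordered semigroup of Cuntz equivalence classes $[a]$ of positive elements $a\in A\otimes\mathcal K$, where $\mathcal K$ is the algebra of compact operators on a separable infinite-dimensional Hilbert space. A trace $\tau$ on $A$, extended in the usual way to $(A\otimes\mathcal K)_+$ (tensoring with the standard trace on $\mathcal K$), induces the functional $d_\tau:\mathrm{Cu}(A)\to[0,\infty]$, $d_\tau([a])=\lim_{n\to\infty}\tau(a^{1/n})$ for $a$ a positive contraction. $\overline{\mathbb N}=\{0,1,2,\dots,\infty\}$. $\mathrm{Lsc}_\sigma(X,\overline{\mathbb N})$ is the set of lower semicontinuous functions $f:X\to\overline{\mathbb N}$ such that $f^{-1}((k,\infty])$ is $\sigma$-compact for every $k=0,1,2,\dots$, with pointwise order and addition. The rank map sends $[a]\in\mathrm{Cu}(C_0(X))$ to the function $x\mapsto \mathrm{rank}(a(x))$,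 where $a\in C_0(X)\otimes\mathcal K=C_0(X,\mathcal K)$. In an ordered set $M$, $a$ is compactly contained in $b$, written $a\ll b$, if for every increasing sequence $(b_k)$ in $M$ with $\sup_k b_k\ge b$, eventually $b_k\ge a$. A map preserves compact containment if $a\ll b$ implies that the image of $a$ is compactly contained in the image of $b$. The order on $[0,\infty]$ is the usual one. *)

theory Defs
  imports "HOL-Analysis.Analysis"
begin

section \<open>The Hilbert space of square-summable complex sequences\<close>

typedef ell2 = "{x :: nat \<Rightarrow> complex. summable (\<lambda>n. (cmod (x n))\<^sup>2)}"
  morphisms coord Abs_ell2
  by (rule exI[of _ "\<lambda>_. 0"]) simp

setup_lifting type_definition_ell2

lemma summable_coord: "summable (\<lambda>n. (cmod (coord x n))\<^sup>2)"
  using coord[of x] by simp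

lemma ell2_eqI: "(\<And>n. coord x n = coord y n) \<Longrightarrow> x = y"
  by (simp add: coord_inject[symmetric] ext)

lemma cmod_add_sq: "(cmod (a + b))\<^sup>2 \<le> 2 * (cmod a)\<^sup>2 + 2 * (cmod b)\<^sup>2"
proof -
  have "(cmod (a + b))\<^sup>2 \<le> (cmod a + cmod b)\<^sup>2"
    by (intro power_mono norm_triangle_ineq) simp
  also have "\<dots> \<le> 2 * (cmod a)\<^sup>2 + 2 * (cmod b)\<^sup>2"
    using sum_squares_bound[of "cmod a" "cmod b"] by (simp add: power2_sum)
  finally show ?thesis .
qed

lemma summable_add_sq:
  assumes "summable (\<lambda>n. (cmod (x n))\<^sup>2)" "summable (\<lambda>n. (cmod (y n))\<^sup>2)"
  shows "summable (\<lambda>n. (cmod (x n + y n))\<^sup>2)"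
  by (rule summable_comparison_test[OF _ summable_add[OF summable_mult[OF assms(1), of 2] summable_mult[OF assms(2), of 2]]])
     (auto intro!: exI[of _ 0] cmod_add_sq)

lemma summable_mult_sq:
  assumes "summable (\<lambda>n. (cmod (x n))\<^sup>2)"
  shows "summable (\<lambda>n. (cmod (c * x n))\<^sup>2)"
  using summable_mult[OF assms, of "(cmod c)\<^sup>2"] by (simp add: norm_mult power_mult_distrib)

lift_definition scaleC :: "complex \<Rightarrow> ell2 \<Rightarrow> ell2" (infixr \<open>*\<^sub>C\<close> 75)
  is "\<lambda>c x n. c * x n"
  by (rule summable_mult_sq)

lift_definition basis_vec :: "nat \<Rightarrow> ell2" is "\<lambda>i n. if n = i then 1 else 0"
proof -
  fix i :: nat
  show "summable (\<lambda>n. (cmod (if n = i then 1 else 0))\<^sup>2)"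
    by (rule summable_finite[of "{i}"]) auto
qed

definition cinner :: "ell2 \<Rightarrow> ell2 \<Rightarrow> complex" where
  "cinner x y = (\<Sum>n. coord x n * cnj (coord y n))"

lemma summable_cinner: "summable (\<lambda>n. coord x n * cnj (coord y n))"
proof (rule summable_comparison_test)
  show "summable (\<lambda>n. (cmod (coord x n))\<^sup>2 + (cmod (coord y n))\<^sup>2)"
    by (intro summable_add summable_coord)
  have "a * b \<le> a\<^sup>2 + b\<^sup>2" if "a \<ge> 0" "b \<ge> 0" for a b :: real
    using sum_squares_bound[of a b] mult_nonneg_nonneg[OF that] by linarith
  then show "\<exists>N. \<forall>n\<ge>N. norm (coord x n * cnj (coord y n)) \<le> (cmod (coord x n))\<^sup>2 + (cmod (coord y n))\<^sup>2"
    by (auto simp: norm_mult)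
qed

text \<open>The library has no complex inner product spaces, so the norm and topology come from the real
  inner product \<open>Re \<langle>x, y\<rangle>\<close>, which induces the same norm.\<close>

instantiation ell2 :: real_inner
begin

lift_definition zero_ell2 :: ell2 is "\<lambda>_. 0" by simp

lift_definition plus_ell2 :: "ell2 \<Rightarrow> ell2 \<Rightarrow> ell2" is "\<lambda>x y n. x n + y n"
  by (rule summable_add_sq)

lift_definition uminus_ell2 :: "ell2 \<Rightarrow> ell2" is "\<lambda>x n. - x n" by simp

lift_definition minus_ell2 :: "ell2 \<Rightarrow> ell2 \<Rightarrow> ell2" is "\<lambda>x y n. x n - y n"
  using summable_add_sq[of _ "\<lambda>n. - _ n"] by simp

lift_definition scaleR_ell2 :: "real \<Rightarrow> ell2 \<Rightarrow> ell2" is "\<lambda>r x n. complex_of_real r * x n"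
  by (rule summable_mult_sq)

definition inner_ell2 :: "ell2 \<Rightarrow> ell2 \<Rightarrow> real" where
  "inner_ell2 x y = Re (cinner x y)"

definition norm_ell2 :: "ell2 \<Rightarrow> real" where
  "norm_ell2 x = sqrt (\<Sum>n. (cmod (coord x n))\<^sup>2)"

definition dist_ell2 :: "ell2 \<Rightarrow> ell2 \<Rightarrow> real" where
  "dist_ell2 x y = norm (x - y)"

definition sgn_ell2 :: "ell2 \<Rightarrow> ell2" where
  "sgn_ell2 x = scaleR (inverse (norm x)) x"

definition uniformity_ell2 :: "(ell2 \<times> ell2) filter" where
  "uniformity_ell2 = (INF e\<in>{0<..}. principal {(x, y). dist x y < e})"

definition open_ell2 :: "ell2 set \<Rightarrow> bool" where
  "open_ell2 U = (\<forall>x\<in>U. \<forall>\<^sub>F (x', y) in uniformity. x' = x \<longrightarrow> y \<in> U)"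

lemma inner_self: "inner x x = (\<Sum>n. (cmod (coord x n))\<^sup>2)" for x :: ell2
proof -
  have "inner x x = (\<Sum>n. Re (coord x n * cnj (coord x n)))"
    unfolding inner_ell2_def cinner_def by (rule bounded_linear.suminf[OF bounded_linear_Re summable_cinner])
  also have "\<dots> = (\<Sum>n. (cmod (coord x n))\<^sup>2)"
    by (simp add: complex_norm_square[symmetric] del: of_real_power flip: of_real_power)
  finally show ?thesis .
qed

instance
proof
  fix x y z :: ell2 and a b :: real
  show "x + y + z = x + (y + z)" by transfer (simp add: add.assoc)
  show "x + y = y + x" by transfer (simp add: add.commute)
  show "0 + x = x" by transfer simp
  show "- x + x = 0" by transfer simp
  show "x - y = x + - y" by transfer simp
  show "a *\<^sub>R (x + y) = a *\<^sub>R x + a *\<^sub>R y" by transfer (simp add: algebra_simps)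
  show "(a + b) *\<^sub>R x = a *\<^sub>R x + b *\<^sub>R x" by transfer (simp add: algebra_simps)
  show "a *\<^sub>R b *\<^sub>R x = (a * b) *\<^sub>R x" by transfer (simp add: algebra_simps)
  show "1 *\<^sub>R x = x" by transfer simp
  show "dist x y = norm (x - y)" by (rule dist_ell2_def)
  show "sgn x = scaleR (inverse (norm x)) x" by (rule sgn_ell2_def)
  show "(uniformity :: (ell2 \<times> ell2) filter) = (INF e\<in>{0<..}. principal {(x, y). dist x y < e})"
    by (rule uniformity_ell2_def)
  show "open U = (\<forall>x\<in>U. \<forall>\<^sub>F (x', y) in uniformity. x' = x \<longrightarrow> y \<in> U)" for U :: "ell2 set"
    by (rule open_ell2_def)
  have Re_inner: "inner x y = (\<Sum>n. Re (coord x n * cnj (coord y n)))" for x y :: ell2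
    unfolding inner_ell2_def cinner_def by (rule bounded_linear.suminf[OF bounded_linear_Re summable_cinner])
  have sm: "summable (\<lambda>n. Re (coord x n * cnj (coord y n)))" for x y
    by (rule bounded_linear.summable[OF bounded_linear_Re summable_cinner])
  show "inner x y = inner y x"
    unfolding Re_inner by (simp add: mult.commute)
  show "inner (x + y) z = inner x z + inner y z"
    unfolding Re_inner suminf_add[OF sm sm] by (simp add: plus_ell2.rep_eq algebra_simps)
  show "inner (a *\<^sub>R x) y = a * inner x y"
    unfolding Re_inner suminf_mult[OF sm, symmetric] by (simp add: scaleR_ell2.rep_eq algebra_simps)
  show "0 \<le> inner x x"
    unfolding inner_self by (intro suminf_nonneg summable_coord) simp
  show "inner x x = 0 \<longleftrightarrow> x = 0"
    unfolding inner_self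
    by (subst suminf_eq_zero_iff[OF summable_coord]) (auto simp: zero_ell2.rep_eq intro!: ell2_eqI)
  show "norm x = sqrt (inner x x)"
    unfolding inner_self by (rule norm_ell2_def)
qed

end

lemma cmod_coord_le: "cmod (coord x n) \<le> norm x"
proof -
  have "(cmod (coord x n))\<^sup>2 \<le> (\<Sum>n. (cmod (coord x n))\<^sup>2)"
    using sum_le_suminf[OF summable_coord[of x], of "{n}"] by simp
  then show ?thesis
    unfolding norm_ell2_def by (rule real_le_rsqrt)
qed

instance ell2 :: banach
proof
  fix X :: "nat \<Rightarrow> ell2"
  assume X: "Cauchy X"
  have "\<exists>l. (\<lambda>k. coord (X k) n) \<longlonglongrightarrow> l" for n
  proof -
    have "Cauchy (\<lambda>k. coord (X k) n)"
    proof (rule CauchyI)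
      fix e :: real assume "0 < e"
      then obtain M where M: "\<And>i j. i \<ge> M \<Longrightarrow> j \<ge> M \<Longrightarrow> norm (X i - X j) < e"
        using CauchyD[OF X] by metis
      have "norm (coord (X i) n - coord (X j) n) < e" if "i \<ge> M" "j \<ge> M" for i j
        using M[OF that] cmod_coord_le[of "X i - X j" n] by (simp add: minus_ell2.rep_eq)
      then show "\<exists>M. \<forall>m\<ge>M. \<forall>k\<ge>M. norm (coord (X m) n - coord (X k) n) < e" by blast
    qed
    then show ?thesis by (simp add: Cauchy_convergent_iff convergent_def)
  qed
  then obtain l where l: "\<And>n. (\<lambda>k. coord (X k) n) \<longlonglongrightarrow> l n" by metis
  have tail: "\<exists>M. \<forall>i\<ge>M. summable (\<lambda>n. (cmod (coord (X i) n - l n))\<^sup>2) \<and>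
      (\<Sum>n. (cmod (coord (X i) n - l n))\<^sup>2) \<le> e\<^sup>2" if e: "e > 0" for e
  proof -
    obtain M where M: "\<And>i j. i \<ge> M \<Longrightarrow> j \<ge> M \<Longrightarrow> norm (X i - X j) < e"
      using CauchyD[OF X e] by metis
    have part: "(\<Sum>n<N. (cmod (coord (X i) n - l n))\<^sup>2) \<le> e\<^sup>2" if i: "i \<ge> M" for i N
    proof (rule LIMSEQ_le_const2)
      show "(\<lambda>j. \<Sum>n<N. (cmod (coord (X i) n - coord (X j) n))\<^sup>2) \<longlonglongrightarrow> (\<Sum>n<N. (cmod (coord (X i) n - l n))\<^sup>2)"
        by (intro tendsto_intros l)
      have "(\<Sum>n<N. (cmod (coord (X i) n - coord (X j) n))\<^sup>2) \<le> e\<^sup>2" if j: "j \<ge> M" for j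
      proof -
        have "(\<Sum>n<N. (cmod (coord (X i) n - coord (X j) n))\<^sup>2) \<le> (\<Sum>n. (cmod (coord (X i - X j) n))\<^sup>2)"
          using sum_le_suminf[OF summable_coord[of "X i - X j"], of "{..<N}"] by (simp add: minus_ell2.rep_eq)
        also have "\<dots> = (norm (X i - X j))\<^sup>2"
          unfolding norm_ell2_def by (simp add: suminf_nonneg summable_coord)
        also have "\<dots> \<le> e\<^sup>2"
          using M[OF i j] by (intro power_mono) auto
        finally show ?thesis .
      qed
      then show "\<exists>K. \<forall>j\<ge>K. (\<Sum>n<N. (cmod (coord (X i) n - coord (X j) n))\<^sup>2) \<le> e\<^sup>2" by blast
    qed
    have sm: "summable (\<lambda>n. (cmod (coord (X i) n - l n))\<^sup>2)" if "i \<ge> M" for i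
      by (rule bounded_imp_summable[of _ "e\<^sup>2"])
         (use part[OF that, of "Suc _"] in \<open>auto simp: lessThan_Suc_atMost\<close>)
    show ?thesis
      using sm suminf_le_const[OF sm part] by blast
  qed
  have "summable (\<lambda>n. (cmod (l n))\<^sup>2)"
  proof -
    obtain i where i: "summable (\<lambda>n. (cmod (coord (X i) n - l n))\<^sup>2)"
      using tail[of 1] by auto
    have "summable (\<lambda>n. (cmod (coord (X i) n + (- 1) * (coord (X i) n - l n)))\<^sup>2)"
      by (intro summable_add_sq summable_mult_sq summable_coord i)
    then show ?thesis by simp
  qed
  then have L: "coord (Abs_ell2 l) = l"
    by (simp add: Abs_ell2_inverse)
  have "X \<longlonglongrightarrow> Abs_ell2 l"
  proof (rule LIMSEQ_I)
    fix r :: real assume r: "0 < r"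
    then obtain M where M: "\<And>i. i \<ge> M \<Longrightarrow> (\<Sum>n. (cmod (coord (X i) n - l n))\<^sup>2) \<le> (r/2)\<^sup>2"
      using tail[of "r/2"] by auto
    have "norm (X i - Abs_ell2 l) < r" if "i \<ge> M" for i
    proof -
      have "norm (X i - Abs_ell2 l) \<le> sqrt ((r/2)\<^sup>2)"
        unfolding norm_ell2_def minus_ell2.rep_eq L by (rule real_sqrt_le_mono[OF M[OF that]])
      then show ?thesis using r by simp
    qed
    then show "\<exists>N. \<forall>n\<ge>N. norm (X n - Abs_ell2 l) < r" by blast
  qed
  then show "convergent X" by (auto simp: convergent_def)
qed

interpretation ell2: vector_space scaleC
  by unfold_locales (transfer; simp add: algebra_simps)+


section \<open>Operators on the Hilbert space\<close>

text \<open>\<^typ>\<open>ell2 \<Rightarrow>\<^sub>L ell2\<close> consists of the bounded real-linear operators with the operator norm;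
  complex linearity is imposed separately.\<close>

type_synonym operator = "ell2 \<Rightarrow>\<^sub>L ell2"

definition compact_operators :: "operator set" where
  "compact_operators = {T :: operator. (\<forall>c x. T (c *\<^sub>C x) = c *\<^sub>C T x) \<and> compact (closure (T ` cball 0 1))}"

definition adjoint_op :: "operator \<Rightarrow> operator" where
  "adjoint_op T = (THE S :: operator. \<forall>x y. cinner (T x) y = cinner x (S y))"

definition op_power :: "operator \<Rightarrow> nat \<Rightarrow> operator" where
  "op_power T n = ((\<lambda>S. T o\<^sub>L S) ^^ n) id_blinfun"

definition rank_op :: "operator \<Rightarrow> enat" where
  "rank_op T = (if \<exists>B. finite B \<and> range T \<subseteq> ell2.span B then enat (ell2.dim (range T)) else \<infinity>)"


section \<open>The algebras \<open>C\<^sub>0(X)\<close> and \<open>C\<^sub>0(X) \<otimes> \<K> = C\<^sub>0(X, \<K>)\<close>\<close>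

text \<open>A function on \<open>X\<close> is represented by its extension by zero outside \<^term>\<open>topspace X\<close>, so that
  equality of functions is equality on \<open>X\<close>. The norm is the supremum norm.\<close>

definition vanishing_at_infinity :: "'a topology \<Rightarrow> ('a \<Rightarrow> 'b::real_normed_vector) set" where
  "vanishing_at_infinity X = {f. continuous_map X euclidean f \<and>
     (\<forall>\<epsilon>>0. compactin X {x \<in> topspace X. \<epsilon> \<le> norm (f x)}) \<and> (\<forall>x. x \<notin> topspace X \<longrightarrow> f x = 0)}"

definition C0 :: "'a topology \<Rightarrow> ('a \<Rightarrow> complex) set" where
  "C0 X = vanishing_at_infinity X"

definition C0_pos :: "'a topology \<Rightarrow> ('a \<Rightarrow> complex) set" where
  "C0_pos X = {\<lambda>x. cnj (b x) * b x | b. b \<in> C0 X}"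

definition C0K :: "'a topology \<Rightarrow> ('a \<Rightarrow> operator) set" where
  "C0K X = {a \<in> vanishing_at_infinity X. \<forall>x. a x \<in> compact_operators}"

definition C0K_pos :: "'a topology \<Rightarrow> ('a \<Rightarrow> operator) set" where
  "C0K_pos X = {\<lambda>x. adjoint_op (b x) o\<^sub>L b x | b. b \<in> C0K X}"

definition C0K_nth_root :: "'a topology \<Rightarrow> nat \<Rightarrow> ('a \<Rightarrow> operator) \<Rightarrow> ('a \<Rightarrow> operator)" where
  "C0K_nth_root X n a = (THE b. b \<in> C0K_pos X \<and> (\<lambda>x. op_power (b x) n) = a)"


section \<open>The Cuntz semigroup of \<open>C\<^sub>0(X)\<close>\<close>

definition cuntz_below :: "'a topology \<Rightarrow> ('a \<Rightarrow> operator) \<Rightarrow> ('a \<Rightarrow> operator) \<Rightarrow> bool" where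
  "cuntz_below X a b \<longleftrightarrow> (\<exists>r. (\<forall>n::nat. r n \<in> C0K X) \<and>
     uniform_limit (topspace X) (\<lambda>n x. adjoint_op (r n x) o\<^sub>L b x o\<^sub>L r n x) a sequentially)"

definition cuntz_class :: "'a topology \<Rightarrow> ('a \<Rightarrow> operator) \<Rightarrow> ('a \<Rightarrow> operator) set" where
  "cuntz_class X a = {b \<in> C0K_pos X. cuntz_below X a b \<and> cuntz_below X b a}"

definition Cu :: "'a topology \<Rightarrow> ('a \<Rightarrow> operator) set set" where
  "Cu X = cuntz_class X ` C0K_pos X"

definition Cu_le :: "'a topology \<Rightarrow> ('a \<Rightarrow> operator) set \<Rightarrow> ('a \<Rightarrow> operator) set \<Rightarrow> bool" where
  "Cu_le X C D \<longleftrightarrow> (\<exists>a\<in>C. \<exists>b\<in>D. cuntz_below X a b)"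

text \<open>\<open>[a] + [b] = [a + b]\<close> for orthogonal representatives; these exist because
  \<open>a \<oplus> 0\<close> and \<open>0 \<oplus> b\<close> can be moved into \<open>C\<^sub>0(X, \<K>)\<close> along \<open>M\<^sub>2(\<K>) \<cong> \<K>\<close>. Here and below,
  \<^const>\<open>the_elem\<close> picks the common value at all admissible representatives.\<close>

definition Cu_add :: "'a topology \<Rightarrow> ('a \<Rightarrow> operator) set \<Rightarrow> ('a \<Rightarrow> operator) set \<Rightarrow> ('a \<Rightarrow> operator) set" where
  "Cu_add X C D =
     the_elem {cuntz_class X (\<lambda>x. a x + b x) | a b. a \<in> C \<and> b \<in> D \<and> (\<forall>x. a x o\<^sub>L b x = 0)}"

definition rank_map :: "'a topology \<Rightarrow> ('a \<Rightarrow> operator) set \<Rightarrow> ('a \<Rightarrow> enat)" where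
  "rank_map X C = the_elem ((\<lambda>a x. rank_op (a x)) ` C)"

definition sigma_compactin :: "'a topology \<Rightarrow> 'a set \<Rightarrow> bool" where
  "sigma_compactin X S \<longleftrightarrow> (\<exists>\<C>. countable \<C> \<and> (\<forall>K\<in>\<C>. compactin X K) \<and> S = \<Union>\<C>)"

text \<open>Lower semicontinuity of \<open>f\<close> says that each \<open>f\<^sup>-\<^sup>1((k, \<infinity>])\<close> is open; since \<open>f\<close> takes values in
  \<^typ>\<open>enat\<close>, finite \<open>k\<close> suffice.\<close>

definition Lsc_sigma :: "'a topology \<Rightarrow> ('a \<Rightarrow> enat) set" where
  "Lsc_sigma X = {f. (\<forall>k::nat. openin X {x \<in> topspace X. enat k < f x}) \<and>
     (\<forall>k::nat. sigma_compactin X {x \<in> topspace X. enat k < f x}) \<and>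
     (\<forall>x. x \<notin> topspace X \<longrightarrow> f x = 0)}"

definition rank_map_is_isomorphism :: "'a topology \<Rightarrow> bool" where
  "rank_map_is_isomorphism X \<longleftrightarrow>
     bij_betw (rank_map X) (Cu X) (Lsc_sigma X) \<and>
     (\<forall>C\<in>Cu X. \<forall>D\<in>Cu X. Cu_le X C D \<longleftrightarrow> rank_map X C \<le> rank_map X D) \<and>
     (\<forall>C\<in>Cu X. \<forall>D\<in>Cu X. rank_map X (Cu_add X C D) = (\<lambda>x. rank_map X C x + rank_map X D x))"


section \<open>Traces on \<open>C\<^sub>0(X)\<close> and their functionals\<close>

definition is_trace :: "'a topology \<Rightarrow> (('a \<Rightarrow> complex) \<Rightarrow> ennreal) \<Rightarrow> bool" where
  "is_trace X \<tau> \<longleftrightarrow>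
     (\<forall>a\<in>C0_pos X. \<forall>c. c < \<tau> a \<longrightarrow>
        (\<exists>\<epsilon>>0. \<forall>b\<in>C0_pos X. (\<forall>x\<in>topspace X. cmod (b x - a x) < \<epsilon>) \<longrightarrow> c < \<tau> b)) \<and>
     (\<forall>a\<in>C0_pos X. \<forall>b\<in>C0_pos X. \<tau> (\<lambda>x. a x + b x) = \<tau> a + \<tau> b) \<and>
     (\<forall>a\<in>C0_pos X. \<forall>t>0. \<tau> (\<lambda>x. complex_of_real t * a x) = ennreal t * \<tau> a) \<and>
     \<tau> (\<lambda>x. 0) = 0 \<and>
     (\<forall>a\<in>C0 X. \<tau> (\<lambda>x. cnj (a x) * a x) = \<tau> (\<lambda>x. a x * cnj (a x)))"

definition faithful_trace :: "'a topology \<Rightarrow> (('a \<Rightarrow> complex) \<Rightarrow> ennreal) \<Rightarrow> bool" where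
  "faithful_trace X \<tau> \<longleftrightarrow> (\<forall>a\<in>C0 X. \<tau> (\<lambda>x. cnj (a x) * a x) = 0 \<longrightarrow> a = (\<lambda>x. 0))"

definition densely_defined_trace :: "'a topology \<Rightarrow> (('a \<Rightarrow> complex) \<Rightarrow> ennreal) \<Rightarrow> bool" where
  "densely_defined_trace X \<tau> \<longleftrightarrow>
     (\<forall>a\<in>C0_pos X. \<forall>\<epsilon>>0. \<exists>b\<in>C0_pos X. \<tau> b < \<infinity> \<and> (\<forall>x\<in>topspace X. cmod (b x - a x) < \<epsilon>))"

text \<open>The extension \<open>\<tau> \<otimes> Tr\<close>: the sum of \<open>\<tau>\<close> over the diagonal entries \<open>x \<mapsto> \<langle>a(x) e\<^sub>i, e\<^sub>i\<rangle>\<close>.\<close>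

definition trace_ext :: "(('a \<Rightarrow> complex) \<Rightarrow> ennreal) \<Rightarrow> ('a \<Rightarrow> operator) \<Rightarrow> ennreal" where
  "trace_ext \<tau> a = (\<Sum>i. \<tau> (\<lambda>x. cinner (a x (basis_vec i)) (basis_vec i)))"

definition d_functional ::
    "'a topology \<Rightarrow> (('a \<Rightarrow> complex) \<Rightarrow> ennreal) \<Rightarrow> ('a \<Rightarrow> operator) set \<Rightarrow> ennreal" where
  "d_functional X \<tau> C =
     the_elem ((\<lambda>a. lim (\<lambda>n. trace_ext \<tau> (C0K_nth_root X n a))) `
       {a \<in> C. \<forall>x\<in>topspace X. norm (a x) \<le> 1})"


section \<open>Compact containment\<close>

text \<open>The condition \<open>sup\<^sub>k s\<^sub>k \<ge> b\<close> is read as: the supremum \<open>t\<close> of the sequence exists in the ordered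
  set \<open>(M, le)\<close> and \<open>t \<ge> b\<close>.\<close>

definition is_supremum :: "'m set \<Rightarrow> ('m \<Rightarrow> 'm \<Rightarrow> bool) \<Rightarrow> (nat \<Rightarrow> 'm) \<Rightarrow> 'm \<Rightarrow> bool" where
  "is_supremum M le s t \<longleftrightarrow>
     t \<in> M \<and> (\<forall>k. le (s k) t) \<and> (\<forall>u\<in>M. (\<forall>k. le (s k) u) \<longrightarrow> le t u)"

definition compactly_contained :: "'m set \<Rightarrow> ('m \<Rightarrow> 'm \<Rightarrow> bool) \<Rightarrow> 'm \<Rightarrow> 'm \<Rightarrow> bool" where
  "compactly_contained M le a b \<longleftrightarrow>
     (\<forall>s t. (\<forall>k. s k \<in> M \<and> le (s k) (s (Suc k))) \<and> is_supremum M le s t \<and> le b t \<longrightarrow>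
        (\<forall>\<^sub>F k in sequentially. le a (s k)))"

definition preserves_compact_containment ::
    "'m set \<Rightarrow> ('m \<Rightarrow> 'm \<Rightarrow> bool) \<Rightarrow> 'n set \<Rightarrow> ('n \<Rightarrow> 'n \<Rightarrow> bool) \<Rightarrow> ('m \<Rightarrow> 'n) \<Rightarrow> bool" where
  "preserves_compact_containment M le N le' f \<longleftrightarrow>
     (\<forall>a\<in>M. \<forall>b\<in>M. compactly_contained M le a b \<longrightarrow> compactly_contained N le' (f a) (f b))"

end

theory Submission
  imports Defs
begin

text \<open>For a contraction \<open>T \<ge> 0\<close> the diagonal sums of \<open>T\<^bsup>1/n\<^esup>\<close> increase to the rank of \<open>T\<close>, so a Dini
  argument for \<open>\<mu>\<close> shows that \<open>d\<^sub>\<mu> [a]\<close> is the integral of the rank function of \<open>a\<close>, the supremum of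
  \<open>\<mu> h\<close> over \<open>h \<in> C\<^sub>0(X)\<^sub>+\<close> below it.

  If \<open>[a] \<ll> [b]\<close> then, writing \<open>\<parallel>b\<parallel>\<close> for the pointwise norm of \<open>b\<close>, the rank function of \<open>a\<close> lies below
  the truncation \<open>min (rank b) k\<close> supported on \<open>{\<parallel>b\<parallel> > \<epsilon>}\<close>; its integral is finite. When no non-empty open
  set is compact, either \<open>b = 0\<close> or \<open>\<parallel>b\<parallel>\<close> takes a value in \<open>(0, \<epsilon>)\<close>, and a bump function on
  \<open>{0 < \<parallel>b\<parallel> < \<epsilon>}\<close> gives \<open>d\<^sub>\<mu> [a] < d\<^sub>\<mu> [b]\<close> by faithfulness. Conversely the indicator function of a compact open
  set is compactly contained in itself, while only \<open>0\<close> has this property among the values of \<open>d\<^sub>\<mu>\<close>.\<close>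

section \<open>Polynomials of positive contractions\<close>

text \<open>Roots require a functional calculus for symmetric operators with 0 \<le> T \<le> 1. It
  is built without spectra: positivity of p(T) for polynomials p \<ge> 0 on [0,1] comes from
  Bernstein expansions, the norm bound from positivity of c^2 - p^2, and continuous functions are
  reached by Weierstrass approximation. All error bounds are independent of T, so roots are norm
  continuous in T and may be taken pointwise on \<open>X\<close>.

  The rank map and the functional are read off representatives through \<open>the_elem\<close>, so
  independence of the representative has to be proved: rank is lower semicontinuous under norm
  limits and therefore a Cuntz invariant, and positive multiples stay in the class, which supplies
  contractions.

  Suprema in the Cuntz semigroup are given only abstractly by order. The isomorphism hypothesis
  turns truncations and pointwise suprema of rank functions into actual classes, and only then can
  the abstract supremum be compared with a pointwise one. The strict inequality of the two
  functional values rests on finiteness of the smaller one; this is where dense definedness of \<mu>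
  enters.\<close>

lemma choose_ratio_power_diff_le:
  assumes "2 * j \<le> n" "0 < n" "k \<le> n"
  shows "\<bar>real (k choose j) / real (n choose j) - (real k / real n) ^ j\<bar> \<le> real j * (real j / (real n - real j))"
proof -
  have jn: "j < n" using assms by linarith
  have eq: "real (k choose j) / real (n choose j) = (\<Prod>i<j. (real k - real i) / (real n - real i))"
    by (simp add: binomial_gbinomial gbinomial_prod_rev prod_dividef atLeast0LessThan)
  \<comment> \<open>Both products have \<open>j\<close> factors of modulus at most 1; for such
    products the difference is at most the sum of the differences of the factors.\<close>
  have "\<bar>(\<Prod>i<j. (real k - real i) / (real n - real i)) - (\<Prod>i<j. real k / real n)\<bar>
      \<le> (\<Sum>i<j. \<bar>(real k - real i) / (real n - real i) - real k / real n\<bar>)"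
  proof (rule norm_prod_diff[where 'a = real, unfolded real_norm_def])
    fix i assume "i \<in> {..<j}"
    then have i: "i < j" by simp
    have "real n - real i > 0" using i jn by simp
    \<comment> \<open>For \<open>k < i\<close> the left side is \<open>i - k \<le> i\<close>, and
      \<open>i \<le> n - i\<close> because \<open>2 * j \<le> n\<close>.\<close>
    moreover have "\<bar>real k - real i\<bar> \<le> real n - real i" using i assms by auto
    ultimately show "\<bar>(real k - real i) / (real n - real i)\<bar> \<le> 1"
      by (simp add: abs_divide)
    show "\<bar>real k / real n\<bar> \<le> 1" using assms by simp
  qed
  also have "\<dots> \<le> (\<Sum>i<j. real j / (real n - real j))"
  proof (rule sum_mono)
    fix i assume "i \<in> {..<j}"
    then have i: "i < j" by simp
    have pos: "real n - real i > 0" "real n - real j > 0" using i jn by simp_all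
    have "(real k - real i) / (real n - real i) - real k / real n
        = - ((real i / (real n - real i)) * ((real n - real k) / real n))"
      using pos assms by (simp add: divide_simps) (simp add: algebra_simps)
    then have "\<bar>(real k - real i) / (real n - real i) - real k / real n\<bar>
        = (real i / (real n - real i)) * ((real n - real k) / real n)"
      using pos assms by (simp add: abs_mult)
    also have "\<dots> \<le> (real i / (real n - real i)) * 1"
      using pos assms by (intro mult_left_mono) auto
    also have "\<dots> \<le> real j / (real n - real j)"
      using pos i by (simp add: frac_le)
    finally show "\<bar>(real k - real i) / (real n - real i) - real k / real n\<bar> \<le> real j / (real n - real j)" .
  qed
  finally show ?thesis
    by (simp add: eq)
qed

text \<open>Multiply \<open>X^j\<close> by \<open>(X + (1 - X))^(n - j) = 1\<close> and expand; the
  weight \<open>n - j choose (k - j)\<close> is rewritten by \<open>choose_mult\<close>. The terms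
  with \<open>k < j\<close> vanish because \<open>k choose j = 0\<close>.\<close>

lemma X_power_eq_bernstein_sum:
  assumes "j \<le> n"
  shows "[:0, 1::real:] ^ j =
    (\<Sum>k\<le>n. smult (real (k choose j) / real (n choose j) * real (n choose k)) ([:0, 1:] ^ k * [:1, - 1:] ^ (n - k)))"
    (is "_ = sum ?f _")
proof -
  let ?X = "[:0, 1::real:]" and ?Y = "[:1, - 1::real:]"
  have one: "?X + ?Y = 1" by simp
  have w: "real (k choose j) / real (n choose j) * real (n choose k) = real (n - j choose (k - j))"
    if "j \<le> k" "k \<le> n" for k
  proof -
    have "(n choose k) * (k choose j) = (n choose j) * ((n - j) choose (k - j))"
      using choose_mult[OF that] .
    then have "real (n choose k) * real (k choose j) = real (n choose j) * real ((n - j) choose (k - j))"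
      by (metis of_nat_mult)
    moreover have "real (n choose j) \<noteq> 0" using assms by simp
    ultimately show ?thesis by (simp add: divide_simps mult.commute)
  qed
  have "?X ^ j = ?X ^ j * (?X + ?Y) ^ (n - j)"
    unfolding one by simp
  also have "\<dots> = (\<Sum>i\<le>n - j. ?X ^ j * (of_nat (n - j choose i) * ?X ^ i * ?Y ^ (n - j - i)))"
    by (simp only: binomial_ring sum_distrib_left)
  also have "\<dots> = (\<Sum>i\<le>n - j. ?f (i + j))"
  proof (rule sum.cong[OF refl])
    fix i assume "i \<in> {..n - j}"
    then have i: "i + j \<le> n" using assms by auto
    have "n - j - i = n - (i + j)" using i by simp
    then show "?X ^ j * (of_nat (n - j choose i) * ?X ^ i * ?Y ^ (n - j - i)) = ?f (i + j)"
      unfolding w[OF le_add2 i] by (simp add: power_add of_nat_poly mult_ac)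
  qed
  also have "\<dots> = sum ?f {j..n}"
    by (rule sum.reindex_bij_witness[of _ "\<lambda>k. k - j" "\<lambda>i. i + j"]) (use assms in auto)
  also have "\<dots> = sum ?f {..n}"
    by (rule sum.mono_neutral_left) auto
  finally show ?thesis .
qed

text \<open>Hausdorff's argument for the moment problem: in the expansion of \<open>p\<close> along the Bernstein basis of
  degree \<open>n\<close>, the \<open>k\<close>-th coefficient tends to \<open>p (k / n)\<close>, uniformly in \<open>k\<close>.\<close>

lemma bernstein_positive_functional:
  fixes L :: "real poly \<Rightarrow> real"
  assumes add: "\<And>p q. L (p + q) = L p + L q" and smult: "\<And>c p. L (smult c p) = c * L p"
    and basis: "\<And>k l. 0 \<le> L ([:0, 1:] ^ k * [:1, - 1:] ^ l)"
    and p: "\<And>t. 0 \<le> t \<Longrightarrow> t \<le> 1 \<Longrightarrow> 0 \<le> poly p t"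
  shows "0 \<le> L p"
proof -
  define d where "d = degree p"
  define A where "A = (\<Sum>j\<le>d. \<bar>coeff p j\<bar>)"
  \<comment> \<open>The value of \<open>L\<close> at the k-th Bernstein polynomial of degree
    \<open>n\<close>. These values are nonnegative and add up to \<open>L 1\<close>, so a
    coefficient error of at most c changes \<open>L p\<close> by at most
    \<open>c * L 1\<close>.\<close>
  define B where "B n k = real (n choose k) * L ([:0, 1:] ^ k * [:1, - 1:] ^ (n - k))" for n k
  have L0: "L 0 = 0" using smult[of 0 0] by simp
  have Lsum: "L (\<Sum>i\<in>I. f i) = (\<Sum>i\<in>I. L (f i))" if "finite I" for I :: "nat set" and f
    using that by (induction I rule: finite_induct) (simp_all add: L0 add)
  have LX: "L ([:0, 1:] ^ j) = (\<Sum>k\<le>n. real (k choose j) / real (n choose j) * B n k)" if "j \<le> n" for j n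
    by (subst X_power_eq_bernstein_sum[OF that]) (simp add: Lsum smult B_def mult_ac)
  have B1: "(\<Sum>k\<le>n. B n k) = L 1" for n
    using LX[of 0 n] by simp
  have B0: "0 \<le> B n k" for n k
    unfolding B_def by (simp add: basis)
  have ge: "L p \<ge> - (A * (real d * (real d / (real n - real d))) * L 1)" if n: "2 * d < n" for n
  proof -
    let ?e = "real d * (real d / (real n - real d))"
    have coef: "(\<Sum>j\<le>d. coeff p j * (real (k choose j) / real (n choose j))) \<ge> - (A * ?e)" if "k \<le> n" for k
    proof -
      have "poly p (real k / real n) - (\<Sum>j\<le>d. coeff p j * (real (k choose j) / real (n choose j)))
          = (\<Sum>j\<le>d. coeff p j * ((real k / real n) ^ j - real (k choose j) / real (n choose j)))"
        by (simp add: poly_altdef d_def sum_subtractf algebra_simps)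
      also have "\<dots> \<le> (\<Sum>j\<le>d. \<bar>coeff p j\<bar> * ?e)"
      proof (rule sum_mono)
        fix j assume "j \<in> {..d}"
        then have j: "j \<le> d" by simp
        have "\<bar>(real k / real n) ^ j - real (k choose j) / real (n choose j)\<bar> \<le> real j * (real j / (real n - real j))"
          using choose_ratio_power_diff_le[of j n k] j n that by (simp add: abs_minus_commute)
        also have "\<dots> \<le> ?e"
          using j n by (intro mult_mono frac_le) auto
        finally have "\<bar>coeff p j\<bar> * \<bar>(real k / real n) ^ j - real (k choose j) / real (n choose j)\<bar> \<le> \<bar>coeff p j\<bar> * ?e"
          by (intro mult_left_mono) auto
        then show "coeff p j * ((real k / real n) ^ j - real (k choose j) / real (n choose j)) \<le> \<bar>coeff p j\<bar> * ?e"
          unfolding abs_mult[symmetric] by (rule order_trans[OF abs_ge_self])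
      qed
      also have "\<dots> = A * ?e" by (simp only: A_def sum_distrib_right)
      finally have "poly p (real k / real n) - (\<Sum>j\<le>d. coeff p j * (real (k choose j) / real (n choose j))) \<le> A * ?e" .
      moreover have "0 \<le> poly p (real k / real n)"
        using n that by (intro p) auto
      ultimately show ?thesis by linarith
    qed
    have "p = (\<Sum>j\<le>d. smult (coeff p j) ([:0, 1:] ^ j))"
      unfolding d_def by (subst poly_as_sum_of_monoms[symmetric]) (simp add: monom_altdef)
    then have "L p = (\<Sum>j\<le>d. coeff p j * L ([:0, 1:] ^ j))"
      by (metis (no_types, lifting) Lsum finite_atMost smult sum.cong)
    also have "\<dots> = (\<Sum>j\<le>d. \<Sum>k\<le>n. coeff p j * (real (k choose j) / real (n choose j)) * B n k)"
    proof (rule sum.cong[OF refl])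
      fix j assume "j \<in> {..d}"
      then have "j \<le> n" using n by simp
      then show "coeff p j * L ([:0, 1:] ^ j) = (\<Sum>k\<le>n. coeff p j * (real (k choose j) / real (n choose j)) * B n k)"
        unfolding LX[OF \<open>j \<le> n\<close>] by (simp add: sum_distrib_left mult.assoc)
    qed
    also have "\<dots> = (\<Sum>k\<le>n. (\<Sum>j\<le>d. coeff p j * (real (k choose j) / real (n choose j))) * B n k)"
      by (subst sum.swap) (simp add: sum_distrib_right)
    also have "\<dots> \<ge> (\<Sum>k\<le>n. - (A * ?e) * B n k)"
      by (intro sum_mono mult_right_mono coef B0) auto
    also have "(\<Sum>k\<le>n. - (A * ?e) * B n k) = - (A * ?e * L 1)"
      by (simp only: sum_distrib_left[symmetric] B1) simp
    finally show ?thesis by simp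
  qed
  have "(\<lambda>n. - (A * (real d * (real d / (real n - real d))) * L 1)) \<longlonglongrightarrow> - (A * (real d * 0) * L 1)"
  proof (intro tendsto_intros)
    show "(\<lambda>n. real d / (real n - real d)) \<longlonglongrightarrow> 0"
      by (intro tendsto_divide_0[OF tendsto_const] filterlim_at_top_imp_at_infinity)
        (use filterlim_tendsto_add_at_top[OF tendsto_const[of "- real d"] filterlim_real_sequentially] in simp)
  qed
  then have "- (A * (real d * 0) * L 1) \<le> L p"
    by (rule LIMSEQ_le_const2) (use ge in \<open>auto intro!: exI[of _ "2 * d + 1"]\<close>)
  then show ?thesis by simp
qed

section \<open>Polynomials of an operator\<close>

definition op_poly :: "('h \<Rightarrow>\<^sub>L 'h) \<Rightarrow> real poly \<Rightarrow> ('h::real_normed_vector \<Rightarrow>\<^sub>L 'h)" where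
  "op_poly T p = fold_coeffs (\<lambda>a S. a *\<^sub>R id_blinfun + (T o\<^sub>L S)) p 0"

lemma op_poly_0 [simp]: "op_poly T 0 = 0"
  by (simp add: op_poly_def)

lemma op_poly_pCons [simp]: "op_poly T (pCons a p) = a *\<^sub>R id_blinfun + (T o\<^sub>L op_poly T p)"
  by (cases "p = 0 \<and> a = 0") (auto simp: op_poly_def)

lemma op_poly_1 [simp]: "op_poly T 1 = id_blinfun"
  by (simp add: one_pCons)

lemma op_poly_add: "op_poly T (p + q) = op_poly T p + op_poly T q"
  by (induction p q rule: poly_induct2) (auto intro!: blinfun_eqI simp: blinfun.bilinear_simps algebra_simps)

lemma op_poly_smult: "op_poly T (smult c p) = c *\<^sub>R op_poly T p"
  by (induction p) (auto intro!: blinfun_eqI simp: blinfun.bilinear_simps algebra_simps)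

lemma op_poly_diff: "op_poly T (p - q) = op_poly T p - op_poly T q"
  using op_poly_add[of T "p - q" q] by simp

lemma op_poly_mult: "op_poly T (p * q) = op_poly T p o\<^sub>L op_poly T q"
  by (induction p) (auto intro!: blinfun_eqI simp: blinfun.bilinear_simps op_poly_add op_poly_smult)

lemma op_poly_pcompose: "op_poly T (p \<circ>\<^sub>p q) = op_poly (op_poly T q) p"
  by (induction p) (simp_all add: pcompose_pCons op_poly_add op_poly_mult)

lemma op_poly_factor: "op_poly T (pCons 0 p) = op_poly T p o\<^sub>L T"
proof -
  have "op_poly T (pCons 0 p) = op_poly T (p * [:0, 1:])"
    by simp
  then show ?thesis
    by (simp only: op_poly_mult) (auto intro!: blinfun_eqI simp: blinfun.bilinear_simps)
qed

lemma continuous_on_op_poly: "continuous_on S (\<lambda>T. op_poly T p)"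
  by (induction p) (auto intro!: continuous_intros)

text \<open>The order relation 0 \<le> T \<le> 1 in a real inner product space. Complex linearity is
  left out, so that the calculus runs over the reals; it is recovered afterwards by passing to
  limits.\<close>

definition pos_contraction :: "('h::real_inner \<Rightarrow>\<^sub>L 'h) \<Rightarrow> bool" where
  "pos_contraction T \<longleftrightarrow> (\<forall>x y. inner (T x) y = inner x (T y)) \<and>
     (\<forall>x. 0 \<le> inner (T x) x) \<and> (\<forall>x. inner (T x) x \<le> inner x x)"

lemma pos_contraction_sym: "pos_contraction T \<Longrightarrow> inner (T x) y = inner x (T y)"
  and pos_contraction_nonneg: "pos_contraction T \<Longrightarrow> 0 \<le> inner (T x) x"
  and pos_contraction_le: "pos_contraction T \<Longrightarrow> inner (T x) x \<le> inner x x"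
  unfolding pos_contraction_def by blast+

lemma pos_contraction_0 [simp]: "pos_contraction 0"
  by (simp add: pos_contraction_def)

lemma op_poly_sym:
  assumes "pos_contraction T"
  shows "inner (op_poly T p x) y = inner x (op_poly T p y)"
proof (induction p arbitrary: x y)
  case (pCons a p)
  have "inner (T (op_poly T p x)) y = inner x (T (op_poly T p y))"
  proof -
    have "inner (T (op_poly T p x)) y = inner x (op_poly T p (T y))"
      using pCons.IH by (simp add: pos_contraction_sym[OF assms])
    also have "op_poly T p (T y) = T (op_poly T p y)"
      using op_poly_factor[of T p] by (metis (no_types, lifting) add_0 blinfun_apply_blinfun_compose op_poly_pCons scaleR_zero_left)
    finally show ?thesis .
  qed
  then show ?case
    by (simp add: blinfun.bilinear_simps inner_add_left inner_add_right)
qed simp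

text \<open>A square can be split between the two sides of the inner product, which lowers the
  exponents of \<open>X^k * (1 - X)^l\<close> by 2 until both are at most 1. With the Bernstein
  basis positive, \<open>bernstein_positive_functional\<close> applies to the functional
  \<open>p \<mapsto> inner (op_poly T p x) x\<close>.\<close>

lemma op_poly_nonneg:
  assumes T: "pos_contraction T" and p: "\<And>t. 0 \<le> t \<Longrightarrow> t \<le> 1 \<Longrightarrow> 0 \<le> poly p t"
  shows "0 \<le> inner (op_poly T p x) x"
proof -
  have sq: "inner (op_poly T (p * p * q) x) x = inner (op_poly T q (op_poly T p x)) (op_poly T p x)" for p q x
  proof -
    have "p * p * q = p * (q * p)" by (simp add: mult_ac)
    then show ?thesis by (simp only: op_poly_mult blinfun_apply_blinfun_compose op_poly_sym[OF T])
  qed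
  have lin: "0 \<le> inner (op_poly T [:0, 1:] x) x" "0 \<le> inner (op_poly T [:1, - 1:] x) x" for x
    using pos_contraction_nonneg[OF T, of x] pos_contraction_le[OF T, of x]
    by (simp_all add: blinfun.bilinear_simps inner_diff_left)
  have basis: "0 \<le> inner (op_poly T ([:0, 1:] ^ k * [:1, - 1:] ^ l) x) x" for k l x
  proof (induction "k + l" arbitrary: k l x rule: less_induct)
    case less
    consider k' where "k = Suc (Suc k')" | l' where "l = Suc (Suc l')" | "k \<le> 1" "l \<le> 1"
      by (metis One_nat_def Suc_le_mono not0_implies_Suc zero_le le_Suc_eq)
    then show ?case
    proof cases
      case 1
      have "[:0, 1::real:] ^ k * [:1, - 1:] ^ l = [:0, 1:] * [:0, 1:] * ([:0, 1:] ^ k' * [:1, - 1:] ^ l)"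
        unfolding 1 power_Suc by (simp only: mult.assoc)
      then show ?thesis
        using less(1)[of k' l] unfolding 1 by (simp only: sq)
    next
      case 2
      have "[:0, 1::real:] ^ k * [:1, - 1:] ^ l = [:1, - 1:] * [:1, - 1:] * ([:0, 1:] ^ k * [:1, - 1:] ^ l')"
        unfolding 2 power_Suc by (simp only: mult_ac)
      then show ?thesis
        using less(1)[of k l'] unfolding 2 by (simp only: sq)
    next
      case 3
      have "0 \<le> inner (op_poly T ([:0, 1:] * [:1, - 1:]) x) x"
      proof -
        \<comment> \<open>The only mixed case. Multiplying \<open>X * (1 - X)\<close> by
          \<open>X + (1 - X) = 1\<close> makes a square appear in each summand.\<close>
        have eq: "[:0, 1::real:] * [:1, - 1:] = [:0, 1:] * [:0, 1:] * [:1, - 1:] + [:1, - 1:] * [:1, - 1:] * [:0, 1:]"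
          by simp
        have "op_poly T ([:0, 1:] * [:1, - 1:])
            = op_poly T ([:0, 1:] * [:0, 1:] * [:1, - 1:]) + op_poly T ([:1, - 1:] * [:1, - 1:] * [:0, 1:])"
          by (subst eq) (rule op_poly_add)
        then show ?thesis
          by (simp only: blinfun.add_left inner_add_left sq) (intro add_nonneg_nonneg lin)
      qed
      moreover have "k = 0 \<or> k = 1" "l = 0 \<or> l = 1" using 3 by auto
      ultimately show ?thesis
        using lin by (auto simp del: op_poly_pCons mult_pCons_left mult_pCons_right)
    qed
  qed
  show ?thesis
    by (rule bernstein_positive_functional[where L = "\<lambda>p. inner (op_poly T p x) x"])
      (use basis p in \<open>auto simp: op_poly_add op_poly_smult blinfun.bilinear_simps inner_add_left
        simp del: op_poly_pCons\<close>)
qed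

text \<open>Positivity of \<open>[:c\<^sup>2:] - p * p\<close> at \<open>T\<close> says that the
  squared norm of p(T)x is at most that of c x.\<close>

lemma norm_op_poly_le:
  assumes T: "pos_contraction T" and c: "0 \<le> c" and p: "\<And>t. 0 \<le> t \<Longrightarrow> t \<le> 1 \<Longrightarrow> \<bar>poly p t\<bar> \<le> c"
  shows "norm (op_poly T p) \<le> c"
proof (rule norm_blinfun_bound[OF c])
  fix x
  have "0 \<le> inner (op_poly T ([:c\<^sup>2:] - p * p) x) x"
  proof (rule op_poly_nonneg[OF T])
    fix t :: real assume "0 \<le> t" "t \<le> 1"
    then have "\<bar>poly p t\<bar>\<^sup>2 \<le> c\<^sup>2"
      by (intro power_mono p) auto
    then show "0 \<le> poly ([:c\<^sup>2:] - p * p) t"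
      by (simp add: power2_eq_square)
  qed
  also have "inner (op_poly T ([:c\<^sup>2:] - p * p) x) x = (c * norm x)\<^sup>2 - (norm (op_poly T p x))\<^sup>2"
    by (simp add: op_poly_diff op_poly_mult blinfun.bilinear_simps inner_diff_left
        op_poly_sym[OF T, of p "op_poly T p x"] power_mult_distrib flip: power2_norm_eq_inner)
  finally have "(norm (op_poly T p x))\<^sup>2 \<le> (c * norm x)\<^sup>2" by simp
  then show "norm (op_poly T p x) \<le> c * norm x"
    by (rule power2_le_imp_le) (simp add: c)
qed

section \<open>Continuous functional calculus for positive contractions\<close>

lemma uniform_limit_poly_exists:
  assumes "continuous_on {0..1::real} f"
  obtains p where "\<And>n t. 0 \<le> t \<Longrightarrow> t \<le> 1 \<Longrightarrow> \<bar>f t - poly (p n) t\<bar> \<le> inverse (real (Suc n))"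
    and "uniform_limit {0..1} (\<lambda>n. poly (p n)) f sequentially"
proof -
  have "\<exists>p. \<forall>t\<in>{0..1}. \<bar>f t - poly p t\<bar> < inverse (real (Suc n))" for n
  proof -
    obtain g where g: "real_polynomial_function g" "\<And>t. t \<in> {0..1} \<Longrightarrow> \<bar>f t - g t\<bar> < inverse (real (Suc n))"
      using Stone_Weierstrass_real_polynomial_function[OF compact_Icc assms, of "inverse (real (Suc n))"] by auto
    then obtain a m where "g = (\<lambda>x. \<Sum>i\<le>m. a i * x ^ i)"
      using real_polynomial_function_iff_sum by metis
    then have "g = poly (\<Sum>i\<le>m. monom (a i) i)"
      by (auto simp: poly_sum poly_monom)
    then show ?thesis using g(2) by blast
  qed
  then obtain p where p: "\<And>n t. t \<in> {0..1} \<Longrightarrow> \<bar>f t - poly (p n) t\<bar> < inverse (real (Suc n))" by metis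
  show ?thesis
  proof (rule that)
    show "\<bar>f t - poly (p n) t\<bar> \<le> inverse (real (Suc n))" if "0 \<le> t" "t \<le> 1" for n t
      using p[of t n] that by simp
    show "uniform_limit {0..1} (\<lambda>n. poly (p n)) f sequentially"
    proof (rule uniform_limitI)
      fix e :: real assume "0 < e"
      then obtain N where N: "inverse (real (Suc N)) < e" using reals_Archimedean by blast
      show "\<forall>\<^sub>F n in sequentially. \<forall>t\<in>{0..1}. dist (poly (p n) t) (f t) < e"
      proof (rule eventually_sequentiallyI[of N], intro ballI)
        fix n t assume "N \<le> n" "t \<in> {0..1::real}"
        moreover have "inverse (real (Suc n)) \<le> inverse (real (Suc N))"
          using \<open>N \<le> n\<close> by (simp add: le_imp_inverse_le)
        ultimately show "dist (poly (p n) t) (f t) < e"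
          using p[of t n] N unfolding dist_real_def abs_minus_commute[of "poly (p n) t"] by linarith
      qed
    qed
  qed
qed

text \<open>The quantifier over all approximating sequences builds independence of the choice into
  the definition. It is meaningful for a positive contraction \<open>T\<close> and \<open>f\<close>
  continuous on [0,1], where \<open>fcalc_tendsto\<close> supplies the limit; values of
  \<open>f\<close> outside [0,1] do not enter.\<close>

definition fcalc :: "('h \<Rightarrow>\<^sub>L 'h) \<Rightarrow> (real \<Rightarrow> real) \<Rightarrow> ('h::{real_inner, banach} \<Rightarrow>\<^sub>L 'h)" where
  "fcalc T f = (THE S. \<forall>p. uniform_limit {0..1} (\<lambda>n. poly (p n)) f sequentially \<longrightarrow>
     (\<lambda>n. op_poly T (p n)) \<longlonglongrightarrow> S)"

lemma fcalc_cong: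
  assumes "\<And>t. 0 \<le> t \<Longrightarrow> t \<le> 1 \<Longrightarrow> f t = g t"
  shows "fcalc T f = fcalc T g"
proof -
  have "uniform_limit {0..1} (\<lambda>n. poly (p n)) f sequentially \<longleftrightarrow>
      uniform_limit {0..1} (\<lambda>n. poly (p n)) g sequentially" for p :: "nat \<Rightarrow> real poly"
    by (rule uniform_limit_cong') (simp_all add: assms)
  then show ?thesis unfolding fcalc_def by presburger
qed

text \<open>Two polynomials that are both close to \<open>f\<close> on [0,1] are close to each other
  there, and \<open>norm_op_poly_le\<close> transfers this to the operators. Applied to one sequence
  this is the Cauchy property, applied to two it shows that their limits agree.\<close>

lemma fcalc_tendsto:
  assumes T: "pos_contraction T" and f: "continuous_on {0..1} f"
    and p: "uniform_limit {0..1} (\<lambda>n. poly (p n)) f sequentially"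
  shows "(\<lambda>n. op_poly T (p n)) \<longlonglongrightarrow> fcalc T f"
proof -
  have close: "\<exists>N. \<forall>n\<ge>N. \<forall>m\<ge>N. norm (op_poly T (p n) - op_poly T (q m)) < e"
    if p: "uniform_limit {0..1} (\<lambda>n. poly (p n)) f sequentially"
      and q: "uniform_limit {0..1} (\<lambda>n. poly (q n)) f sequentially" and e: "0 < e" for p q e
  proof -
    have "0 < e / 3" using e by simp
    from eventually_conj[OF uniform_limitD[OF p this] uniform_limitD[OF q this]]
    obtain N where N: "\<And>n t. n \<ge> N \<Longrightarrow> t \<in> {0..1} \<Longrightarrow> dist (poly (p n) t) (f t) < e / 3"
      and N': "\<And>n t. n \<ge> N \<Longrightarrow> t \<in> {0..1} \<Longrightarrow> dist (poly (q n) t) (f t) < e / 3"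
      unfolding eventually_sequentially by blast
    have "norm (op_poly T (p n) - op_poly T (q m)) < e" if "n \<ge> N" "m \<ge> N" for n m
    proof -
      have "norm (op_poly T (p n - q m)) \<le> 2 * (e / 3)"
      proof (rule norm_op_poly_le[OF T])
        fix t :: real assume "0 \<le> t" "t \<le> 1"
        then show "\<bar>poly (p n - q m) t\<bar> \<le> 2 * (e / 3)"
          using N[OF that(1), of t] N'[OF that(2), of t] dist_triangle2[of "poly (p n) t" "poly (q m) t" "f t"]
          by (simp flip: dist_real_def)
      qed (use e in simp)
      then show ?thesis using e by (simp add: op_poly_diff)
    qed
    then show ?thesis by blast
  qed
  have lim: "\<exists>S. (\<lambda>n. op_poly T (p n)) \<longlonglongrightarrow> S"
    if p: "uniform_limit {0..1} (\<lambda>n. poly (p n)) f sequentially" for p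
    using close[OF p p] by (simp add: Cauchy_convergent_iff[symmetric] convergent_def[symmetric] Cauchy_iff)
  obtain S where S: "(\<lambda>n. op_poly T (p n)) \<longlonglongrightarrow> S" using lim[OF p] by blast
  have "fcalc T f = S"
    unfolding fcalc_def
  proof (rule the_equality)
    show "\<forall>q. uniform_limit {0..1} (\<lambda>n. poly (q n)) f sequentially \<longrightarrow> (\<lambda>n. op_poly T (q n)) \<longlonglongrightarrow> S"
    proof (intro allI impI)
      fix q assume q: "uniform_limit {0..1} (\<lambda>n. poly (q n)) f sequentially"
      have "(\<lambda>n. op_poly T (q n) - op_poly T (p n)) \<longlonglongrightarrow> 0"
        unfolding LIMSEQ_iff using close[OF q p] by (metis diff_zero)
      from tendsto_add[OF this S] show "(\<lambda>n. op_poly T (q n)) \<longlonglongrightarrow> S" by simp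
    qed
    show "S' = S" if "\<forall>q. uniform_limit {0..1} (\<lambda>n. poly (q n)) f sequentially \<longrightarrow> (\<lambda>n. op_poly T (q n)) \<longlonglongrightarrow> S'" for S'
      using that p S LIMSEQ_unique by blast
  qed
  then show ?thesis using S by simp
qed

context
  fixes T :: "'h::{real_inner, banach} \<Rightarrow>\<^sub>L 'h"
  assumes T: "pos_contraction T"
begin

lemma fcalc_eq_op_poly:
  assumes "\<And>t. 0 \<le> t \<Longrightarrow> t \<le> 1 \<Longrightarrow> f t = poly p t"
  shows "fcalc T f = op_poly T p"
proof -
  have "uniform_limit {0..1} (\<lambda>n. poly p) f sequentially"
    by (rule uniform_limit_cong'[THEN iffD1, OF _ _ uniform_limit_const]) (simp_all add: assms)
  moreover have "continuous_on {0..1} f"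
    using continuous_on_cong[of "{0..1}" "{0..1}" f "poly p"] assms
    by (simp add: continuous_on_poly)
  ultimately show ?thesis
    using LIMSEQ_unique[OF fcalc_tendsto[OF T] tendsto_const] by blast
qed

lemma fcalc_id: "(\<And>t. 0 \<le> t \<Longrightarrow> t \<le> 1 \<Longrightarrow> f t = t) \<Longrightarrow> fcalc T f = T"
  by (subst fcalc_eq_op_poly[where p = "[:0, 1:]"]) (auto intro!: blinfun_eqI simp: blinfun.bilinear_simps)

lemma fcalc_mult:
  assumes f: "continuous_on {0..1} f" and g: "continuous_on {0..1} g"
  shows "fcalc T (\<lambda>t. f t * g t) = fcalc T f o\<^sub>L fcalc T g"
proof -
  obtain p where p: "uniform_limit {0..1} (\<lambda>n. poly (p n)) f sequentially"
    using uniform_limit_poly_exists[OF f] by metis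
  obtain q where q: "uniform_limit {0..1} (\<lambda>n. poly (q n)) g sequentially"
    using uniform_limit_poly_exists[OF g] by metis
  have bdd: "bounded (f ` {0..1})" "bounded (g ` {0..1})"
    using f g by (auto intro!: compact_imp_bounded compact_continuous_image)
  have "uniform_limit {0..1} (\<lambda>n. poly (p n * q n)) (\<lambda>t. f t * g t) sequentially"
    using uniform_lim_mult[OF p q bdd] by (simp add: poly_mult[abs_def])
  then have "(\<lambda>n. op_poly T (p n * q n)) \<longlonglongrightarrow> fcalc T (\<lambda>t. f t * g t)"
    by (intro fcalc_tendsto[OF T] continuous_intros f g)
  moreover have "(\<lambda>n. op_poly T (p n * q n)) \<longlonglongrightarrow> (fcalc T f o\<^sub>L fcalc T g)"
    unfolding op_poly_mult
    by (intro bounded_bilinear.tendsto[OF bounded_bilinear_blinfun_compose] fcalc_tendsto[OF T] f g p q)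
  ultimately show ?thesis by (rule LIMSEQ_unique)
qed

lemma fcalc_diff:
  assumes f: "continuous_on {0..1} f" and g: "continuous_on {0..1} g"
  shows "fcalc T (\<lambda>t. f t - g t) = fcalc T f - fcalc T g"
proof -
  obtain p where p: "uniform_limit {0..1} (\<lambda>n. poly (p n)) f sequentially"
    using uniform_limit_poly_exists[OF f] by metis
  obtain q where q: "uniform_limit {0..1} (\<lambda>n. poly (q n)) g sequentially"
    using uniform_limit_poly_exists[OF g] by metis
  have "uniform_limit {0..1} (\<lambda>n. poly (p n - q n)) (\<lambda>t. f t - g t) sequentially"
    using uniform_limit_minus[OF p q] by (simp add: poly_diff[abs_def])
  then have "(\<lambda>n. op_poly T (p n - q n)) \<longlonglongrightarrow> fcalc T (\<lambda>t. f t - g t)"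
    by (intro fcalc_tendsto[OF T] continuous_intros f g)
  moreover have "(\<lambda>n. op_poly T (p n - q n)) \<longlonglongrightarrow> fcalc T f - fcalc T g"
    unfolding op_poly_diff by (intro tendsto_intros fcalc_tendsto[OF T] f g p q)
  ultimately show ?thesis by (rule LIMSEQ_unique)
qed

lemma op_poly_fcalc_power:
  assumes f: "continuous_on {0..1} f"
  shows "op_poly (fcalc T f) ([:0, 1:] ^ n) = fcalc T (\<lambda>t. f t ^ n)"
proof (induction n)
  case 0
  then show ?case by (simp add: fcalc_eq_op_poly[where p = 1])
next
  case (Suc n)
  have "op_poly (fcalc T f) ([:0, 1:] ^ Suc n) = fcalc T f o\<^sub>L fcalc T (\<lambda>t. f t ^ n)"
    using Suc by (simp add: op_poly_mult)
  also have "\<dots> = fcalc T (\<lambda>t. f t * f t ^ n)"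
    by (intro fcalc_mult[symmetric] continuous_intros f)
  finally show ?case by simp
qed

lemma fcalc_sym:
  assumes f: "continuous_on {0..1} f"
  shows "inner (fcalc T f x) y = inner x (fcalc T f y)"
proof -
  obtain p where p: "uniform_limit {0..1} (\<lambda>n. poly (p n)) f sequentially"
    using uniform_limit_poly_exists[OF f] by metis
  note lim = fcalc_tendsto[OF T f p]
  have "(\<lambda>n. inner (op_poly T (p n) x) y) \<longlonglongrightarrow> inner (fcalc T f x) y"
    by (intro tendsto_intros lim)
  moreover have "(\<lambda>n. inner x (op_poly T (p n) y)) \<longlonglongrightarrow> inner x (fcalc T f y)"
    by (intro tendsto_intros lim)
  ultimately show ?thesis
    using LIMSEQ_unique by (simp add: op_poly_sym[OF T]) blast
qed

lemma fcalc_nonneg: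
  assumes f: "continuous_on {0..1} f" and nonneg: "\<And>t. 0 \<le> t \<Longrightarrow> t \<le> 1 \<Longrightarrow> 0 \<le> f t"
  shows "0 \<le> inner (fcalc T f x) x"
proof -
  obtain p where p: "\<And>n t. 0 \<le> t \<Longrightarrow> t \<le> 1 \<Longrightarrow> \<bar>f t - poly (p n) t\<bar> \<le> inverse (real (Suc n))"
    and lim: "uniform_limit {0..1} (\<lambda>n. poly (p n)) f sequentially"
    using uniform_limit_poly_exists[OF f] by metis
  \<comment> \<open>The approximants may dip below 0, by no more than
    \<open>inverse (real (Suc n))\<close>; adding this constant restores positivity and disappears
    in the limit.\<close>
  have "0 \<le> inner (op_poly T (p n + [:inverse (real (Suc n)):]) x) x" for n
  proof (rule op_poly_nonneg[OF T])
    fix t :: real assume t: "0 \<le> t" "t \<le> 1"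
    show "0 \<le> poly (p n + [:inverse (real (Suc n)):]) t"
      using p[OF t, of n] nonneg[OF t] by auto
  qed
  then have ge: "0 \<le> inner (op_poly T (p n) x) x + inverse (real (Suc n)) * inner x x" for n
    by (simp add: op_poly_add blinfun.bilinear_simps inner_add_left)
  have "(\<lambda>n. inner (op_poly T (p n) x) x + inverse (real (Suc n)) * inner x x)
      \<longlonglongrightarrow> inner (fcalc T f x) x + 0 * inner x x"
    by (intro tendsto_intros fcalc_tendsto[OF T f lim] LIMSEQ_inverse_real_of_nat)
  then show ?thesis
    using LIMSEQ_le_const ge by fastforce
qed

text \<open>The bound does not involve \<open>T\<close>: one polynomial serves all positive
  contractions at once, which is the reason for \<open>continuous_on_fcalc\<close>.\<close>

lemma norm_fcalc_diff_op_poly_le: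
  assumes f: "continuous_on {0..1} f" and c: "0 \<le> c"
    and p: "\<And>t. 0 \<le> t \<Longrightarrow> t \<le> 1 \<Longrightarrow> \<bar>f t - poly p t\<bar> \<le> c"
  shows "norm (fcalc T f - op_poly T p) \<le> c"
proof -
  obtain q where q: "\<And>n t. 0 \<le> t \<Longrightarrow> t \<le> 1 \<Longrightarrow> \<bar>f t - poly (q n) t\<bar> \<le> inverse (real (Suc n))"
    and lim: "uniform_limit {0..1} (\<lambda>n. poly (q n)) f sequentially"
    using uniform_limit_poly_exists[OF f] by metis
  have "norm (op_poly T (q n) - op_poly T p) \<le> c + inverse (real (Suc n))" for n
    unfolding op_poly_diff[symmetric]
  proof (rule norm_op_poly_le[OF T])
    fix t :: real assume t: "0 \<le> t" "t \<le> 1"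
    show "\<bar>poly (q n - p) t\<bar> \<le> c + inverse (real (Suc n))"
      using q[OF t, of n] p[OF t] by (auto simp: abs_if split: if_splits)
  qed (use c in simp)
  moreover have "(\<lambda>n. norm (op_poly T (q n) - op_poly T p)) \<longlonglongrightarrow> norm (fcalc T f - op_poly T p)"
    by (intro tendsto_intros fcalc_tendsto[OF T f lim])
  moreover have "(\<lambda>n. c + inverse (real (Suc n))) \<longlonglongrightarrow> c + 0"
    by (intro tendsto_intros LIMSEQ_inverse_real_of_nat)
  ultimately show ?thesis
    using LIMSEQ_le by fastforce
qed

lemma norm_fcalc_le:
  assumes "continuous_on {0..1} f" and "0 \<le> c" and "\<And>t. 0 \<le> t \<Longrightarrow> t \<le> 1 \<Longrightarrow> \<bar>f t\<bar> \<le> c"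
  shows "norm (fcalc T f) \<le> c"
  using norm_fcalc_diff_op_poly_le[of f c 0] assms by simp

lemma pos_contraction_fcalc:
  assumes f: "continuous_on {0..1} f" and range: "\<And>t. 0 \<le> t \<Longrightarrow> t \<le> 1 \<Longrightarrow> 0 \<le> f t \<and> f t \<le> 1"
  shows "pos_contraction (fcalc T f)"
  unfolding pos_contraction_def
proof (intro conjI allI)
  fix x y
  show "inner (fcalc T f x) y = inner x (fcalc T f y)" by (rule fcalc_sym[OF f])
  show "0 \<le> inner (fcalc T f x) x" using fcalc_nonneg[OF f] range by blast
  have "0 \<le> inner (fcalc T (\<lambda>t. 1 - f t) x) x"
    by (intro fcalc_nonneg continuous_intros f) (use range in auto)
  also have "fcalc T (\<lambda>t. 1 - f t) = id_blinfun - fcalc T f"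
    by (subst fcalc_diff) (auto intro!: continuous_intros f simp: fcalc_eq_op_poly[where p = 1])
  finally show "inner (fcalc T f x) x \<le> inner x x"
    by (simp add: blinfun.bilinear_simps inner_diff_left)
qed

text \<open>The composition rule f(q(T)) = (f o q)(T). With \<open>f\<close> a root and
  \<open>q\<close> a power it gives uniqueness of positive roots.\<close>

lemma fcalc_op_poly:
  assumes f: "continuous_on {0..1} f" and q: "\<And>t. 0 \<le> t \<Longrightarrow> t \<le> 1 \<Longrightarrow> 0 \<le> poly q t \<and> poly q t \<le> 1"
  shows "fcalc (op_poly T q) f = fcalc T (\<lambda>t. f (poly q t))"
proof -
  obtain p where p: "uniform_limit {0..1} (\<lambda>n. poly (p n)) f sequentially"
    using uniform_limit_poly_exists[OF f] by metis
  have T': "pos_contraction (op_poly T q)"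
    using pos_contraction_fcalc[of "poly q"] q fcalc_eq_op_poly[of "poly q" q] by (simp add: continuous_on_poly)
  have fq: "continuous_on {0..1} (\<lambda>t. f (poly q t))"
    by (rule continuous_on_compose2[OF f]) (use q in \<open>auto intro!: continuous_intros\<close>)
  have "uniform_limit {0..1} (\<lambda>n. poly (p n \<circ>\<^sub>p q)) (\<lambda>t. f (poly q t)) sequentially"
    unfolding poly_pcompose by (rule uniform_limit_compose'[OF p]) (use q in auto)
  from fcalc_tendsto[OF T fq this] have "(\<lambda>n. op_poly (op_poly T q) (p n)) \<longlonglongrightarrow> fcalc T (\<lambda>t. f (poly q t))"
    by (simp only: op_poly_pcompose)
  with fcalc_tendsto[OF T' f p] show ?thesis by (rule LIMSEQ_unique)
qed

text \<open>Since \<open>f 0 = 0\<close>, the constant terms of the approximants tend to 0 and may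
  be dropped, after which \<open>T\<close> splits off. Through this factor the limit inherits
  compactness, complex linearity and the kernel of \<open>T\<close>.\<close>

lemma fcalc_factor:
  assumes f: "continuous_on {0..1} f" and f0: "f 0 = 0"
  obtains q where "(\<lambda>n. op_poly T (q n) o\<^sub>L T) \<longlonglongrightarrow> fcalc T f"
proof -
  obtain p where p: "uniform_limit {0..1} (\<lambda>n. poly (p n)) f sequentially"
    using uniform_limit_poly_exists[OF f] by metis
  have "(\<lambda>n. poly (p n) 0) \<longlonglongrightarrow> f 0"
    using tendsto_uniform_limitI[OF p, of 0] by simp
  then have lim0: "(\<lambda>n. poly (p n) 0 *\<^sub>R (id_blinfun :: 'h \<Rightarrow>\<^sub>L 'h)) \<longlonglongrightarrow> f 0 *\<^sub>R id_blinfun"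
    by (intro tendsto_intros)
  have split: "op_poly T (p n) - poly (p n) 0 *\<^sub>R id_blinfun = op_poly T (poly_shift 1 (p n)) o\<^sub>L T" for n
  proof -
    have eq: "p n = pCons (poly (p n) 0) (poly_shift 1 (p n))"
      by (rule poly_eqI) (simp add: coeff_pCons coeff_poly_shift poly_0_coeff_0 split: nat.split)
    have "op_poly T (p n) = poly (p n) 0 *\<^sub>R id_blinfun + op_poly T (pCons 0 (poly_shift 1 (p n)))"
      by (subst eq) simp
    then show ?thesis
      by (simp only: op_poly_factor) simp
  qed
  show ?thesis
    using tendsto_diff[OF fcalc_tendsto[OF T f p] lim0] unfolding split by (intro that) (simp add: f0)
qed

end

lemma continuous_on_fcalc:
  assumes f: "continuous_on {0..1} f"
  shows "continuous_on {T :: 'h::{real_inner, banach} \<Rightarrow>\<^sub>L 'h. pos_contraction T} (\<lambda>T. fcalc T f)"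
proof -
  obtain p where p: "\<And>n t. 0 \<le> t \<Longrightarrow> t \<le> 1 \<Longrightarrow> \<bar>f t - poly (p n) t\<bar> \<le> inverse (real (Suc n))"
    using uniform_limit_poly_exists[OF f] by metis
  show ?thesis
  proof (rule uniform_limit_theorem[where F = sequentially and f = "\<lambda>n T. op_poly T (p n)"])
    show "uniform_limit {T :: 'h \<Rightarrow>\<^sub>L 'h. pos_contraction T} (\<lambda>n T. op_poly T (p n)) (\<lambda>T. fcalc T f) sequentially"
    proof (rule uniform_limitI)
      fix e :: real assume "0 < e"
      then obtain N where N: "inverse (real (Suc N)) < e" using reals_Archimedean by blast
      show "\<forall>\<^sub>F n in sequentially. \<forall>T\<in>{T :: 'h \<Rightarrow>\<^sub>L 'h. pos_contraction T}. dist (op_poly T (p n)) (fcalc T f) < e"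
      proof (rule eventually_sequentiallyI[of N], intro ballI)
        fix n and T :: "'h \<Rightarrow>\<^sub>L 'h" assume "N \<le> n" "T \<in> {T. pos_contraction T}"
        then have "norm (fcalc T f - op_poly T (p n)) \<le> inverse (real (Suc n))"
          by (intro norm_fcalc_diff_op_poly_le f p) auto
        also have "\<dots> \<le> inverse (real (Suc N))"
          using \<open>N \<le> n\<close> by (simp add: le_imp_inverse_le)
        finally show "dist (op_poly T (p n)) (fcalc T f) < e"
          using N by (simp add: dist_norm norm_minus_commute)
      qed
    qed
  qed (auto intro!: always_eventually continuous_on_op_poly)
qed


section \<open>Roots of positive contractions\<close>

definition root_op :: "nat \<Rightarrow> ('h \<Rightarrow>\<^sub>L 'h) \<Rightarrow> ('h::{real_inner, banach} \<Rightarrow>\<^sub>L 'h)" where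
  "root_op n T = fcalc T (root n)"

lemma continuous_on_root: "0 < n \<Longrightarrow> continuous_on S (root n)"
  by (intro continuous_on_real_root continuous_on_id)

lemma continuous_on_root_op: "0 < n \<Longrightarrow> continuous_on {T. pos_contraction T} (root_op n)"
  unfolding root_op_def by (intro continuous_on_fcalc continuous_on_root)

text \<open>With \<open>s = root n t\<close> the geometric sum \<open>1 + s + ... + s^(n-1)\<close>
  is at least \<open>n * s^n = n * t\<close>, while its product with \<open>1 - s\<close> is
  \<open>1 - s^n \<le> 1\<close>.\<close>

lemma mult_one_minus_root_le:
  assumes n: "0 < n" and t: "0 \<le> t" "t \<le> 1"
  shows "t * (1 - root n t) \<le> inverse (real n)"
proof -
  define s where "s = root n t"
  have s: "0 \<le> s" "s \<le> 1" "s ^ n = t" using assms by (simp_all add: s_def)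
  have "real n * s ^ n = (\<Sum>i<n. s ^ n)" by simp
  also have "\<dots> \<le> (\<Sum>i<n. s ^ i)"
    using s by (intro sum_mono power_decreasing) auto
  finally have "(1 - s) * (real n * t) \<le> (1 - s) * (\<Sum>i<n. s ^ i)"
    using s by (intro mult_left_mono) auto
  also have "\<dots> = 1 - s ^ n" by (simp add: one_diff_power_eq)
  also have "\<dots> \<le> 1" using s t by simp
  finally show ?thesis using n by (simp add: s_def field_simps)
qed

text \<open>Each claim is an identity or an estimate between functions on [0,1]. The two norm bounds
  say that the roots form an approximate unit for \<open>T\<close>, at a rate that depends on
  \<open>n\<close> alone. The double root exhibits \<open>T^(1/n)\<close> as a square, the shape
  that membership in \<open>C0K_pos\<close> asks for.\<close>

lemma
  assumes T: "pos_contraction T" and n: "0 < n"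
  shows pos_contraction_root_op: "pos_contraction (root_op n T)"
    and op_poly_root_op_power: "op_poly (root_op n T) ([:0, 1:] ^ n) = T"
    and root_op_double: "root_op (2 * n) T o\<^sub>L root_op (2 * n) T = root_op n T"
    and norm_root_op_mult_diff_le: "norm ((root_op n T o\<^sub>L T) - T) \<le> inverse (real n)"
    and norm_root_op_conj_diff_le: "norm ((root_op n T o\<^sub>L T o\<^sub>L root_op n T) - T) \<le> 2 * inverse (real n)"
proof -
  note cont = continuous_on_root[OF n, of "{0..1}"]
  show "pos_contraction (root_op n T)"
    unfolding root_op_def by (rule pos_contraction_fcalc[OF T cont]) (simp add: n)
  show "op_poly (root_op n T) ([:0, 1:] ^ n) = T"
    unfolding root_op_def op_poly_fcalc_power[OF T cont] by (rule fcalc_id[OF T]) (simp add: n)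
  have "fcalc T (\<lambda>t. root (2 * n) t * root (2 * n) t) = fcalc T (root n)"
  proof (rule fcalc_cong)
    fix t :: real assume t: "0 \<le> t"
    have "root n (root 2 t) * root n (root 2 t) = root n (root 2 t * root 2 t)"
      by (simp add: real_root_mult)
    also have "root 2 t * root 2 t = t"
      using t by (simp flip: sqrt_def)
    finally show "root (2 * n) t * root (2 * n) t = root n t"
      by (simp add: real_root_mult_exp mult.commute[of 2 n])
  qed
  then show "root_op (2 * n) T o\<^sub>L root_op (2 * n) T = root_op n T"
    unfolding root_op_def using n by (subst fcalc_mult[OF T, symmetric]) (auto intro!: continuous_on_root)
  have id: "T = fcalc T (\<lambda>t. t)"
    by (simp add: fcalc_id[OF T])
  have cont': "continuous_on {0..1} (\<lambda>t. root n t * t)" "continuous_on {0..1} (\<lambda>t. root n t * t * root n t)"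
    by (intro continuous_intros cont)+
  have eq: "root_op n T o\<^sub>L T = fcalc T (\<lambda>t. root n t * t)"
    unfolding root_op_def by (subst fcalc_mult[OF T cont]) (auto intro!: continuous_intros simp: id[symmetric])
  have eq': "root_op n T o\<^sub>L T o\<^sub>L root_op n T = fcalc T (\<lambda>t. root n t * t * root n t)"
    unfolding eq unfolding root_op_def by (rule fcalc_mult[OF T cont'(1) cont, symmetric])
  have "norm (fcalc T (\<lambda>t. root n t * t - t)) \<le> inverse (real n)"
  proof (rule norm_fcalc_le[OF T])
    fix t :: real assume t: "0 \<le> t" "t \<le> 1"
    have "root n t * t - t = - (t * (1 - root n t))"
      by (simp add: algebra_simps)
    moreover have "0 \<le> t * (1 - root n t)"
      using t n by (intro mult_nonneg_nonneg) auto
    ultimately have "\<bar>root n t * t - t\<bar> = t * (1 - root n t)" by simp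
    then show "\<bar>root n t * t - t\<bar> \<le> inverse (real n)"
      using mult_one_minus_root_le[OF n t] by simp
  qed (auto intro!: continuous_intros cont)
  then show "norm ((root_op n T o\<^sub>L T) - T) \<le> inverse (real n)"
    by (subst (asm) fcalc_diff[OF T cont'(1)]) (auto intro!: continuous_intros simp: id[symmetric] eq)
  have "norm (fcalc T (\<lambda>t. root n t * t * root n t - t)) \<le> 2 * inverse (real n)"
  proof (rule norm_fcalc_le[OF T])
    fix t :: real assume t: "0 \<le> t" "t \<le> 1"
    have r: "0 \<le> root n t" "root n t \<le> 1" using t n by simp_all
    have "\<bar>root n t * t * root n t - t\<bar> = t * (1 - root n t) * (1 + root n t)"
    proof -
      have "root n t * t * root n t - t = - (t * (1 - root n t) * (1 + root n t))"
        by (simp add: algebra_simps)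
      moreover have "0 \<le> t * (1 - root n t) * (1 + root n t)"
        using t r by (intro mult_nonneg_nonneg) auto
      ultimately show ?thesis by simp
    qed
    also have "\<dots> \<le> inverse (real n) * 2"
      using mult_one_minus_root_le[OF n t] r by (intro mult_mono) auto
    finally show "\<bar>root n t * t * root n t - t\<bar> \<le> 2 * inverse (real n)" by simp
  qed (auto intro!: continuous_intros cont)
  then show "norm ((root_op n T o\<^sub>L T o\<^sub>L root_op n T) - T) \<le> 2 * inverse (real n)"
    by (subst (asm) fcalc_diff[OF T cont'(2)]) (auto intro!: continuous_intros simp: id[symmetric] eq')
qed

lemma root_op_unique:
  assumes S: "pos_contraction S" and n: "0 < n"
  shows "root_op n (op_poly S ([:0, 1:] ^ n)) = S"
  unfolding root_op_def
  by (subst fcalc_op_poly[OF S continuous_on_root[OF n]])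
    (auto simp: poly_power power_le_one real_root_power_cancel[OF n] intro!: fcalc_id[OF S])

lemma root_op_mono:
  assumes T: "pos_contraction T" and n: "0 < n" "n \<le> m"
  shows "inner (root_op n T x) x \<le> inner (root_op m T x) x"
proof -
  have "0 \<le> inner (fcalc T (\<lambda>t. root m t - root n t) x) x"
  proof (rule fcalc_nonneg[OF T])
    fix t :: real assume "0 \<le> t" "t \<le> 1"
    then show "0 \<le> root m t - root n t"
      using n real_root_increasing[of n m t] by (cases "n = m") auto
  qed (use n in \<open>auto intro!: continuous_intros continuous_on_root\<close>)
  then show ?thesis
    using n by (subst (asm) fcalc_diff[OF T])
      (auto simp: root_op_def blinfun.bilinear_simps inner_diff_left intro!: continuous_on_root)
qed

lemma root_op_factor:
  assumes T: "pos_contraction T" and n: "0 < n"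
  obtains q where "(\<lambda>k. op_poly T (q k) o\<^sub>L T) \<longlonglongrightarrow> root_op n T"
  using fcalc_factor[OF T continuous_on_root[OF n]] unfolding root_op_def by auto

lemma root_op_eq_0:
  assumes T: "pos_contraction T" and n: "0 < n" and x: "T x = 0"
  shows "root_op n T x = 0"
proof -
  obtain q where "(\<lambda>k. op_poly T (q k) o\<^sub>L T) \<longlonglongrightarrow> root_op n T"
    using root_op_factor[OF T n] .
  then have "(\<lambda>k. (op_poly T (q k) o\<^sub>L T) x) \<longlonglongrightarrow> root_op n T x"
    by (intro tendsto_intros)
  then show ?thesis
    by (simp add: x blinfun.bilinear_simps LIMSEQ_const_iff)
qed

section \<open>Complex-linear and compact operators on the Hilbert space\<close>

lemma coord_plus [simp]: "coord (x + y) n = coord x n + coord y n"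
  and coord_minus [simp]: "coord (x - y) n = coord x n - coord y n"
  and coord_zero [simp]: "coord 0 n = 0"
  and coord_scaleC [simp]: "coord (c *\<^sub>C x) n = c * coord x n"
  and coord_scaleR [simp]: "coord (r *\<^sub>R x) n = complex_of_real r * coord x n"
  and coord_basis_vec [simp]: "coord (basis_vec i) n = (if n = i then 1 else 0)"
  by (simp_all add: plus_ell2.rep_eq minus_ell2.rep_eq zero_ell2.rep_eq uminus_ell2.rep_eq scaleC.rep_eq
      scaleR_ell2.rep_eq basis_vec.rep_eq)

lemma coord_sum [simp]: "coord (\<Sum>i\<in>I. f i) n = (\<Sum>i\<in>I. coord (f i) n)"
  by (induction I rule: infinite_finite_induct) auto

lemma scaleR_eq_scaleC: "r *\<^sub>R x = complex_of_real r *\<^sub>C x"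
  by (rule ell2_eqI) simp

lemma scaleC_one [simp]: "1 *\<^sub>C x = x"
  and zero_scaleC [simp]: "0 *\<^sub>C x = 0"
  and scaleC_add_right: "c *\<^sub>C (x + y) = c *\<^sub>C x + c *\<^sub>C y"
  and scaleC_diff_right: "c *\<^sub>C (x - y) = c *\<^sub>C x - c *\<^sub>C y"
  by (auto intro!: ell2_eqI simp: algebra_simps)

lemma cinner_add_left: "cinner (x + y) z = cinner x z + cinner y z"
  unfolding cinner_def using suminf_add[OF summable_cinner[of x z] summable_cinner[of y z]]
  by (simp add: algebra_simps)

lemma cinner_scaleC_left: "cinner (c *\<^sub>C x) y = c * cinner x y"
  unfolding cinner_def using suminf_mult[OF summable_cinner[of x y], of c] by (simp add: algebra_simps)

lemma cinner_commute: "cinner x y = cnj (cinner y x)"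
proof -
  have "(\<lambda>n. cnj (coord y n * cnj (coord x n))) sums cnj (cinner y x)"
    unfolding cinner_def by (intro bounded_linear.sums[OF bounded_linear_cnj] summable_sums summable_cinner)
  then show ?thesis
    unfolding cinner_def[of x y] by (subst sums_unique[symmetric]) (auto simp: mult.commute)
qed

lemma cinner_add_right: "cinner x (y + z) = cinner x y + cinner x z"
  by (subst (1 2 3) cinner_commute) (simp add: cinner_add_left)

lemma cinner_scaleC_right: "cinner x (c *\<^sub>C y) = cnj c * cinner x y"
  by (subst (1 2) cinner_commute) (simp add: cinner_scaleC_left)

lemma Re_cinner: "Re (cinner x y) = inner x y"
  by (simp add: inner_ell2_def)

text \<open>Recovers the complex inner product from the real one, so that a complex-linear operator
  that is symmetric for \<open>inner\<close> is symmetric for \<open>cinner\<close> as well.\<close>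

lemma cinner_eq_Complex: "cinner x y = Complex (inner x y) (inner x (\<i> *\<^sub>C y))"
  by (rule complex_eqI) (simp_all add: inner_ell2_def cinner_scaleC_right)

lemma cinner_zero_left [simp]: "cinner 0 y = 0"
  and cinner_zero_right [simp]: "cinner x 0 = 0"
  by (simp_all add: cinner_def)

lemma cinner_minus_left: "cinner (x - y) z = cinner x z - cinner y z"
  using cinner_add_left[of "x - y" y z] by simp

lemma cinner_minus_right: "cinner x (y - z) = cinner x y - cinner x z"
  using cinner_add_right[of x "y - z" z] by simp

lemma cinner_sum_left: "cinner (\<Sum>i\<in>I. f i) y = (\<Sum>i\<in>I. cinner (f i) y)"
  by (induction I rule: infinite_finite_induct) (auto simp: cinner_add_left)

lemma cinner_sum_right: "cinner y (\<Sum>i\<in>I. f i) = (\<Sum>i\<in>I. cinner y (f i))"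
  by (induction I rule: infinite_finite_induct) (auto simp: cinner_add_right)

lemma cinner_self: "cinner x x = complex_of_real ((norm x)\<^sup>2)"
proof -
  have "Im (cinner x x) = 0"
    using arg_cong[OF cinner_commute[of x x], of Im] by simp
  then show ?thesis
    by (intro complex_eqI) (simp_all add: Re_cinner power2_norm_eq_inner)
qed

lemma norm_scaleC: "norm (c *\<^sub>C x) = cmod c * norm x"
proof -
  have "cinner (c *\<^sub>C x) (c *\<^sub>C x) = c * cnj c * cinner x x"
    by (simp add: cinner_scaleC_left cinner_scaleC_right)
  then have "complex_of_real ((norm (c *\<^sub>C x))\<^sup>2) = complex_of_real ((cmod c * norm x)\<^sup>2)"
    unfolding cinner_self by (simp add: power_mult_distrib complex_norm_square del: of_real_power)
  then have "(norm (c *\<^sub>C x))\<^sup>2 = (cmod c * norm x)\<^sup>2"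
    using of_real_eq_iff by blast
  then show ?thesis
    by (rule power2_eq_imp_eq) auto
qed

lemma bounded_linear_scaleC: "bounded_linear (\<lambda>x. c *\<^sub>C x)"
  by (rule bounded_linear_intro[of _ "cmod c"])
    (auto simp: scaleC_add_right scaleR_eq_scaleC mult.commute norm_scaleC)

lemma cmod_cinner_le: "cmod (cinner x y) \<le> norm x * norm y"
proof (cases "cinner x y = 0")
  case False
  \<comment> \<open>A phase that rotates \<open>cinner x y\<close> onto the nonnegative real axis,
    where the real Cauchy-Schwarz inequality applies.\<close>
  define c where "c = cnj (sgn (cinner x y))"
  have c: "cmod c = 1" using False by (simp add: c_def norm_sgn)
  have "cinner (c *\<^sub>C x) y = complex_of_real (cmod (cinner x y))"
    using False by (simp add: c_def cinner_scaleC_left sgn_div_norm scaleR_conv_of_real divide_simps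
        complex_norm_square[symmetric] power2_eq_square mult.commute)
  then have "cmod (cinner x y) = inner (c *\<^sub>C x) y"
    by (metis Re_cinner Re_complex_of_real)
  also have "\<dots> \<le> norm (c *\<^sub>C x) * norm y" by (rule norm_cauchy_schwarz)
  finally show ?thesis by (simp add: norm_scaleC c)
qed simp

lemma bounded_bilinear_cinner: "bounded_bilinear cinner"
proof
  show "cinner (r *\<^sub>R x) y = r *\<^sub>R cinner x y" for r x y
    by (simp add: scaleR_eq_scaleC cinner_scaleC_left scaleR_conv_of_real)
  show "cinner x (r *\<^sub>R y) = r *\<^sub>R cinner x y" for r x y
    by (simp add: scaleR_eq_scaleC cinner_scaleC_right scaleR_conv_of_real)
  show "\<exists>K. \<forall>x y. cmod (cinner x y) \<le> norm x * norm y * K"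
    by (rule exI[of _ 1]) (simp add: cmod_cinner_le)
qed (simp_all add: cinner_add_left cinner_add_right)

lemmas tendsto_cinner = bounded_bilinear.tendsto[OF bounded_bilinear_cinner]

lemma cinner_basis_vec_right [simp]: "cinner x (basis_vec i) = coord x i"
proof -
  have "(\<lambda>n. coord x n * cnj (coord (basis_vec i) n)) sums (\<Sum>n\<in>{i}. coord x n * cnj (coord (basis_vec i) n))"
    by (rule sums_finite) auto
  then show ?thesis unfolding cinner_def by (simp add: sums_iff)
qed

lemma cinner_basis_vec_left [simp]: "cinner (basis_vec i) x = cnj (coord x i)"
  by (subst cinner_commute) simp

lemma norm_sq_sums: "(\<lambda>i. (cmod (coord x i))\<^sup>2) sums (norm x)\<^sup>2"
  using summable_sums[OF summable_coord[of x]] by (simp add: norm_ell2_def suminf_nonneg summable_coord)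

lemma sum_coord_le_norm_sq: "(\<Sum>i<n. (cmod (coord x i))\<^sup>2) \<le> (norm x)\<^sup>2"
  using sum_le_suminf[OF summable_coord[of x], of "{..<n}"] sums_unique[OF norm_sq_sums[of x]] by simp

lemma cinner_ext_right: "(\<And>x. cinner x y = cinner x z) \<Longrightarrow> y = z"
  by (rule ell2_eqI) (metis cinner_basis_vec_left complex_cnj_cancel_iff)

lemma basis_vec_expansion: "(\<lambda>n. \<Sum>i<n. coord x i *\<^sub>C basis_vec i) \<longlonglongrightarrow> x"
proof -
  define s where "s n = (\<Sum>i<n. coord x i *\<^sub>C basis_vec i)" for n
  have coord_s: "coord (s n) i = (if i < n then coord x i else 0)" for n i
    by (auto simp: s_def if_distrib[of "(*) _"] cong: if_cong)
  have eq: "(norm (s n - x))\<^sup>2 = (norm x)\<^sup>2 - (\<Sum>i<n. (cmod (coord x i))\<^sup>2)" for n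
  proof -
    have "(\<lambda>i. if i < n then (cmod (coord x i))\<^sup>2 else 0) sums (\<Sum>i<n. (cmod (coord x i))\<^sup>2)"
      using sums_If_finite[of "\<lambda>i. i < n" "\<lambda>i. (cmod (coord x i))\<^sup>2"] by (simp add: lessThan_def)
    from sums_diff[OF norm_sq_sums[of x] this]
    have "(\<lambda>i. (cmod (coord (s n - x) i))\<^sup>2) sums ((norm x)\<^sup>2 - (\<Sum>i<n. (cmod (coord x i))\<^sup>2))"
      by (rule sums_cong[THEN iffD1, rotated]) (simp add: coord_s)
    then show ?thesis using norm_sq_sums sums_unique2 by blast
  qed
  have "(\<lambda>n. (norm x)\<^sup>2 - (\<Sum>i<n. (cmod (coord x i))\<^sup>2)) \<longlonglongrightarrow> (norm x)\<^sup>2 - (norm x)\<^sup>2"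
    by (intro tendsto_intros norm_sq_sums[unfolded sums_def])
  then have "(\<lambda>n. sqrt ((norm (s n - x))\<^sup>2)) \<longlonglongrightarrow> sqrt 0"
    unfolding eq by (intro tendsto_intros) simp
  then have "(\<lambda>n. s n - x) \<longlonglongrightarrow> 0"
    by (simp add: tendsto_norm_zero_iff)
  then show ?thesis
    unfolding s_def[symmetric] by (rule LIM_zero_cancel)
qed

definition clinear_op :: "operator \<Rightarrow> bool" where
  "clinear_op T \<longleftrightarrow> (\<forall>c x. T (c *\<^sub>C x) = c *\<^sub>C T x)"

lemma clinear_opD: "clinear_op T \<Longrightarrow> T (c *\<^sub>C x) = c *\<^sub>C T x"
  by (simp add: clinear_op_def)

lemma clinear_op_0 [simp]: "clinear_op 0"
  and clinear_op_id [simp]: "clinear_op id_blinfun"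
  and clinear_op_compose: "clinear_op S \<Longrightarrow> clinear_op T \<Longrightarrow> clinear_op (S o\<^sub>L T)"
  and clinear_op_add: "clinear_op S \<Longrightarrow> clinear_op T \<Longrightarrow> clinear_op (S + T)"
  and clinear_op_diff: "clinear_op S \<Longrightarrow> clinear_op T \<Longrightarrow> clinear_op (S - T)"
  and clinear_op_scaleR: "clinear_op T \<Longrightarrow> clinear_op (r *\<^sub>R T)"
  by (simp_all add: clinear_op_def blinfun.bilinear_simps scaleC_add_right scaleC_diff_right scaleR_eq_scaleC
      mult.commute)

lemma clinear_op_limit:
  assumes lim: "S \<longlonglongrightarrow> T" and S: "\<And>n. clinear_op (S n)"
  shows "clinear_op T"
  unfolding clinear_op_def
proof (intro allI)
  fix c x
  have "(\<lambda>n. S n (c *\<^sub>C x)) \<longlonglongrightarrow> T (c *\<^sub>C x)"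
    by (intro tendsto_intros lim)
  moreover have "(\<lambda>n. c *\<^sub>C S n x) \<longlonglongrightarrow> c *\<^sub>C T x"
    by (intro bounded_linear.tendsto[OF bounded_linear_scaleC] tendsto_intros lim)
  ultimately show "T (c *\<^sub>C x) = c *\<^sub>C T x"
    using LIMSEQ_unique by (simp add: clinear_opD[OF S]) blast
qed

lemma clinear_op_op_poly: "clinear_op T \<Longrightarrow> clinear_op (op_poly T p)"
  by (induction p) (auto intro!: clinear_op_add clinear_op_scaleR clinear_op_compose)

text \<open>Riesz representation in coordinates: the only possible i-th coordinate of the image of
  \<open>y\<close> is \<open>cinner y (T (basis_vec i))\<close>. Testing against the truncation
  \<open>s n\<close> of this very sequence bounds \<open>norm (s n)\<close> by
  \<open>norm T * norm y\<close>, which makes the sequence square-summable and the resulting map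
  bounded.\<close>

lemma adjoint_exists:
  assumes T: "clinear_op T"
  shows "\<exists>S :: operator. \<forall>x y. cinner (T x) y = cinner x (S y)"
proof -
  have ex: "\<exists>z. (\<forall>x. cinner (T x) y = cinner x z) \<and> norm z \<le> norm T * norm y" for y
  proof -
    define w where "w i = cinner y (T (basis_vec i))" for i
    define s where "s n = (\<Sum>i<n. w i *\<^sub>C basis_vec i)" for n
    have coord_s: "coord (s n) i = (if i < n then w i else 0)" for n i
      by (auto simp: s_def if_distrib[of "(*) _"] cong: if_cong)
    have norm_s: "(norm (s n))\<^sup>2 = (\<Sum>i<n. (cmod (w i))\<^sup>2)" for n
    proof -
      have "(\<lambda>i. if i < n then (cmod (w i))\<^sup>2 else 0) sums (\<Sum>i<n. (cmod (w i))\<^sup>2)"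
        using sums_If_finite[of "\<lambda>i. i < n" "\<lambda>i. (cmod (w i))\<^sup>2"] by (simp add: lessThan_def)
      then have "(\<lambda>i. (cmod (coord (s n) i))\<^sup>2) sums (\<Sum>i<n. (cmod (w i))\<^sup>2)"
        by (rule sums_cong[THEN iffD1, rotated]) (simp add: coord_s)
      then show ?thesis using norm_sq_sums sums_unique2 by blast
    qed
    have bound: "norm (s n) \<le> norm T * norm y" for n
    proof -
      have "cinner y (T (s n)) = (\<Sum>i<n. cnj (w i) * w i)"
        by (simp add: s_def w_def blinfun.bilinear_simps blinfun.sum_right clinear_opD[OF T] cinner_sum_right
            cinner_scaleC_right)
      also have "\<dots> = complex_of_real ((norm (s n))\<^sup>2)"
        by (simp add: norm_s complex_norm_square mult.commute del: of_real_power)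
      finally have "(norm (s n))\<^sup>2 = cmod (cinner y (T (s n)))"
        by (simp add: norm_power)
      also have "\<dots> \<le> norm y * (norm T * norm (s n))"
        by (rule order_trans[OF cmod_cinner_le]) (intro mult_left_mono norm_blinfun norm_ge_zero)
      finally have "norm (s n) * norm (s n) \<le> (norm T * norm y) * norm (s n)"
        by (simp add: power2_eq_square mult_ac)
      then show ?thesis
        by (cases "norm (s n) = 0") (auto simp: mult_le_cancel_right)
    qed
    have sq: "(\<Sum>i<n. (cmod (w i))\<^sup>2) \<le> (norm T * norm y)\<^sup>2" for n
      unfolding norm_s[symmetric] by (intro power_mono bound) auto
    have sm: "summable (\<lambda>i. (cmod (w i))\<^sup>2)"
      by (rule bounded_imp_summable[of _ "(norm T * norm y)\<^sup>2"])
        (use sq[of "Suc _"] in \<open>auto simp: lessThan_Suc_atMost\<close>)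
    define z where "z = Abs_ell2 w"
    have z: "coord z = w" unfolding z_def using sm by (simp add: Abs_ell2_inverse)
    have "cinner (T x) y = cinner x z" for x
    proof -
      define r where "r n = (\<Sum>i<n. coord x i *\<^sub>C basis_vec i)" for n
      have "cinner (T (r n)) y = cinner (r n) z" for n
        unfolding r_def
        by (simp add: blinfun.sum_right clinear_opD[OF T] cinner_sum_left cinner_scaleC_left z w_def
            cinner_commute[symmetric])
      moreover have "(\<lambda>n. cinner (T (r n)) y) \<longlonglongrightarrow> cinner (T x) y"
        unfolding r_def by (intro tendsto_cinner tendsto_intros basis_vec_expansion)
      moreover have "(\<lambda>n. cinner (r n) z) \<longlonglongrightarrow> cinner x z"
        unfolding r_def by (intro tendsto_cinner tendsto_intros basis_vec_expansion)
      ultimately show ?thesis using LIMSEQ_unique by fastforce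
    qed
    moreover have "(norm z)\<^sup>2 \<le> (norm T * norm y)\<^sup>2"
      using suminf_le_const[OF sm sq] sums_unique[OF norm_sq_sums[of z]] by (simp add: z)
    then have "norm z \<le> norm T * norm y"
      by (rule power2_le_imp_le) simp
    ultimately show ?thesis by blast
  qed
  then obtain S where S: "\<And>x y. cinner (T x) y = cinner x (S y)" and bound: "\<And>y. norm (S y) \<le> norm T * norm y"
    by metis
  have "bounded_linear S"
  proof (rule bounded_linear_intro[of _ "norm T"])
    show "S (y + z) = S y + S z" for y z
      by (rule cinner_ext_right) (simp add: S[symmetric] cinner_add_right)
    show "S (r *\<^sub>R y) = r *\<^sub>R S y" for r y
      by (rule cinner_ext_right) (simp add: S[symmetric] cinner_scaleC_right scaleR_eq_scaleC)
    show "norm (S y) \<le> norm y * norm T" for y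
      using bound[of y] by (simp add: mult.commute)
  qed
  then have "blinfun_apply (Blinfun S) = S" by (simp add: bounded_linear_Blinfun_apply)
  then show ?thesis using S by metis
qed

lemma adjoint_op_unique:
  fixes S T :: operator
  assumes "\<And>x y. cinner (T x) y = cinner x (S y)"
  shows "adjoint_op T = S"
  unfolding adjoint_op_def
proof (rule the_equality)
  fix S' :: operator assume "\<forall>x y. cinner (T x) y = cinner x (S' y)"
  then show "S' = S"
    using assms by (intro blinfun_eqI cinner_ext_right) metis
qed (use assms in blast)

lemma cinner_adjoint_op: "clinear_op T \<Longrightarrow> cinner (T x) y = cinner x (adjoint_op T y)"
  using adjoint_exists[of T] adjoint_op_unique by metis

lemma cinner_adjoint_op_left: "clinear_op T \<Longrightarrow> cinner (adjoint_op T x) y = cinner x (T y)"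
  by (subst (1 2) cinner_commute) (simp add: cinner_adjoint_op)

lemma clinear_op_adjoint_op: "clinear_op T \<Longrightarrow> clinear_op (adjoint_op T)"
  unfolding clinear_op_def[of "adjoint_op T"]
  by (intro allI cinner_ext_right) (simp add: cinner_scaleC_right cinner_adjoint_op[symmetric])

lemma adjoint_op_diff:
  "clinear_op S \<Longrightarrow> clinear_op T \<Longrightarrow> adjoint_op (S - T) = adjoint_op S - adjoint_op T"
  by (rule adjoint_op_unique) (simp add: blinfun.bilinear_simps cinner_minus_left cinner_minus_right cinner_adjoint_op)

lemma norm_adjoint_op_le:
  assumes T: "clinear_op T"
  shows "norm (adjoint_op T) \<le> norm T"
proof (rule norm_blinfun_bound)
  fix y
  have "complex_of_real ((norm (adjoint_op T y))\<^sup>2) = cinner (T (adjoint_op T y)) y"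
    by (simp add: cinner_adjoint_op[OF T] cinner_self)
  then have "(norm (adjoint_op T y))\<^sup>2 = cmod (cinner (T (adjoint_op T y)) y)"
    by (metis abs_of_nonneg norm_of_real zero_le_power2)
  also have "\<dots> \<le> norm T * norm (adjoint_op T y) * norm y"
    by (rule order_trans[OF cmod_cinner_le]) (intro mult_right_mono norm_blinfun norm_ge_zero)
  finally have "norm (adjoint_op T y) * norm (adjoint_op T y) \<le> (norm T * norm y) * norm (adjoint_op T y)"
    by (simp add: power2_eq_square mult_ac)
  then show "norm (adjoint_op T y) \<le> norm T * norm y"
    by (cases "norm (adjoint_op T y) = 0") (auto simp: mult_le_cancel_right)
qed simp

lemma continuous_on_adjoint_op: "continuous_on {T. clinear_op T} adjoint_op"
  unfolding continuous_on_iff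
proof (intro ballI allI impI)
  fix T and e :: real assume "T \<in> {T. clinear_op T}" "0 < e"
  then show "\<exists>d>0. \<forall>S\<in>{T. clinear_op T}. dist S T < d \<longrightarrow> dist (adjoint_op S) (adjoint_op T) < e"
    by (intro exI[of _ e])
      (auto simp: dist_norm adjoint_op_diff[symmetric] clinear_op_diff intro: norm_adjoint_op_le[THEN order.strict_trans1])
qed

section \<open>Compact operators\<close>

lemma compact_closure_iff_totally_bounded:
  fixes A :: "'a::banach set"
  shows "compact (closure A) \<longleftrightarrow> (\<forall>e>0. \<exists>F. finite F \<and> A \<subseteq> (\<Union>x\<in>F. ball x e))"
proof
  assume "compact (closure A)"
  then show "\<forall>e>0. \<exists>F. finite F \<and> A \<subseteq> (\<Union>x\<in>F. ball x e)"
    using closure_subset[of A] unfolding compact_eq_totally_bounded by (meson order_trans)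
next
  assume tb: "\<forall>e>0. \<exists>F. finite F \<and> A \<subseteq> (\<Union>x\<in>F. ball x e)"
  show "compact (closure A)"
    unfolding compact_eq_totally_bounded
  proof (intro conjI allI impI)
    show "complete (closure A)" by (simp add: complete_eq_closed)
    fix e :: real assume "0 < e"
    then obtain F where F: "finite F" "A \<subseteq> (\<Union>x\<in>F. ball x (e / 2))"
      using tb by (meson half_gt_zero)
    have "closure A \<subseteq> (\<Union>x\<in>F. cball x (e / 2))"
      using F by (intro closure_minimal order_trans[OF F(2)] UN_mono) auto
    also have "\<dots> \<subseteq> (\<Union>x\<in>F. ball x e)"
      using \<open>0 < e\<close> by (intro UN_mono) auto
    finally show "\<exists>k. finite k \<and> closure A \<subseteq> (\<Union>x\<in>k. ball x e)" using F by blast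
  qed
qed

lemma compact_operatorsD: "T \<in> compact_operators \<Longrightarrow> clinear_op T"
  by (simp add: compact_operators_def clinear_op_def)

lemma compact_operators_0 [simp]: "0 \<in> compact_operators"
proof -
  have "(\<lambda>x :: ell2. 0 :: ell2) ` cball 0 1 = {0}" by (auto intro!: image_eqI[of _ _ 0])
  then show ?thesis by (simp add: compact_operators_def)
qed

lemma compact_operators_compose:
  assumes S: "clinear_op S" and T: "T \<in> compact_operators"
  shows "S o\<^sub>L T \<in> compact_operators"
proof -
  have "compact (S ` closure (T ` cball 0 1))"
    using T by (intro compact_continuous_image) (auto simp: compact_operators_def intro!: continuous_intros)
  moreover have "closure ((S o\<^sub>L T) ` cball 0 1) \<subseteq> S ` closure (T ` cball 0 1)"
    using calculation by (intro closure_minimal compact_imp_closed) (auto intro!: imageI closure_subset[THEN subsetD])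
  ultimately have "compact (closure ((S o\<^sub>L T) ` cball 0 1))"
    by (metis closed_closure compact_Int_closed inf.absorb_iff2 inf.commute)
  then show ?thesis
    using clinear_op_compose[OF S compact_operatorsD[OF T]] by (simp add: compact_operators_def clinear_op_def)
qed

lemma compact_operators_limit:
  assumes lim: "S \<longlonglongrightarrow> T" and S: "\<And>n. S n \<in> compact_operators"
  shows "T \<in> compact_operators"
proof -
  have "\<exists>F. finite F \<and> T ` cball 0 1 \<subseteq> (\<Union>x\<in>F. ball x e)" if "0 < e" for e
  proof -
    obtain n where n: "norm (S n - T) < e / 2"
      using LIMSEQ_D[OF lim, of "e / 2"] \<open>0 < e\<close> by auto
    obtain F where F: "finite F" "S n ` cball 0 1 \<subseteq> (\<Union>x\<in>F. ball x (e / 2))"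
      using S[of n] half_gt_zero[OF \<open>0 < e\<close>] unfolding compact_operators_def compact_closure_iff_totally_bounded
      by blast
    have "T ` cball 0 1 \<subseteq> (\<Union>x\<in>F. ball x e)"
    proof
      fix y assume "y \<in> T ` cball 0 1"
      then obtain x where x: "norm x \<le> 1" "y = T x" by auto
      then obtain z where z: "z \<in> F" "dist z (S n x) < e / 2" using F(2) by fastforce
      have "norm ((S n - T) x) \<le> norm (S n - T) * norm x" by (rule norm_blinfun)
      also have "\<dots> \<le> norm (S n - T) * 1" using x by (intro mult_left_mono) auto
      finally have "dist (S n x) (T x) < e / 2" using n by (simp add: dist_norm blinfun.bilinear_simps)
      then have "dist z y < e" using z(2) x dist_triangle_half_l dist_commute by metis
      then show "y \<in> (\<Union>x\<in>F. ball x e)" using z by auto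
    qed
    then show ?thesis using F by blast
  qed
  then have "compact (closure (T ` cball 0 1))"
    by (simp add: compact_closure_iff_totally_bounded)
  then show ?thesis
    using clinear_op_limit[OF lim compact_operatorsD[OF S]] by (simp add: compact_operators_def clinear_op_def)
qed

lemma compact_operators_scaleR: "T \<in> compact_operators \<Longrightarrow> r *\<^sub>R T \<in> compact_operators"
proof -
  assume T: "T \<in> compact_operators"
  have "r *\<^sub>R T = (r *\<^sub>R id_blinfun) o\<^sub>L T"
    by (rule blinfun_eqI) (simp add: blinfun.bilinear_simps)
  then show ?thesis
    using compact_operators_compose[OF _ T, of "r *\<^sub>R id_blinfun"] by (simp add: clinear_op_scaleR)
qed

lemma compact_operators_root_op:
  assumes T: "pos_contraction T" "T \<in> compact_operators" and n: "0 < n"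
  shows "root_op n T \<in> compact_operators"
proof -
  obtain q where "(\<lambda>k. op_poly T (q k) o\<^sub>L T) \<longlonglongrightarrow> root_op n T"
    using root_op_factor[OF T(1) n] .
  then show ?thesis
    by (rule compact_operators_limit) (intro compact_operators_compose clinear_op_op_poly compact_operatorsD T)
qed

section \<open>Orthonormal systems and rank\<close>

definition orthonormal :: "ell2 set \<Rightarrow> bool" where
  "orthonormal B \<longleftrightarrow> (\<forall>u\<in>B. \<forall>v\<in>B. cinner u v = (if u = v then 1 else 0))"

lemma cinner_orthonormal_sum:
  assumes "finite B" "orthonormal B" "u \<in> B"
  shows "cinner (\<Sum>v\<in>B. c v *\<^sub>C v) u = c u"
proof -
  have "cinner (\<Sum>v\<in>B. c v *\<^sub>C v) u = (\<Sum>v\<in>B. c v * (if v = u then 1 else 0))"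
    using assms unfolding cinner_sum_left cinner_scaleC_left orthonormal_def by (intro sum.cong) auto
  also have "\<dots> = c u" using assms by (simp add: if_distrib[of "(*) _"] cong: if_cong)
  finally show ?thesis .
qed

lemma orthonormal_norm: "orthonormal B \<Longrightarrow> v \<in> B \<Longrightarrow> norm v = 1"
proof -
  assume "orthonormal B" "v \<in> B"
  then have "complex_of_real ((norm v)\<^sup>2) = 1"
    unfolding cinner_self[symmetric] by (simp add: orthonormal_def)
  then have "(norm v)\<^sup>2 = 1\<^sup>2"
    unfolding of_real_eq_1_iff by simp
  then show "norm v = 1"
    by (rule power2_eq_imp_eq) auto
qed

lemma orthonormal_independent:
  assumes "finite B" "orthonormal B"
  shows "ell2.independent B"
proof (rule ell2.independent_if_scalars_zero[OF assms(1)])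
  fix f u assume "(\<Sum>v\<in>B. f v *\<^sub>C v) = 0" "u \<in> B"
  then show "f u = 0"
    using cinner_orthonormal_sum[OF assms, of u f] by simp
qed

definition oproj :: "ell2 set \<Rightarrow> ell2 \<Rightarrow> ell2" where
  "oproj B x = (\<Sum>v\<in>B. cinner x v *\<^sub>C v)"

lemma cinner_oproj_complement:
  assumes "finite B" "orthonormal B" "v \<in> B"
  shows "cinner (x - oproj B x) v = 0"
  using cinner_orthonormal_sum[OF assms] by (simp add: cinner_minus_left oproj_def)

lemma oproj_in_subspace: "ell2.subspace W \<Longrightarrow> B \<subseteq> W \<Longrightarrow> oproj B x \<in> W"
  unfolding oproj_def by (intro ell2.subspace_sum ell2.subspace_scale) auto

lemma cinner_eq_0_span:
  assumes "finite B" "w \<in> ell2.span B" "\<And>v. v \<in> B \<Longrightarrow> cinner y v = 0"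
  shows "cinner y w = 0"
proof -
  obtain c where "w = (\<Sum>v\<in>B. c v *\<^sub>C v)"
    using assms by (auto simp: ell2.span_finite)
  then show ?thesis
    using assms(3) by (simp add: cinner_sum_right cinner_scaleC_right)
qed

lemma norm_oproj_sq:
  assumes "finite B" "orthonormal B"
  shows "(norm (oproj B x))\<^sup>2 = (\<Sum>v\<in>B. (cmod (cinner x v))\<^sup>2)"
proof -
  have "cinner (oproj B x) (oproj B x) = (\<Sum>v\<in>B. cnj (cinner x v) * cinner x v)"
    unfolding oproj_def cinner_sum_right cinner_scaleC_right
    by (intro sum.cong refl) (simp add: cinner_orthonormal_sum[OF assms])
  also have "\<dots> = complex_of_real (\<Sum>v\<in>B. (cmod (cinner x v))\<^sup>2)"
    by (simp add: complex_norm_square mult.commute del: of_real_power)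
  finally show ?thesis
    unfolding cinner_self of_real_eq_iff .
qed

lemma orthonormal_extend:
  assumes B: "finite B" "orthonormal B" "B \<subseteq> W" and W: "ell2.subspace W" "\<not> W \<subseteq> ell2.span B"
  obtains u where "u \<in> W" "u \<notin> B" "orthonormal (insert u B)"
proof -
  obtain w where w: "w \<in> W" "w \<notin> ell2.span B" using W by blast
  define z where "z = w - oproj B w"
  have "oproj B w \<in> ell2.span B"
    by (intro oproj_in_subspace ell2.subspace_span ell2.span_superset)
  then have z0: "z \<noteq> 0" using w by (auto simp: z_def)
  have zB: "cinner z v = 0" if "v \<in> B" for v
    unfolding z_def by (rule cinner_oproj_complement[OF B(1,2) that])
  define u where "u = complex_of_real (inverse (norm z)) *\<^sub>C z"
  have uB: "cinner u v = 0" "cinner v u = 0" if "v \<in> B" for v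
    using zB[OF that] cinner_commute[of v z] by (simp_all add: u_def cinner_scaleC_left cinner_scaleC_right)
  have uu: "cinner u u = 1"
    using z0 unfolding cinner_self by (simp add: u_def norm_scaleC norm_inverse)
  have "u \<notin> B" using uB uu by force
  moreover have "u \<in> W"
    unfolding u_def z_def using w W B by (intro ell2.subspace_scale ell2.subspace_diff oproj_in_subspace) auto
  moreover have "orthonormal (insert u B)"
    using B(2) uB uu \<open>u \<notin> B\<close> unfolding orthonormal_def by auto
  ultimately show ?thesis using that by blast
qed

text \<open>Gram-Schmidt: extending an orthonormal system inside \<open>W\<close> either stops at a
  finite basis or reaches every cardinality.\<close>

lemma orthonormal_basis_cases:
  assumes W: "ell2.subspace W"
  obtains B where "finite B" "orthonormal B" "B \<subseteq> W" "W \<subseteq> ell2.span B"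
  | "\<And>n. \<exists>B. finite B \<and> orthonormal B \<and> B \<subseteq> W \<and> card B = n"
proof (cases "\<exists>B. finite B \<and> orthonormal B \<and> B \<subseteq> W \<and> W \<subseteq> ell2.span B")
  case False
  have "\<exists>B. finite B \<and> orthonormal B \<and> B \<subseteq> W \<and> card B = n" for n
  proof (induction n)
    case 0
    then show ?case by (intro exI[of _ "{}"]) (simp add: orthonormal_def)
  next
    case (Suc n)
    then obtain B where B: "finite B" "orthonormal B" "B \<subseteq> W" "card B = n" by blast
    then obtain u where "u \<in> W" "u \<notin> B" "orthonormal (insert u B)"
      using orthonormal_extend[OF B(1-3) W] False by blast
    then show ?case using B by (intro exI[of _ "insert u B"]) auto
  qed
  then show ?thesis using that by blast
qed (use that in blast)

lemma subspace_range: "clinear_op T \<Longrightarrow> ell2.subspace (range T)"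
  unfolding ell2.subspace_def
  by (auto simp: clinear_opD[symmetric] blinfun.add_right[symmetric] intro: range_eqI[of _ _ 0])

lemma independent_card_le_rank_op:
  fixes T :: operator
  assumes "finite B" "ell2.independent B" "B \<subseteq> range T"
  shows "enat (card B) \<le> rank_op T"
proof (cases "\<exists>F. finite F \<and> range T \<subseteq> ell2.span F")
  case True
  then obtain F where F: "finite F" "range T \<subseteq> ell2.span F" by blast
  obtain A where A: "A \<subseteq> range T" "ell2.independent A" "range T \<subseteq> ell2.span A" "card A = ell2.dim (range T)"
    using ell2.basis_exists by blast
  have "finite A" using ell2.independent_span_bound[OF F(1) A(2)] A F by blast
  then have "card B \<le> ell2.dim (range T)"
    using ell2.independent_span_bound[of A B] assms A by auto
  then show ?thesis using True by (simp add: rank_op_def)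
qed (auto simp: rank_op_def)

lemma rank_op_le:
  fixes T :: operator
  assumes "finite F" "range T \<subseteq> ell2.span F"
  shows "rank_op T \<le> enat (card F)"
  using assms ell2.dim_le_card[of "range T" F] by (auto simp: rank_op_def)

text \<open>\<open>ell2.dim\<close> carries no information about an infinite-dimensional range.
  Orthonormal systems inside the range make sense in both cases, and it is against these that traces
  and limits are tested.\<close>

lemma rank_op_cases:
  assumes T: "clinear_op T"
  obtains B where "finite B" "orthonormal B" "B \<subseteq> range T" "range T \<subseteq> ell2.span B" "rank_op T = enat (card B)"
  | "rank_op T = \<infinity>" "\<And>n. \<exists>B. finite B \<and> orthonormal B \<and> B \<subseteq> range T \<and> card B = n"
  using subspace_range[OF T]
proof (cases rule: orthonormal_basis_cases)
  case (1 B)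
  then have "rank_op T = enat (card B)"
    by (intro antisym rank_op_le independent_card_le_rank_op orthonormal_independent)
  then show ?thesis using 1 that by blast
next
  case 2
  have "enat n \<le> rank_op T" for n
  proof -
    obtain B where "finite B" "orthonormal B" "B \<subseteq> range T" "card B = n" using 2 by blast
    then show ?thesis using independent_card_le_rank_op orthonormal_independent by blast
  qed
  then have "rank_op T = \<infinity>"
  proof (cases "rank_op T")
    case (enat k)
    then show ?thesis using \<open>\<And>n. enat n \<le> rank_op T\<close>[of "Suc k"] by simp
  qed
  then show ?thesis using 2 that by blast
qed

lemma orthonormal_in_range:
  assumes T: "clinear_op T" and n: "enat n \<le> rank_op T"
  obtains B where "finite B" "orthonormal B" "B \<subseteq> range T" "card B = n"
  using T
proof (cases rule: rank_op_cases)
  case (1 B)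
  then have "n \<le> card B" using n by simp
  then obtain A where "A \<subseteq> B" "card A = n" "finite A"
    by (rule obtain_subset_with_card_n)
  moreover have "orthonormal A"
    using 1(2) calculation unfolding orthonormal_def by blast
  ultimately show ?thesis using 1 that by blast
qed (use that in blast)

lemma rank_op_eq_0_iff:
  assumes T: "clinear_op T"
  shows "rank_op T = 0 \<longleftrightarrow> T = 0"
proof
  assume r: "rank_op T = 0"
  show "T = 0"
    using T
  proof (cases rule: rank_op_cases)
    case (1 B)
    then have "B = {}" using r by (simp add: zero_enat_def)
    then show ?thesis using 1 by (intro blinfun_eqI) auto
  qed (use r in auto)
next
  assume "T = 0"
  then have "rank_op T \<le> enat (card ({} :: ell2 set))" by (intro rank_op_le) auto
  then show "rank_op T = 0" by (simp add: zero_enat_def[symmetric])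
qed

lemma rank_op_compose_le:
  assumes "clinear_op A" "clinear_op T"
  shows "rank_op (A o\<^sub>L T o\<^sub>L R) \<le> rank_op T"
  using assms(2)
proof (cases rule: rank_op_cases)
  case (1 B)
  have "range (A o\<^sub>L T o\<^sub>L R) \<subseteq> ell2.span (A ` B)"
  proof
    fix y assume "y \<in> range (A o\<^sub>L T o\<^sub>L R)"
    then obtain x where x: "y = A (T (R x))" by auto
    have "T (R x) \<in> ell2.span B" using 1 by auto
    then obtain c where "T (R x) = (\<Sum>v\<in>B. c v *\<^sub>C v)"
      using 1 by (auto simp: ell2.span_finite)
    then have "y = (\<Sum>v\<in>B. c v *\<^sub>C A v)"
      by (simp add: x blinfun.sum_right clinear_opD[OF assms(1)])
    then show "y \<in> ell2.span (A ` B)"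
      by (simp only:) (intro ell2.span_sum ell2.span_scale ell2.span_base imageI)
  qed
  then have "rank_op (A o\<^sub>L T o\<^sub>L R) \<le> enat (card (A ` B))"
    using 1 by (intro rank_op_le) auto
  also have "\<dots> \<le> rank_op T" using 1 by (simp add: card_image_le)
  finally show ?thesis .
qed simp

text \<open>Pairing the relation with the vector of the largest coefficient gives
  \<open>m \<le> m * (\<Sum>v\<in>B. norm (u v - v))\<close> for the modulus \<open>m\<close> of
  that coefficient; the sum is below 1, so \<open>m = 0\<close>.\<close>

lemma near_orthonormal_independent:
  assumes B: "finite B" "orthonormal B" and close: "\<And>v. v \<in> B \<Longrightarrow> norm (u v - v) * real (card B) < 1"
    and zero: "(\<Sum>v\<in>B. c v *\<^sub>C u v) = 0" and w: "w \<in> B"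
  shows "c w = 0"
proof -
  define m where "m = Max ((\<lambda>v. cmod (c v)) ` B)"
  have m: "cmod (c v) \<le> m" if "v \<in> B" for v
    unfolding m_def using B that by (intro Max_ge) auto
  have "m \<in> (\<lambda>v. cmod (c v)) ` B"
    unfolding m_def using B w by (intro Max_in) auto
  then obtain v0 where v0: "v0 \<in> B" "cmod (c v0) = m" by auto
  have m0: "0 \<le> m" using v0 by auto
  have "c v0 = cinner (\<Sum>v\<in>B. c v *\<^sub>C v) v0"
    by (rule cinner_orthonormal_sum[OF B v0(1), symmetric])
  also have "(\<Sum>v\<in>B. c v *\<^sub>C v) = - (\<Sum>v\<in>B. c v *\<^sub>C (u v - v))"
    using zero by (simp add: scaleC_diff_right sum_subtractf)
  finally have "m \<le> norm (- (\<Sum>v\<in>B. c v *\<^sub>C (u v - v))) * norm v0"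
    using cmod_cinner_le v0(2) by metis
  also have "\<dots> \<le> (\<Sum>v\<in>B. norm (c v *\<^sub>C (u v - v)))"
    using orthonormal_norm[OF B(2) v0(1)] norm_sum by simp
  also have "\<dots> \<le> (\<Sum>v\<in>B. m * norm (u v - v))"
    unfolding norm_scaleC by (intro sum_mono mult_right_mono m) auto
  finally have le: "m \<le> m * (\<Sum>v\<in>B. norm (u v - v))"
    by (simp add: sum_distrib_left)
  have card: "0 < card B" using B w by (auto simp: card_gt_0_iff)
  have "(\<Sum>v\<in>B. norm (u v - v)) < (\<Sum>v\<in>B. 1 / real (card B))"
    using B w close card by (intro sum_strict_mono) (auto simp: field_simps)
  also have "\<dots> = 1" using card by simp
  finally have lt: "(\<Sum>v\<in>B. norm (u v - v)) < 1" .
  have "m = 0"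
  proof (rule ccontr)
    assume "m \<noteq> 0"
    then have "m * (\<Sum>v\<in>B. norm (u v - v)) < m * 1"
      using lt m0 by (intro mult_strict_left_mono) auto
    then show False using le by simp
  qed
  then show ?thesis using m[OF w] by simp
qed

text \<open>Lower semicontinuity of rank. Preimages under \<open>T\<close> of an orthonormal system
  are mapped by \<open>S n\<close>, for large \<open>n\<close>, to vectors so close to that system
  that they are independent.\<close>

lemma rank_op_limit_le:
  assumes lim: "S \<longlonglongrightarrow> T" and T: "clinear_op T" and r: "\<And>n. rank_op (S n) \<le> r"
  shows "rank_op T \<le> r"
proof (rule ccontr)
  assume "\<not> rank_op T \<le> r"
  then obtain k where k: "r = enat k" "enat (Suc k) \<le> rank_op T"
    using ileI1[of r "rank_op T"] by (cases r) (auto simp: not_le eSuc_enat)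
  obtain B where B: "finite B" "orthonormal B" "B \<subseteq> range T" "card B = Suc k"
    using orthonormal_in_range[OF T k(2)] .
  obtain z where z: "\<And>v. v \<in> B \<Longrightarrow> T (z v) = v" using B(3) by (metis image_iff subsetD)
  have "\<forall>\<^sub>F n in sequentially. \<forall>v\<in>B. norm (S n (z v) - v) * real (card B) < 1"
  proof (rule eventually_ball_finite[OF B(1)], intro ballI)
    fix v assume v: "v \<in> B"
    have "(\<lambda>n. norm (S n (z v) - v) * real (card B)) \<longlonglongrightarrow> norm (T (z v) - v) * real (card B)"
      by (intro tendsto_intros lim)
    then show "\<forall>\<^sub>F n in sequentially. norm (S n (z v) - v) * real (card B) < 1"
      by (rule order_tendstoD) (simp add: z[OF v])
  qed
  then obtain n where n: "\<And>v. v \<in> B \<Longrightarrow> norm (S n (z v) - v) * real (card B) < 1"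
    unfolding eventually_sequentially by blast
  define u where "u v = S n (z v)" for v
  have ind: "c w = 0" if "(\<Sum>v\<in>B. c v *\<^sub>C u v) = 0" "w \<in> B" for c w
    by (rule near_orthonormal_independent[OF B(1,2) _ that]) (simp add: u_def n)
  have inj: "inj_on u B"
  proof (rule inj_onI, rule ccontr)
    fix v w assume vw: "v \<in> B" "w \<in> B" "u v = u w" "v \<noteq> w"
    have "(\<Sum>x\<in>B. (if x = v then 1 else if x = w then - 1 else 0) *\<^sub>C u x)
        = (\<Sum>x\<in>{v, w}. (if x = v then 1 else if x = w then - 1 else 0) *\<^sub>C u x)"
      by (rule sum.mono_neutral_right) (use B vw in auto)
    also have "\<dots> = 0" using vw(3,4) by (simp add: ell2_eqI)
    finally show False using ind[of "\<lambda>x. if x = v then 1 else if x = w then - 1 else 0" v] vw(1) by simp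
  qed
  have "ell2.independent (u ` B)"
  proof (rule ell2.independent_if_scalars_zero)
    fix f y assume f: "(\<Sum>x\<in>u ` B. f x *\<^sub>C x) = 0" and y: "y \<in> u ` B"
    then show "f y = 0"
      using ind[of "\<lambda>v. f (u v)"] by (auto simp: sum.reindex[OF inj])
  qed (use B in simp)
  then have "enat (card (u ` B)) \<le> rank_op (S n)"
    using B by (intro independent_card_le_rank_op) (auto simp: u_def)
  also have "\<dots> \<le> enat k" using r k by metis
  finally show False using B(4) by (simp add: card_image[OF inj])
qed

section \<open>Positive operators and their roots\<close>

definition pos_op :: "operator \<Rightarrow> bool" where
  "pos_op T \<longleftrightarrow> clinear_op T \<and> (\<forall>x y. inner (T x) y = inner x (T y)) \<and> (\<forall>x. 0 \<le> inner (T x) x)"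

lemma pos_op_clinear: "pos_op T \<Longrightarrow> clinear_op T"
  by (simp add: pos_op_def)

lemma pos_op_nonneg: "pos_op T \<Longrightarrow> 0 \<le> inner (T x) x"
  unfolding pos_op_def by blast

lemma pos_op_scaleR: "pos_op T \<Longrightarrow> 0 \<le> r \<Longrightarrow> pos_op (r *\<^sub>R T)"
  by (auto simp: pos_op_def clinear_op_scaleR blinfun.bilinear_simps inner_commute)

lemma pos_contraction_of_pos_op:
  assumes T: "pos_op T" and le: "norm T \<le> 1"
  shows "pos_contraction T"
proof -
  have "inner (T x) x \<le> inner x x" for x
  proof -
    have "inner (T x) x \<le> norm (T x) * norm x" by (rule norm_cauchy_schwarz)
    also have "\<dots> \<le> (norm T * norm x) * norm x" by (intro mult_right_mono norm_blinfun) auto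
    also have "\<dots> \<le> (1 * norm x) * norm x" by (intro mult_right_mono le) auto
    finally show ?thesis by (simp add: power2_norm_eq_inner[symmetric] power2_eq_square)
  qed
  then show ?thesis using T unfolding pos_op_def pos_contraction_def by blast
qed

lemma pos_op_adjoint_compose:
  assumes T: "clinear_op T"
  shows "pos_op (adjoint_op T o\<^sub>L T)"
  unfolding pos_op_def
  by (intro conjI allI clinear_op_compose clinear_op_adjoint_op T)
    (simp_all add: Re_cinner[symmetric] cinner_adjoint_op_left[OF T] cinner_adjoint_op[OF T, symmetric] cinner_self)

text \<open>Real symmetry and complex linearity together handle both components in
  \<open>cinner_eq_Complex\<close>.\<close>

lemma adjoint_op_pos_op: "pos_op T \<Longrightarrow> adjoint_op T = T"
  by (rule adjoint_op_unique) (simp add: pos_op_def cinner_eq_Complex clinear_op_def)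

lemma clinear_op_root_op:
  assumes T: "pos_contraction T" "clinear_op T" and n: "0 < n"
  shows "clinear_op (root_op n T)"
proof -
  obtain q where "(\<lambda>k. op_poly T (q k) o\<^sub>L T) \<longlonglongrightarrow> root_op n T"
    using root_op_factor[OF T(1) n] .
  then show ?thesis
    by (rule clinear_op_limit) (intro clinear_op_compose clinear_op_op_poly T)
qed

lemma pos_op_root_op: "pos_contraction T \<Longrightarrow> clinear_op T \<Longrightarrow> 0 < n \<Longrightarrow> pos_op (root_op n T)"
  using pos_contraction_root_op[of T n] clinear_op_root_op[of T n]
  unfolding pos_op_def pos_contraction_def by blast

lemma op_power_eq_op_poly: "op_power T n = op_poly T ([:0, 1:] ^ n)"
proof (induction n)
  case (Suc n)
  then show ?case
    by (simp add: op_power_def op_poly_mult)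
qed (simp add: op_power_def)

lemma op_power_scaleR: "op_power (r *\<^sub>R T) n = r ^ n *\<^sub>R op_power T n"
  by (induction n) (auto intro!: blinfun_eqI simp: op_power_def blinfun.bilinear_simps)

lemma pos_op_root_unique:
  assumes S: "pos_op S" and R: "pos_op R" and eq: "op_power S n = op_power R n" and n: "0 < n"
  shows "S = R"
proof -
  \<comment> \<open>One common factor makes both operators contractions; powers are homogeneous, so
    the equation between the n-th powers survives the scaling.\<close>
  define r where "r = inverse (1 + norm S + norm R)"
  have r: "0 < r" unfolding r_def by (simp add: add_pos_nonneg)
  have "norm (r *\<^sub>R S) \<le> 1" "norm (r *\<^sub>R R) \<le> 1"
    unfolding r_def by (simp_all add: field_simps add_pos_nonneg)
  then have pc: "pos_contraction (r *\<^sub>R S)" "pos_contraction (r *\<^sub>R R)"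
    using S R r by (auto intro!: pos_contraction_of_pos_op pos_op_scaleR)
  have "r *\<^sub>R S = root_op n (op_power (r *\<^sub>R S) n)"
    unfolding op_power_eq_op_poly by (rule root_op_unique[OF pc(1) n, symmetric])
  also have "\<dots> = root_op n (op_power (r *\<^sub>R R) n)"
    by (simp add: op_power_scaleR eq)
  also have "\<dots> = r *\<^sub>R R"
    unfolding op_power_eq_op_poly by (rule root_op_unique[OF pc(2) n])
  finally show ?thesis using r by simp
qed

text \<open>The limit of \<open>T\<^bsup>1/n\<^esup>\<close> is the projection onto the closure of the range of \<open>T\<close>, whose trace is
  the rank; both bounds test it against orthonormal systems in the range.\<close>

lemma trace_root_op_le_card:
  assumes T: "pos_contraction T" "clinear_op T"
    and B: "finite B" "orthonormal B" "B \<subseteq> range T" "range T \<subseteq> ell2.span B" and n: "0 < n"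
  shows "(\<Sum>i<N. inner (root_op n T (basis_vec i)) (basis_vec i)) \<le> real (card B)"
proof -
  define R where "R = root_op n T"
  have R: "pos_contraction R" unfolding R_def by (rule pos_contraction_root_op[OF T(1) n])
  have "inner (R x) x \<le> (\<Sum>v\<in>B. (cmod (cinner x v))\<^sup>2)" for x
  proof -
    define y where "y = x - oproj B x"
    \<comment> \<open>\<open>y\<close> is orthogonal to the span of \<open>B\<close>, which contains
      \<open>T (T y)\<close>. By symmetry \<open>T y\<close> has norm 0, and the root annihilates
      whatever \<open>T\<close> does.\<close>
    have "T (T y) \<in> ell2.span B" using B by auto
    then have "cinner y (T (T y)) = 0"
      by (rule cinner_eq_0_span[OF B(1)]) (simp add: y_def cinner_oproj_complement[OF B(1,2)])
    then have "inner y (T (T y)) = 0"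
      by (simp flip: Re_cinner)
    then have "inner (T y) (T y) = 0"
      by (simp only: pos_contraction_sym[OF T(1)])
    then have "R y = 0"
      unfolding R_def by (intro root_op_eq_0[OF T(1) n]) simp
    then have Rx: "R x = R (oproj B x)" by (simp add: y_def blinfun.bilinear_simps)
    have "inner (R x) x = inner (oproj B x) (R x)"
      unfolding Rx by (rule pos_contraction_sym[OF R, THEN trans]) (simp only: Rx)
    also have "\<dots> = inner (R (oproj B x)) (oproj B x)" by (simp add: Rx inner_commute)
    also have "\<dots> \<le> inner (oproj B x) (oproj B x)" by (rule pos_contraction_le[OF R])
    also have "\<dots> = (\<Sum>v\<in>B. (cmod (cinner x v))\<^sup>2)"
      by (simp add: norm_oproj_sq[OF B(1,2)] flip: power2_norm_eq_inner)
    finally show ?thesis .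
  qed
  \<comment> \<open>After the sums are exchanged, each \<open>v \<in> B\<close> contributes at most
    its squared norm, which is 1.\<close>
  from sum_mono[of "{..<N}", OF this[of "basis_vec _"]]
  have "(\<Sum>i<N. inner (R (basis_vec i)) (basis_vec i)) \<le> (\<Sum>i<N. \<Sum>v\<in>B. (cmod (coord v i))\<^sup>2)"
    by simp
  also have "\<dots> = (\<Sum>v\<in>B. \<Sum>i<N. (cmod (coord v i))\<^sup>2)" by (rule sum.swap)
  also have "\<dots> \<le> (\<Sum>v\<in>B. (norm v)\<^sup>2)" by (intro sum_mono sum_coord_le_norm_sq)
  also have "\<dots> = real (card B)" by (simp add: orthonormal_norm[OF B(2)])
  finally show ?thesis by (simp add: R_def)
qed

lemma card_le_SUP_trace_root_op:
  assumes T: "pos_contraction T" "clinear_op T"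
    and B: "finite B" "orthonormal B" "B \<subseteq> range T"
  shows "of_nat (card B) \<le> (SUP N. ennreal (\<Sum>i<N. inner (root_op (Suc N) T (basis_vec i)) (basis_vec i)))"
    (is "_ \<le> (SUP N. ennreal (?g N))")
proof -
  define R where "R N = root_op (Suc N) T" for N
  have R: "pos_contraction (R N)" for N unfolding R_def by (rule pos_contraction_root_op[OF T(1)]) simp
  define P where "P = oproj B"
  \<comment> \<open>The expansion of \<open>inner (R N x) x\<close> along
    \<open>x = P x + (x - P x)\<close> without the last, nonnegative term. What remains involves
    \<open>R N\<close> only at \<open>P x\<close>, which lies in the range of \<open>T\<close>,
    where the roots converge to the identity.\<close>
  define low where "low N x = inner (R N (P x)) (P x) + 2 * inner (R N (P x)) (x - P x)" for N x
  have low_le: "low N x \<le> inner (R N x) x" for N x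
  proof -
    define y where "y = x - P x"
    have x: "x = P x + y" by (simp add: y_def)
    have "inner (R N x) x = inner (R N (P x)) (P x) + 2 * inner (R N (P x)) y + inner (R N y) y"
      using pos_contraction_sym[OF R, of N y "P x"] inner_commute[of "R N (P x)" y]
      by (subst (1 2) x) (simp add: blinfun.bilinear_simps inner_add_left inner_add_right)
    then show ?thesis
      using pos_contraction_nonneg[OF R, of N y] by (simp add: low_def y_def)
  qed
  have low_lim: "(\<lambda>N. low N x) \<longlonglongrightarrow> (\<Sum>v\<in>B. (cmod (cinner x v))\<^sup>2)" for x
  proof -
    have "P x \<in> range T"
      unfolding P_def by (rule oproj_in_subspace[OF subspace_range[OF T(2)] B(3)])
    then obtain z where z: "P x = T z" by auto
    have "(\<lambda>N. (R N o\<^sub>L T) - T) \<longlonglongrightarrow> 0"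
    proof (rule Lim_null_comparison)
      show "\<forall>\<^sub>F N in sequentially. norm ((R N o\<^sub>L T) - T) \<le> inverse (real (Suc N))"
        unfolding R_def using norm_root_op_mult_diff_le[OF T(1)] by (intro always_eventually allI) blast
    qed (rule LIMSEQ_inverse_real_of_nat)
    then have "(\<lambda>N. ((R N o\<^sub>L T) - T) z + T z) \<longlonglongrightarrow> blinfun_apply 0 z + T z"
      by (intro tendsto_intros)
    then have RP: "(\<lambda>N. R N (P x)) \<longlonglongrightarrow> P x"
      by (simp add: blinfun.bilinear_simps z)
    have "P x \<in> ell2.span B"
      unfolding P_def by (intro oproj_in_subspace ell2.subspace_span ell2.span_superset)
    then have "cinner (x - P x) (P x) = 0"
      by (rule cinner_eq_0_span[OF B(1)]) (simp add: P_def cinner_oproj_complement[OF B(1,2)])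
    from arg_cong[OF this, of Re] have orth: "inner (P x) (x - P x) = 0"
      by (subst inner_commute) (simp only: Re_cinner zero_complex.simps)
    have "(\<lambda>N. low N x) \<longlonglongrightarrow> inner (P x) (P x) + 2 * inner (P x) (x - P x)"
      unfolding low_def by (intro tendsto_intros RP)
    moreover have "inner (P x) (P x) = (\<Sum>v\<in>B. (cmod (cinner x v))\<^sup>2)"
      by (simp add: P_def norm_oproj_sq[OF B(1,2)] flip: power2_norm_eq_inner)
    ultimately show ?thesis by (simp add: orth)
  qed
  define s where "s M = (\<Sum>i<M. \<Sum>v\<in>B. (cmod (coord v i))\<^sup>2)" for M
  \<comment> \<open>Two limits in succession. The first \<open>M\<close> diagonal entries are kept
    while the exponent of the root tends to 0; for \<open>N \<ge> M\<close> they all occur in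
    \<open>?g N\<close>, whose other entries are nonnegative. Only afterwards does \<open>M\<close>
    grow.\<close>
  have "ennreal (s M) \<le> (SUP N. ennreal (?g N))" for M
  proof (rule LIMSEQ_le_const2)
    have "(\<lambda>N. \<Sum>i<M. low N (basis_vec i)) \<longlonglongrightarrow> s M"
      unfolding s_def by (intro tendsto_sum) (use low_lim[of "basis_vec _"] in simp)
    then show "(\<lambda>N. ennreal (\<Sum>i<M. low N (basis_vec i))) \<longlonglongrightarrow> ennreal (s M)"
      by (rule tendsto_ennrealI)
    have "ennreal (\<Sum>i<M. low N (basis_vec i)) \<le> (SUP N. ennreal (?g N))" if "M \<le> N" for N
    proof (rule SUP_upper2[OF UNIV_I], rule ennreal_leI)
      have "(\<Sum>i<M. low N (basis_vec i)) \<le> (\<Sum>i<M. inner (R N (basis_vec i)) (basis_vec i))"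
        by (intro sum_mono low_le)
      also have "\<dots> \<le> ?g N"
        unfolding R_def[symmetric] using that by (intro sum_mono2) (auto intro: pos_contraction_nonneg[OF R])
      finally show "(\<Sum>i<M. low N (basis_vec i)) \<le> ?g N" .
    qed
    then show "\<exists>n0. \<forall>N\<ge>n0. ennreal (\<Sum>i<M. low N (basis_vec i)) \<le> (SUP N. ennreal (?g N))" by blast
  qed
  moreover have "(\<lambda>M. ennreal (s M)) \<longlonglongrightarrow> ennreal (\<Sum>v\<in>B. (norm v)\<^sup>2)"
    unfolding s_def by (subst sum.swap) (intro tendsto_ennrealI tendsto_sum norm_sq_sums[unfolded sums_def])
  ultimately have "ennreal (\<Sum>v\<in>B. (norm v)\<^sup>2) \<le> (SUP N. ennreal (?g N))"
    by (intro LIMSEQ_le_const2) auto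
  then show ?thesis by (simp add: orthonormal_norm[OF B(2)] flip: ennreal_of_nat_eq_real_of_nat)
qed

text \<open>A single index drives both the root and the number of diagonal entries. The rank
  function is thereby the supremum of one increasing sequence of continuous functions, the form
  needed for \<open>trace_lsc_SUP\<close>. For infinite rank, orthonormal systems of every size push
  the supremum to \<open>top\<close>.\<close>

lemma SUP_trace_root_op_eq_rank:
  assumes T: "pos_contraction T" "clinear_op T"
  shows "(SUP N. ennreal (\<Sum>i<N. inner (root_op (Suc N) T (basis_vec i)) (basis_vec i)))
    = ennreal_of_enat (rank_op T)"
  using T(2)
proof (cases rule: rank_op_cases)
  case (1 B)
  show ?thesis
  proof (rule antisym)
    show "(SUP N. ennreal (\<Sum>i<N. inner (root_op (Suc N) T (basis_vec i)) (basis_vec i)))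
        \<le> ennreal_of_enat (rank_op T)"
    proof (rule SUP_least)
      fix N
      have "(\<Sum>i<N. inner (root_op (Suc N) T (basis_vec i)) (basis_vec i)) \<le> real (card B)"
        by (rule trace_root_op_le_card[OF T 1(1-4)]) simp
      then show "ennreal (\<Sum>i<N. inner (root_op (Suc N) T (basis_vec i)) (basis_vec i))
          \<le> ennreal_of_enat (rank_op T)"
        by (simp add: 1 ennreal_of_nat_eq_real_of_nat ennreal_leI)
    qed
    show "ennreal_of_enat (rank_op T)
        \<le> (SUP N. ennreal (\<Sum>i<N. inner (root_op (Suc N) T (basis_vec i)) (basis_vec i)))"
      using card_le_SUP_trace_root_op[OF T 1(1-3)] by (simp add: 1)
  qed
next
  case 2
  have "of_nat n \<le> (SUP N. ennreal (\<Sum>i<N. inner (root_op (Suc N) T (basis_vec i)) (basis_vec i)))" for n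
  proof -
    obtain B where B: "finite B" "orthonormal B" "B \<subseteq> range T" "card B = n"
      using 2(2) by blast
    show ?thesis using card_le_SUP_trace_root_op[OF T B(1-3)] unfolding B(4) .
  qed
  then have "(SUP n. of_nat n) \<le> (SUP N. ennreal (\<Sum>i<N. inner (root_op (Suc N) T (basis_vec i)) (basis_vec i)))"
    by (intro SUP_least)
  then have "(SUP N. ennreal (\<Sum>i<N. inner (root_op (Suc N) T (basis_vec i)) (basis_vec i))) = top"
    by (simp add: ennreal_SUP_of_nat_eq_top top_unique)
  then show ?thesis by (simp add: 2)
qed

section \<open>Positive elements and the Cuntz semigroup\<close>

lemma closedin_norm_ge: "continuous_map X euclidean f \<Longrightarrow> closedin X {x \<in> topspace X. e \<le> norm (f x)}"
  using closedin_continuous_map_preimage[of X euclidean f "{y. e \<le> norm y}"]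
  by (simp add: closed_Collect_le continuous_on_norm_id)

lemma
  assumes "f \<in> vanishing_at_infinity X"
  shows vanishing_at_infinity_continuous: "continuous_map X euclidean f"
    and vanishing_at_infinity_compactin: "0 < e \<Longrightarrow> compactin X {x \<in> topspace X. e \<le> norm (f x)}"
    and vanishing_at_infinity_outside: "x \<notin> topspace X \<Longrightarrow> f x = 0"
  using assms by (simp_all add: vanishing_at_infinity_def)

lemma vanishing_at_infinityI:
  assumes "continuous_map X euclidean f" and "\<And>x. x \<notin> topspace X \<Longrightarrow> f x = 0"
    and "\<And>e. 0 < e \<Longrightarrow> \<exists>K. compactin X K \<and> {x \<in> topspace X. e \<le> norm (f x)} \<subseteq> K"
  shows "f \<in> vanishing_at_infinity X"
  unfolding vanishing_at_infinity_def
proof (intro CollectI conjI allI impI assms(1))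
  fix e :: real assume "0 < e"
  from assms(3)[OF this] obtain K where "compactin X K" "{x \<in> topspace X. e \<le> norm (f x)} \<subseteq> K"
    by blast
  then show "compactin X {x \<in> topspace X. e \<le> norm (f x)}"
    using closedin_norm_ge[OF assms(1)] by (rule closed_compactin)
qed (use assms(2) in simp)

text \<open>Continuity of \<open>G\<close> at 0 confines large values of \<open>G (f x)\<close> to
  points where \<open>f x\<close> is large. The domain \<open>D\<close> is there for adjoints and
  roots, whose continuity is established only on complex-linear operators and on positive
  contractions.\<close>

lemma vanishing_at_infinity_compose:
  assumes f: "f \<in> vanishing_at_infinity X" and D: "\<And>x. x \<in> topspace X \<Longrightarrow> f x \<in> D"
    and G: "continuous_on D G" "0 \<in> D" "G 0 = 0"
  shows "(\<lambda>x. G (f x)) \<in> vanishing_at_infinity X"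
proof (rule vanishing_at_infinityI)
  have f': "continuous_map X (top_of_set D) f"
    using vanishing_at_infinity_continuous[OF f] D by (auto simp: continuous_map_in_subtopology)
  have "continuous_map (top_of_set D) euclidean G"
    using G(1) by simp
  from continuous_map_compose[OF f' this] show "continuous_map X euclidean (\<lambda>x. G (f x))"
    by (simp add: o_def)
  show "G (f x) = 0" if "x \<notin> topspace X" for x
    using vanishing_at_infinity_outside[OF f that] G(3) by simp
  fix e :: real assume "0 < e"
  then obtain d where d: "0 < d" "\<And>y. y \<in> D \<Longrightarrow> norm y < d \<Longrightarrow> norm (G y) < e"
    using G(1)[unfolded continuous_on_iff, rule_format, OF G(2) \<open>0 < e\<close>] by (auto simp: dist_norm G(3))
  have "{x \<in> topspace X. e \<le> norm (G (f x))} \<subseteq> {x \<in> topspace X. d \<le> norm (f x)}"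
    using d(2) D by force
  then show "\<exists>K. compactin X K \<and> {x \<in> topspace X. e \<le> norm (G (f x))} \<subseteq> K"
    using vanishing_at_infinity_compactin[OF f d(1)] by blast
qed

lemma vanishing_at_infinity_Pair:
  assumes f: "f \<in> vanishing_at_infinity X" and g: "g \<in> vanishing_at_infinity X"
  shows "(\<lambda>x. (f x, g x)) \<in> vanishing_at_infinity X"
proof (rule vanishing_at_infinityI)
  show "continuous_map X euclidean (\<lambda>x. (f x, g x))"
    using continuous_map_pairedI[OF vanishing_at_infinity_continuous[OF f] vanishing_at_infinity_continuous[OF g]]
    by (simp add: euclidean_product_topology)
  show "(f x, g x) = 0" if "x \<notin> topspace X" for x
    using vanishing_at_infinity_outside[OF f that] vanishing_at_infinity_outside[OF g that] by (simp add: zero_prod_def)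
  fix e :: real assume e: "0 < e"
  let ?K = "{x \<in> topspace X. e / 2 \<le> norm (f x)} \<union> {x \<in> topspace X. e / 2 \<le> norm (g x)}"
  have "x \<in> ?K" if "x \<in> topspace X" "e \<le> norm (f x, g x)" for x
    using norm_Pair_le[of "f x" "g x"] that by auto
  moreover have "compactin X ?K"
    using e by (intro compactin_Un vanishing_at_infinity_compactin f g) auto
  ultimately show "\<exists>K. compactin X K \<and> {x \<in> topspace X. e \<le> norm (f x, g x)} \<subseteq> K" by blast
qed

lemma vanishing_at_infinity_bounded:
  assumes f: "f \<in> vanishing_at_infinity X"
  obtains M where "0 < M" "\<And>x. norm (f x) \<le> M"
proof -
  have "compact (f ` {x \<in> topspace X. 1 \<le> norm (f x)})"
    using image_compactin[OF vanishing_at_infinity_compactin[OF f, of 1] vanishing_at_infinity_continuous[OF f]] by simp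
  then obtain B where "\<forall>y\<in>f ` {x \<in> topspace X. 1 \<le> norm (f x)}. norm y \<le> B"
    by (auto dest!: compact_imp_bounded simp only: bounded_iff)
  then have B: "norm (f x) \<le> B" if "x \<in> topspace X" "1 \<le> norm (f x)" for x
    using that by simp
  have "norm (f x) \<le> max B 1" for x
    using B[of x] vanishing_at_infinity_outside[OF f, of x]
    by (cases "x \<in> topspace X"; cases "1 \<le> norm (f x)") auto
  then show ?thesis by (intro that[of "max B 1"]) auto
qed

lemma C0K_compose:
  assumes a: "a \<in> C0K X" and D: "\<And>x. x \<in> topspace X \<Longrightarrow> a x \<in> D"
    and G: "continuous_on D G" "0 \<in> D" "G 0 = 0" "\<And>T. T \<in> D \<Longrightarrow> T \<in> compact_operators \<Longrightarrow> G T \<in> compact_operators"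
  shows "(\<lambda>x. G (a x)) \<in> C0K X"
proof -
  have "G (a x) \<in> compact_operators" for x
  proof (cases "x \<in> topspace X")
    case False
    then have "a x = 0" using a by (auto simp: C0K_def intro: vanishing_at_infinity_outside)
    then show ?thesis using G by simp
  qed (use a D G in \<open>auto simp: C0K_def\<close>)
  then show ?thesis
    using a vanishing_at_infinity_compose[of a X D G] D G by (auto simp: C0K_def)
qed

lemma C0K_posI: "b \<in> C0K X \<Longrightarrow> (\<lambda>x. adjoint_op (b x) o\<^sub>L b x) \<in> C0K_pos X"
  unfolding C0K_pos_def by (rule CollectI, rule exI[of _ b]) simp

lemma C0K_pos_subset_C0K: "C0K_pos X \<subseteq> C0K X"
proof
  fix a assume "a \<in> C0K_pos X"
  then obtain b where b: "a = (\<lambda>x. adjoint_op (b x) o\<^sub>L b x)" "b \<in> C0K X" by (auto simp: C0K_pos_def)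
  have "adjoint_op (0 :: operator) = 0" by (rule adjoint_op_unique) simp
  then show "a \<in> C0K X"
    unfolding b(1)
    by (intro C0K_compose[OF b(2), of "{T. clinear_op T}"] compact_operators_compose clinear_op_adjoint_op
        continuous_intros continuous_on_adjoint_op)
      (use b(2) in \<open>auto simp: C0K_def intro: compact_operatorsD\<close>)
qed

lemma C0K_pos_pos_op: "a \<in> C0K_pos X \<Longrightarrow> pos_op (a x)"
  by (auto simp: C0K_pos_def C0K_def intro!: pos_op_adjoint_compose compact_operatorsD)

lemma C0K_pos_vanishing: "a \<in> C0K_pos X \<Longrightarrow> a \<in> vanishing_at_infinity X"
  using C0K_pos_subset_C0K by (fastforce simp: C0K_def)

lemma C0K_pos_scaleR:
  assumes a: "a \<in> C0K_pos X" and s: "0 \<le> s"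
  shows "(\<lambda>x. s *\<^sub>R a x) \<in> C0K_pos X"
proof -
  obtain b where b: "a = (\<lambda>x. adjoint_op (b x) o\<^sub>L b x)" "b \<in> C0K X" using a by (auto simp: C0K_pos_def)
  have lin: "clinear_op (b x)" for x using b(2) by (auto simp: C0K_def intro: compact_operatorsD)
  have "(\<lambda>x. sqrt s *\<^sub>R b x) \<in> C0K X"
    by (intro C0K_compose[OF b(2), of UNIV] continuous_intros compact_operators_scaleR) auto
  moreover have "adjoint_op (sqrt s *\<^sub>R b x) = sqrt s *\<^sub>R adjoint_op (b x)" for x
    by (rule adjoint_op_unique)
      (simp add: blinfun.bilinear_simps scaleR_eq_scaleC cinner_scaleC_left cinner_scaleC_right cinner_adjoint_op[OF lin])
  then have "(\<lambda>x. s *\<^sub>R a x) = (\<lambda>x. adjoint_op (sqrt s *\<^sub>R b x) o\<^sub>L (sqrt s *\<^sub>R b x))"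
    using s by (auto intro!: ext blinfun_eqI simp: b(1) blinfun.bilinear_simps)
  ultimately show ?thesis using C0K_posI[of "\<lambda>x. sqrt s *\<^sub>R b x" X] by simp
qed

lemma C0K_root_op:
  assumes a: "a \<in> C0K X" and pc: "\<And>x. pos_contraction (a x)" and n: "0 < n"
  shows "(\<lambda>x. root_op n (a x)) \<in> C0K X"
proof (rule C0K_compose[OF a, of "{T. pos_contraction T}"])
  show "root_op n (0 :: operator) = 0"
    by (rule blinfun_eqI) (simp add: root_op_eq_0[OF _ n])
qed (use pc n in \<open>auto intro: continuous_on_root_op compact_operators_root_op\<close>)

context
  fixes X :: "'a topology" and a :: "'a \<Rightarrow> operator"
  assumes a: "a \<in> C0K_pos X" and contr: "\<And>x. x \<in> topspace X \<Longrightarrow> norm (a x) \<le> 1"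
begin

lemma C0K_pos_pos_contraction: "pos_contraction (a x)"
  using contr[of x] vanishing_at_infinity_outside[OF C0K_pos_vanishing[OF a], of x]
  by (intro pos_contraction_of_pos_op[OF C0K_pos_pos_op[OF a]]) (cases "x \<in> topspace X"; simp)

text \<open>The root of order \<open>2 * n\<close> is self-adjoint, so its square has the form
  required by \<open>C0K_pos\<close>.\<close>

lemma C0K_pos_root_op:
  assumes n: "0 < n"
  shows "(\<lambda>x. root_op n (a x)) \<in> C0K_pos X"
proof -
  have "pos_op (root_op (2 * n) (a x))" for x
    using C0K_pos_pos_contraction pos_op_clinear[OF C0K_pos_pos_op[OF a]] n by (intro pos_op_root_op) auto
  then have "(\<lambda>x. root_op n (a x)) = (\<lambda>x. adjoint_op (root_op (2 * n) (a x)) o\<^sub>L root_op (2 * n) (a x))"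
    by (simp add: adjoint_op_pos_op root_op_double[OF C0K_pos_pos_contraction n])
  moreover have "(\<lambda>x. root_op (2 * n) (a x)) \<in> C0K X"
    using a C0K_pos_subset_C0K n by (intro C0K_root_op C0K_pos_pos_contraction) auto
  ultimately show ?thesis using C0K_posI[of "\<lambda>x. root_op (2 * n) (a x)" X] by simp
qed

text \<open>\<open>C0K_nth_root\<close> is a definite description: existence comes from the
  functional calculus, and uniqueness holds point by point through
  \<open>pos_op_root_unique\<close>.\<close>

lemma C0K_nth_root_eq:
  assumes n: "0 < n"
  shows "C0K_nth_root X n a = (\<lambda>x. root_op n (a x))"
  unfolding C0K_nth_root_def
proof (rule the_equality)
  have pow: "op_power (root_op n (a x)) n = a x" for x
    unfolding op_power_eq_op_poly by (rule op_poly_root_op_power[OF C0K_pos_pos_contraction n])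
  then show "(\<lambda>x. root_op n (a x)) \<in> C0K_pos X \<and> (\<lambda>x. op_power (root_op n (a x)) n) = a"
    using C0K_pos_root_op[OF n] by simp
  fix b assume b: "b \<in> C0K_pos X \<and> (\<lambda>x. op_power (b x) n) = a"
  show "b = (\<lambda>x. root_op n (a x))"
  proof
    fix x
    have "op_power (b x) n = a x"
      using fun_cong[OF conjunct2[OF b], of x] .
    also note pow[of x, symmetric]
    finally have "op_power (b x) n = op_power (root_op n (a x)) n" .
    then show "b x = root_op n (a x)"
      by (rule pos_op_root_unique[OF C0K_pos_pos_op[OF conjunct1[OF b]] C0K_pos_pos_op[OF C0K_pos_root_op[OF n]] _ n])
  qed
qed

end

text \<open>A multiple of the identity operator is not compact, so it cannot serve as the
  conjugating element. Its place is taken by \<open>sqrt s\<close> times the roots of the normalised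
  element \<open>c\<close>, an approximate unit whose rate is uniform in \<open>x\<close>; the
  square root appears because the conjugating element enters twice.\<close>

lemma cuntz_below_scaleR:
  assumes a: "a \<in> C0K_pos X" and s: "0 < s"
  shows "cuntz_below X (\<lambda>x. s *\<^sub>R a x) a"
proof -
  obtain M where M: "0 < M" "\<And>x. norm (a x) \<le> M"
    using vanishing_at_infinity_bounded[OF C0K_pos_vanishing[OF a]] by blast
  define c where "c = (\<lambda>x. inverse M *\<^sub>R a x)"
  have c: "c \<in> C0K_pos X"
    unfolding c_def using M(1) by (intro C0K_pos_scaleR[OF a]) auto
  have cn: "norm (c x) \<le> 1" for x
    using M by (simp add: c_def field_simps)
  note pc = C0K_pos_pos_contraction[OF c cn]
  define r where "r n x = sqrt s *\<^sub>R root_op (Suc n) (c x)" for n x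
  have rt: "(\<lambda>x. root_op (Suc n) (c x)) \<in> C0K_pos X" for n
    by (rule C0K_pos_root_op[OF c cn]) simp
  have "(\<lambda>x. sqrt s *\<^sub>R root_op (Suc n) (c x)) \<in> C0K X" for n
    by (rule C0K_compose[OF subsetD[OF C0K_pos_subset_C0K rt[of n]], of UNIV "\<lambda>T. sqrt s *\<^sub>R T"])
      (simp_all add: continuous_intros compact_operators_scaleR)
  then have "r n \<in> C0K X" for n
    unfolding r_def[abs_def] by simp
  moreover have "uniform_limit (topspace X) (\<lambda>n x. adjoint_op (r n x) o\<^sub>L a x o\<^sub>L r n x) (\<lambda>x. s *\<^sub>R a x) sequentially"
  proof (rule uniform_limitI)
    fix e :: real assume "0 < e"
    then have "0 < e / (2 * s * M)" using s M by simp
    then obtain N where N: "inverse (real (Suc N)) < e / (2 * s * M)" using reals_Archimedean by blast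
    show "\<forall>\<^sub>F n in sequentially. \<forall>x\<in>topspace X. dist (adjoint_op (r n x) o\<^sub>L a x o\<^sub>L r n x) (s *\<^sub>R a x) < e"
    proof (rule eventually_sequentiallyI[of N], intro ballI)
      fix n x assume n: "N \<le> n"
      let ?R = "root_op (Suc n) (c x)"
      have "adjoint_op (r n x) = r n x"
        unfolding r_def using s by (intro adjoint_op_pos_op pos_op_scaleR C0K_pos_pos_op[OF rt]) auto
      moreover have "a x = M *\<^sub>R c x" using M by (simp add: c_def)
      ultimately have "(adjoint_op (r n x) o\<^sub>L a x o\<^sub>L r n x) - s *\<^sub>R a x = (s * M) *\<^sub>R ((?R o\<^sub>L c x o\<^sub>L ?R) - c x)"
        using s by (auto intro!: blinfun_eqI simp: r_def blinfun.bilinear_simps algebra_simps)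
      then have "dist (adjoint_op (r n x) o\<^sub>L a x o\<^sub>L r n x) (s *\<^sub>R a x) = s * M * norm ((?R o\<^sub>L c x o\<^sub>L ?R) - c x)"
        using s M by (simp add: dist_norm)
      also have "\<dots> \<le> s * M * (2 * inverse (real (Suc n)))"
        using s M norm_root_op_conj_diff_le[OF pc, of "Suc n"] by (intro mult_left_mono) auto
      also have "\<dots> \<le> s * M * (2 * inverse (real (Suc N)))"
        using s M n by (intro mult_left_mono) (auto intro: le_imp_inverse_le)
      also have "\<dots> < e"
        using N s M by (simp add: field_simps)
      finally show "dist (adjoint_op (r n x) o\<^sub>L a x o\<^sub>L r n x) (s *\<^sub>R a x) < e" .
    qed
  qed
  ultimately show ?thesis unfolding cuntz_below_def by blast
qed

lemma scaleR_in_cuntz_class: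
  assumes a: "a \<in> C0K_pos X" and s: "0 < s"
  shows "(\<lambda>x. s *\<^sub>R a x) \<in> cuntz_class X a"
  using C0K_pos_scaleR[OF a, of s] cuntz_below_scaleR[OF a s]
    cuntz_below_scaleR[of "\<lambda>x. s *\<^sub>R a x" X "inverse s"] s
  by (simp add: cuntz_class_def)

text \<open>At each point \<open>a x\<close> is a limit of operators that factor through
  \<open>b x\<close>, and rank cannot go up in a limit. Hence the rank function is constant on a
  Cuntz class and \<open>rank_map\<close> is well defined.\<close>

lemma rank_op_le_of_cuntz_below:
  assumes a: "a \<in> C0K_pos X" and b: "b \<in> C0K_pos X" and below: "cuntz_below X a b"
  shows "rank_op (a x) \<le> rank_op (b x)"
proof (cases "x \<in> topspace X")
  case True
  obtain r where r: "\<And>n. r n \<in> C0K X"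
    and lim: "uniform_limit (topspace X) (\<lambda>n x. adjoint_op (r n x) o\<^sub>L b x o\<^sub>L r n x) a sequentially"
    using below by (auto simp: cuntz_below_def)
  show ?thesis
  proof (rule rank_op_limit_le)
    show "(\<lambda>n. adjoint_op (r n x) o\<^sub>L b x o\<^sub>L r n x) \<longlonglongrightarrow> a x"
      by (rule tendsto_uniform_limitI[OF lim True])
    show "clinear_op (a x)" by (rule pos_op_clinear[OF C0K_pos_pos_op[OF a]])
    show "rank_op (adjoint_op (r n x) o\<^sub>L b x o\<^sub>L r n x) \<le> rank_op (b x)" for n
      using r[of n] by (intro rank_op_compose_le clinear_op_adjoint_op pos_op_clinear[OF C0K_pos_pos_op[OF b]])
        (auto simp: C0K_def intro: compact_operatorsD)
  qed
next
  case False
  then have "a x = 0" using vanishing_at_infinity_outside[OF C0K_pos_vanishing[OF a]] by blast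
  then show ?thesis using rank_op_eq_0_iff[of "a x"] by simp
qed

lemma Cu_member_C0K_pos: "C \<in> Cu X \<Longrightarrow> a \<in> C \<Longrightarrow> a \<in> C0K_pos X"
  by (auto simp: Cu_def cuntz_class_def)

lemma rank_map_eq:
  assumes C: "C \<in> Cu X" and a: "a \<in> C"
  shows "rank_map X C = (\<lambda>x. rank_op (a x))"
proof -
  obtain a0 where a0: "a0 \<in> C0K_pos X" "C = cuntz_class X a0" using C by (auto simp: Cu_def)
  have "rank_op (b x) = rank_op (a0 x)" if "b \<in> C" for b x
    using that rank_op_le_of_cuntz_below[of b X a0 x] rank_op_le_of_cuntz_below[of a0 X b x] a0
    by (intro antisym) (auto simp: cuntz_class_def)
  then have "(\<lambda>b x. rank_op (b x)) ` C = {\<lambda>x. rank_op (a x)}"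
    using a by (auto simp: image_iff)
  then show ?thesis by (simp add: rank_map_def)
qed

text \<open>\<open>d_functional\<close> evaluates only contractions of a class; this ensures that
  there are some.\<close>

lemma Cu_contractive_representative:
  assumes C: "C \<in> Cu X"
  obtains a where "a \<in> C" "\<And>x. norm (a x) \<le> 1"
proof -
  obtain a0 where a0: "a0 \<in> C0K_pos X" "C = cuntz_class X a0" using C by (auto simp: Cu_def)
  obtain M where M: "0 < M" "\<And>x. norm (a0 x) \<le> M"
    using vanishing_at_infinity_bounded[OF C0K_pos_vanishing[OF a0(1)]] by blast
  show ?thesis
    using scaleR_in_cuntz_class[OF a0(1), of "inverse M"] M
    by (intro that[of "\<lambda>x. inverse M *\<^sub>R a0 x"]) (auto simp: a0 field_simps)
qed

section \<open>Traces and the functional\<close>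

text \<open>Positive elements as real functions, for which differences and cut-offs can be formed;
  \<open>C0_pos_cases\<close> and \<open>of_real_C0_nonneg_in_C0_pos\<close> identify them with
  \<open>C0_pos\<close>.\<close>

definition C0_nonneg :: "'a topology \<Rightarrow> ('a \<Rightarrow> real) set" where
  "C0_nonneg X = {g \<in> vanishing_at_infinity X. \<forall>x. 0 \<le> g x}"

definition real_trace :: "(('a \<Rightarrow> complex) \<Rightarrow> ennreal) \<Rightarrow> ('a \<Rightarrow> real) \<Rightarrow> ennreal" where
  "real_trace \<mu> g = \<mu> (\<lambda>x. complex_of_real (g x))"

text \<open>For a Radon measure \<open>\<mu>\<close> this is \<open>\<integral> F d\<mu>\<close> for lower semicontinuous \<open>F\<close>.\<close>

definition trace_lsc :: "'a topology \<Rightarrow> (('a \<Rightarrow> complex) \<Rightarrow> ennreal) \<Rightarrow> ('a \<Rightarrow> ennreal) \<Rightarrow> ennreal" where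
  "trace_lsc X \<mu> F = (SUP h\<in>{h \<in> C0_nonneg X. \<forall>x. ennreal (h x) \<le> F x}. real_trace \<mu> h)"

lemma C0_nonneg_nonneg: "g \<in> C0_nonneg X \<Longrightarrow> 0 \<le> g x"
  and C0_nonneg_vanishing: "g \<in> C0_nonneg X \<Longrightarrow> g \<in> vanishing_at_infinity X"
  by (simp_all add: C0_nonneg_def)

lemma C0_nonneg_compose:
  assumes g: "g \<in> vanishing_at_infinity X" and G: "continuous_on UNIV G" "G 0 = 0" "\<And>x. 0 \<le> G (g x)"
  shows "(\<lambda>x. G (g x)) \<in> C0_nonneg X"
  using vanishing_at_infinity_compose[OF g, of UNIV G] G by (simp add: C0_nonneg_def)

lemma C0_nonneg_compose2:
  fixes g h :: "'a \<Rightarrow> real"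
  assumes "g \<in> C0_nonneg X" "h \<in> C0_nonneg X"
    and G: "continuous_on UNIV (\<lambda>p. G (fst p) (snd p))" "G 0 0 = 0" "\<And>x. 0 \<le> G (g x) (h x)"
  shows "(\<lambda>x. G (g x) (h x)) \<in> C0_nonneg X"
  using C0_nonneg_compose[OF vanishing_at_infinity_Pair[OF assms(1,2)[THEN C0_nonneg_vanishing]] G(1)] G(2,3) by simp

lemma C0_nonneg_0: "(\<lambda>x. 0) \<in> C0_nonneg X"
  by (simp add: C0_nonneg_def vanishing_at_infinity_def)

lemma C0_nonneg_add: "g \<in> C0_nonneg X \<Longrightarrow> h \<in> C0_nonneg X \<Longrightarrow> (\<lambda>x. g x + h x) \<in> C0_nonneg X"
  by (rule C0_nonneg_compose2) (auto intro!: continuous_intros simp: C0_nonneg_nonneg)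

lemma C0_nonneg_diff:
  "g \<in> C0_nonneg X \<Longrightarrow> h \<in> C0_nonneg X \<Longrightarrow> (\<And>x. h x \<le> g x) \<Longrightarrow> (\<lambda>x. g x - h x) \<in> C0_nonneg X"
  by (rule C0_nonneg_compose2) (auto intro!: continuous_intros)

lemma C0_nonneg_sum: "(\<And>i. i \<in> I \<Longrightarrow> g i \<in> C0_nonneg X) \<Longrightarrow> (\<lambda>x. \<Sum>i\<in>I. g i x) \<in> C0_nonneg X"
  by (induction I rule: infinite_finite_induct) (auto intro: C0_nonneg_0 C0_nonneg_add)

lemma C0_nonneg_scale: "g \<in> C0_nonneg X \<Longrightarrow> 0 \<le> t \<Longrightarrow> (\<lambda>x. t * g x) \<in> C0_nonneg X"
  by (rule C0_nonneg_compose[OF C0_nonneg_vanishing]) (auto intro!: continuous_intros simp: C0_nonneg_nonneg)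

lemma C0_nonneg_cutoff: "g \<in> C0_nonneg X \<Longrightarrow> 0 \<le> e \<Longrightarrow> (\<lambda>x. max 0 (g x - e)) \<in> C0_nonneg X"
  by (rule C0_nonneg_compose[OF C0_nonneg_vanishing]) (auto intro!: continuous_intros)

lemma sqrt_C0_nonneg:
  assumes g: "g \<in> C0_nonneg X"
  shows "(\<lambda>x. complex_of_real (sqrt (g x))) \<in> C0 X"
  unfolding C0_def
  by (rule vanishing_at_infinity_compose[OF C0_nonneg_vanishing[OF g], of UNIV "\<lambda>t. complex_of_real (sqrt t)"])
    (auto intro!: continuous_intros)

lemma of_real_sqrt_square: "0 \<le> t \<Longrightarrow> cnj (complex_of_real (sqrt t)) * complex_of_real (sqrt t) = complex_of_real t"
  by (simp flip: of_real_mult)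

lemma of_real_C0_nonneg_in_C0_pos:
  assumes g: "g \<in> C0_nonneg X"
  shows "(\<lambda>x. complex_of_real (g x)) \<in> C0_pos X"
proof -
  have "(\<lambda>x. complex_of_real (g x)) = (\<lambda>x. cnj (complex_of_real (sqrt (g x))) * complex_of_real (sqrt (g x)))"
    by (intro ext of_real_sqrt_square[symmetric] C0_nonneg_nonneg[OF g])
  then show ?thesis
    unfolding C0_pos_def using sqrt_C0_nonneg[OF g] by (intro CollectI exI conjI)
qed

lemma C0_pos_cases:
  assumes "a \<in> C0_pos X"
  obtains g where "g \<in> C0_nonneg X" "a = (\<lambda>x. complex_of_real (g x))"
proof -
  obtain b where b: "a = (\<lambda>x. cnj (b x) * b x)" "b \<in> C0 X" using assms by (auto simp: C0_pos_def)
  have "(\<lambda>x. (cmod (b x))\<^sup>2) \<in> C0_nonneg X"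
    using b(2) unfolding C0_def by (rule C0_nonneg_compose) (auto intro!: continuous_intros)
  moreover have "a = (\<lambda>x. complex_of_real ((cmod (b x))\<^sup>2))"
    unfolding b(1) complex_norm_square by (simp add: mult.commute)
  ultimately show ?thesis by (rule that)
qed

lemma compactin_incseq_cover:
  assumes K: "compactin X K" and U: "\<And>k::nat. openin X (U k)" "incseq U" and cover: "K \<subseteq> (\<Union>k. U k)"
  shows "\<exists>k. K \<subseteq> U k"
proof -
  obtain \<F> where \<F>: "finite \<F>" "\<F> \<subseteq> range U" "K \<subseteq> \<Union>\<F>"
    using compactinD[OF K, of "range U"] U(1) cover by blast
  then obtain I where I: "finite I" "\<F> = U ` I" by (meson finite_subset_image)
  have "U i \<subseteq> U (Max (insert 0 I))" if "i \<in> I" for i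
    using that I(1) by (intro incseqD[OF U(2)] Max_ge) auto
  then show ?thesis using \<F>(3) I(2) by blast
qed

context
  fixes X :: "'a topology" and \<mu> :: "('a \<Rightarrow> complex) \<Rightarrow> ennreal"
  assumes trace: "is_trace X \<mu>"
begin

lemma real_trace_0: "real_trace \<mu> (\<lambda>x. 0) = 0"
  using trace by (simp add: is_trace_def real_trace_def)

lemma real_trace_add:
  assumes "g \<in> C0_nonneg X" "h \<in> C0_nonneg X"
  shows "real_trace \<mu> (\<lambda>x. g x + h x) = real_trace \<mu> g + real_trace \<mu> h"
  using trace assms[THEN of_real_C0_nonneg_in_C0_pos] by (simp add: is_trace_def real_trace_def)

lemma real_trace_scale:
  assumes "g \<in> C0_nonneg X" "0 < t"
  shows "real_trace \<mu> (\<lambda>x. t * g x) = ennreal t * real_trace \<mu> g"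
  using trace assms(2) of_real_C0_nonneg_in_C0_pos[OF assms(1)] by (simp add: is_trace_def real_trace_def)

lemma real_trace_sum:
  assumes "\<And>i. i \<in> I \<Longrightarrow> g i \<in> C0_nonneg X" and "finite I"
  shows "real_trace \<mu> (\<lambda>x. \<Sum>i\<in>I. g i x) = (\<Sum>i\<in>I. real_trace \<mu> (g i))"
  using assms(2,1) by (induction I rule: finite_induct) (simp_all add: real_trace_0 real_trace_add C0_nonneg_sum)

lemma real_trace_mono:
  assumes g: "g \<in> C0_nonneg X" and h: "h \<in> C0_nonneg X" and le: "\<And>x. g x \<le> h x"
  shows "real_trace \<mu> g \<le> real_trace \<mu> h"
proof -
  have "real_trace \<mu> h = real_trace \<mu> g + real_trace \<mu> (\<lambda>x. h x - g x)"
    using real_trace_add[OF g C0_nonneg_diff[OF h g le]] by simp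
  then show ?thesis by simp
qed

text \<open>As in Dini's theorem, the cut-off \<open>(h - \<epsilon>)\<^sub>+\<close> has compact support and lies below some \<open>g k\<close>.\<close>

lemma real_trace_le_SUP:
  assumes g: "\<And>k::nat. g k \<in> C0_nonneg X" and mono: "\<And>j k x. j \<le> k \<Longrightarrow> g j x \<le> g k x"
    and h: "h \<in> C0_nonneg X" and le: "\<And>x. ennreal (h x) \<le> (SUP k. ennreal (g k x))"
  shows "real_trace \<mu> h \<le> (SUP k. real_trace \<mu> (g k))"
proof (rule dense_le)
  fix c assume "c < real_trace \<mu> h"
  then obtain e where e: "0 < e"
    and lsc: "\<And>b. b \<in> C0_pos X \<Longrightarrow> (\<And>x. x \<in> topspace X \<Longrightarrow> cmod (b x - complex_of_real (h x)) < e) \<Longrightarrow> c < \<mu> b"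
    using trace of_real_C0_nonneg_in_C0_pos[OF h] unfolding is_trace_def real_trace_def by meson
  \<comment> \<open>Within distance e of \<open>h\<close>, so lower semicontinuity keeps its trace
    above \<open>c\<close>.\<close>
  define h' where "h' = (\<lambda>x. max 0 (h x - e / 2))"
  have h': "h' \<in> C0_nonneg X"
    unfolding h'_def using e by (intro C0_nonneg_cutoff h) simp
  have "cmod (complex_of_real (h' x) - complex_of_real (h x)) < e" for x
  proof -
    have "\<bar>h' x - h x\<bar> < e" using C0_nonneg_nonneg[OF h, of x] e by (auto simp: h'_def max_def)
    then show ?thesis by (simp flip: of_real_diff)
  qed
  then have c: "c < real_trace \<mu> h'"
    unfolding real_trace_def by (intro lsc of_real_C0_nonneg_in_C0_pos h')
  define K where "K = {x \<in> topspace X. e / 2 \<le> norm (h x)}"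
  \<comment> \<open>The open set where \<open>g k\<close> exceeds \<open>h - e / 2\<close>. On
    \<open>K\<close> the function \<open>h\<close> is positive, so this strict inequality is
    eventually reached at every point.\<close>
  define U where "U k = {x \<in> topspace X. h x - g k x \<in> {..<e / 2}}" for k
  have "\<exists>k. K \<subseteq> U k"
  proof (rule compactin_incseq_cover)
    show "compactin X K"
      unfolding K_def using e by (intro vanishing_at_infinity_compactin C0_nonneg_vanishing h) simp
    show "openin X (U k)" for k
    proof -
      have "continuous_map X euclideanreal (\<lambda>x. h x - g k x)"
        by (intro continuous_map_diff vanishing_at_infinity_continuous[OF C0_nonneg_vanishing] h g)
      then show ?thesis
        unfolding U_def by (rule openin_continuous_map_preimage) simp
    qed
    show "incseq U"
    proof (intro monoI subsetI)
      fix j k x assume "j \<le> k" "x \<in> U j"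
      then show "x \<in> U k" using mono[of j k x] by (simp add: U_def)
    qed
    show "K \<subseteq> (\<Union>k. U k)"
    proof
      fix x assume x: "x \<in> K"
      then have "0 < h x" using e C0_nonneg_nonneg[OF h, of x] by (auto simp: K_def)
      then have "ennreal (h x - e / 2) < ennreal (h x)"
        using e by (intro ennreal_lessI) auto
      also note le
      finally obtain k where "ennreal (h x - e / 2) < ennreal (g k x)"
        by (auto simp: less_SUP_iff)
      then have "h x - e / 2 < g k x"
        by (metis ennreal_leI not_le)
      then have "x \<in> U k"
        using x by (simp add: U_def K_def)
      then show "x \<in> (\<Union>k. U k)" by blast
    qed
  qed
  then obtain k where k: "K \<subseteq> U k" by blast
  have "h' x \<le> g k x" for x
  proof (cases "e / 2 \<le> h x")
    case True
    then have "x \<in> K"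
      using e C0_nonneg_nonneg[OF h, of x] vanishing_at_infinity_outside[OF C0_nonneg_vanishing[OF h], of x]
      by (cases "x \<in> topspace X") (auto simp: K_def)
    then show ?thesis using k C0_nonneg_nonneg[OF g, of k x] by (auto simp: U_def h'_def)
  next
    case False
    then show ?thesis using C0_nonneg_nonneg[OF g, of k x] by (simp add: h'_def)
  qed
  then have "real_trace \<mu> h' \<le> real_trace \<mu> (g k)"
    by (intro real_trace_mono h' g)
  also have "\<dots> \<le> (SUP k. real_trace \<mu> (g k))" by (intro SUP_upper UNIV_I)
  finally show "c \<le> (SUP k. real_trace \<mu> (g k))" using c by simp
qed

text \<open>Monotone convergence: every function competing in \<open>trace_lsc\<close> is controlled
  by \<open>real_trace_le_SUP\<close>, and each \<open>g k\<close> is itself a competitor.\<close>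

lemma trace_lsc_SUP:
  assumes g: "\<And>k::nat. g k \<in> C0_nonneg X" and mono: "\<And>j k x. j \<le> k \<Longrightarrow> g j x \<le> g k x"
  shows "trace_lsc X \<mu> (\<lambda>x. SUP k. ennreal (g k x)) = (SUP k. real_trace \<mu> (g k))"
  unfolding trace_lsc_def
proof (rule antisym)
  show "(SUP h\<in>{h \<in> C0_nonneg X. \<forall>x. ennreal (h x) \<le> (SUP k. ennreal (g k x))}. real_trace \<mu> h)
      \<le> (SUP k. real_trace \<mu> (g k))"
    by (rule SUP_least) (use real_trace_le_SUP[of g, OF g mono] in blast)
  show "(SUP k. real_trace \<mu> (g k))
      \<le> (SUP h\<in>{h \<in> C0_nonneg X. \<forall>x. ennreal (h x) \<le> (SUP k. ennreal (g k x))}. real_trace \<mu> h)"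
    by (intro SUP_least SUP_upper CollectI conjI allI g UNIV_I)
qed

lemma trace_lsc_real:
  assumes g: "g \<in> C0_nonneg X"
  shows "trace_lsc X \<mu> (\<lambda>x. ennreal (g x)) = real_trace \<mu> g"
  using trace_lsc_SUP[of "\<lambda>k. g"] g by simp

lemma diagonal_C0_nonneg:
  assumes c: "c \<in> C0K_pos X"
  shows "(\<lambda>x. inner (c x (basis_vec i)) (basis_vec i)) \<in> C0_nonneg X"
  by (rule C0_nonneg_compose[OF C0K_pos_vanishing[OF c], of "\<lambda>T. inner (T (basis_vec i)) (basis_vec i)"])
    (auto intro!: continuous_intros pos_op_nonneg C0K_pos_pos_op[OF c])

text \<open>Diagonal entries of a positive operator are real, so the partial sums are traces of
  functions in \<open>C0_nonneg X\<close> by finite additivity.\<close>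

lemma trace_ext_eq_SUP:
  assumes c: "c \<in> C0K_pos X"
  shows "trace_ext \<mu> c = (SUP N. real_trace \<mu> (\<lambda>x. \<Sum>i<N. inner (c x (basis_vec i)) (basis_vec i)))"
proof -
  have "cinner (c x (basis_vec i)) (basis_vec i) = complex_of_real (inner (c x (basis_vec i)) (basis_vec i))" for x i
  proof (rule complex_eqI)
    have "cinner (c x (basis_vec i)) (basis_vec i) = cinner (basis_vec i) (c x (basis_vec i))"
      using cinner_adjoint_op[OF pos_op_clinear[OF C0K_pos_pos_op[OF c]], of x "basis_vec i" "basis_vec i"]
        adjoint_op_pos_op[OF C0K_pos_pos_op[OF c], of x] by simp
    then show "Im (cinner (c x (basis_vec i)) (basis_vec i))
        = Im (complex_of_real (inner (c x (basis_vec i)) (basis_vec i)))"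
      using cinner_commute[of "c x (basis_vec i)" "basis_vec i"]
      by (metis Im_complex_of_real Reals_cnj_iff complex_is_Real_iff)
  qed (simp only: Re_cinner Re_complex_of_real)
  then have "trace_ext \<mu> c = (\<Sum>i. real_trace \<mu> (\<lambda>x. inner (c x (basis_vec i)) (basis_vec i)))"
    by (simp add: trace_ext_def real_trace_def)
  also have "\<dots> = (SUP N. \<Sum>i<N. real_trace \<mu> (\<lambda>x. inner (c x (basis_vec i)) (basis_vec i)))"
    by (rule suminf_eq_SUP)
  also have "\<dots> = (SUP N. real_trace \<mu> (\<lambda>x. \<Sum>i<N. inner (c x (basis_vec i)) (basis_vec i)))"
    by (subst real_trace_sum) (auto intro: diagonal_C0_nonneg[OF c])
  finally show ?thesis .
qed

text \<open>The diagonal sums \<open>s n N\<close> increase in both indices, so the iterated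
  supremum equals that of \<open>s N N\<close>, whose pointwise supremum is the rank. Monotone
  convergence for \<mu> then exchanges trace and supremum.\<close>

lemma lim_trace_ext_root:
  assumes a: "a \<in> C0K_pos X" and contr: "\<And>x. x \<in> topspace X \<Longrightarrow> norm (a x) \<le> 1"
  shows "lim (\<lambda>n. trace_ext \<mu> (C0K_nth_root X n a)) = trace_lsc X \<mu> (\<lambda>x. ennreal_of_enat (rank_op (a x)))"
proof -
  define s where "s n N x = (\<Sum>i<N. inner (root_op (Suc n) (a x) (basis_vec i)) (basis_vec i))" for n N x
  note pc = C0K_pos_pos_contraction[OF a contr]
  have root: "(\<lambda>x. root_op (Suc n) (a x)) \<in> C0K_pos X" for n
    by (rule C0K_pos_root_op[OF a contr]) simp_all
  have s: "s n N \<in> C0_nonneg X" for n N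
    unfolding s_def[abs_def] by (intro C0_nonneg_sum diagonal_C0_nonneg[OF root])
  have s_mono: "s n N x \<le> s m M x" if "n \<le> m" "N \<le> M" for n m N M x
  proof -
    have "s n N x \<le> s m N x"
      unfolding s_def using that by (intro sum_mono root_op_mono pc) auto
    also have "\<dots> \<le> s m M x"
      unfolding s_def using that
      by (intro sum_mono2 pos_contraction_nonneg pos_contraction_root_op pc) auto
    finally show ?thesis .
  qed
  have ext_root: "trace_ext \<mu> (C0K_nth_root X (Suc n) a) = (SUP N. real_trace \<mu> (s n N))" for n
    unfolding s_def[abs_def] using trace_ext_eq_SUP[OF root[of n]] C0K_nth_root_eq[OF a contr, of "Suc n"] by simp
  have "incseq (\<lambda>n. trace_ext \<mu> (C0K_nth_root X (Suc n) a))"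
    unfolding ext_root by (intro incseq_SucI SUP_mono') (intro real_trace_mono s s_mono, auto)
  then have "(\<lambda>n. trace_ext \<mu> (C0K_nth_root X (Suc n) a)) \<longlonglongrightarrow> (SUP n. trace_ext \<mu> (C0K_nth_root X (Suc n) a))"
    by (rule LIMSEQ_SUP)
  also have "(SUP n. trace_ext \<mu> (C0K_nth_root X (Suc n) a)) = (SUP N. real_trace \<mu> (s N N))"
  proof (rule antisym)
    show "(SUP n. trace_ext \<mu> (C0K_nth_root X (Suc n) a)) \<le> (SUP N. real_trace \<mu> (s N N))"
      unfolding ext_root
    proof (intro SUP_least)
      fix n N
      have "real_trace \<mu> (s n N) \<le> real_trace \<mu> (s (max n N) (max n N))"
        by (intro real_trace_mono s s_mono) auto
      also have "\<dots> \<le> (SUP N. real_trace \<mu> (s N N))" by (intro SUP_upper UNIV_I)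
      finally show "real_trace \<mu> (s n N) \<le> (SUP N. real_trace \<mu> (s N N))" .
    qed
    show "(SUP N. real_trace \<mu> (s N N)) \<le> (SUP n. trace_ext \<mu> (C0K_nth_root X (Suc n) a))"
      unfolding ext_root by (intro SUP_mono) (meson SUP_upper UNIV_I)
  qed
  also have "\<dots> = trace_lsc X \<mu> (\<lambda>x. SUP N. ennreal (s N N x))"
    by (rule trace_lsc_SUP[symmetric]) (intro s, intro s_mono, auto)
  also have "(\<lambda>x. SUP N. ennreal (s N N x)) = (\<lambda>x. ennreal_of_enat (rank_op (a x)))"
    unfolding s_def by (rule ext) (rule SUP_trace_root_op_eq_rank[OF pc pos_op_clinear[OF C0K_pos_pos_op[OF a]]])
  \<comment> \<open>The roots are indexed from 1; the term at index 0 has no effect on the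
    limit.\<close>
  finally show ?thesis
    by (rule limI[OF LIMSEQ_imp_Suc])
qed

text \<open>The limit sees a contraction only through its rank function, which is the same for all
  members of \<open>C\<close>; so \<open>the_elem\<close> is applied to a singleton.\<close>

lemma d_functional_eq:
  assumes C: "C \<in> Cu X"
  shows "d_functional X \<mu> C = trace_lsc X \<mu> (\<lambda>x. ennreal_of_enat (rank_map X C x))"
proof -
  let ?S = "{a \<in> C. \<forall>x\<in>topspace X. norm (a x) \<le> 1}"
  obtain a where "a \<in> C" "\<And>x. norm (a x) \<le> 1"
    by (rule Cu_contractive_representative[OF C]) blast
  then have "?S \<noteq> {}" by auto
  moreover have "lim (\<lambda>n. trace_ext \<mu> (C0K_nth_root X n b)) = trace_lsc X \<mu> (\<lambda>x. ennreal_of_enat (rank_map X C x))"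
    if "b \<in> ?S" for b
    using that by (subst lim_trace_ext_root) (auto intro: Cu_member_C0K_pos[OF C] simp: rank_map_eq[OF C, of b])
  ultimately have "(\<lambda>a. lim (\<lambda>n. trace_ext \<mu> (C0K_nth_root X n a))) ` ?S
      = {trace_lsc X \<mu> (\<lambda>x. ennreal_of_enat (rank_map X C x))}"
    by (auto simp: image_iff)
  then show ?thesis unfolding d_functional_def by simp
qed

end

section \<open>Compact containment\<close>

text \<open>A strict inequality \<open>a < b\<close> puts \<open>a\<close> strictly below the
  supremum, so some term already exceeds it. This includes \<open>b = top\<close> with
  \<open>a\<close> finite.\<close>

lemma compactly_contained_ennreal:
  fixes a b :: ennreal
  assumes "a = 0 \<or> a < b"
  shows "compactly_contained UNIV (\<le>) a b"
  unfolding compactly_contained_def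
proof (intro allI impI)
  fix s :: "nat \<Rightarrow> ennreal" and t
  assume s: "(\<forall>k. s k \<in> UNIV \<and> s k \<le> s (Suc k)) \<and> is_supremum UNIV (\<le>) s t \<and> b \<le> t"
  then have "b \<le> t" "\<forall>u. (\<forall>k. s k \<le> u) \<longrightarrow> t \<le> u"
    by (simp_all add: is_supremum_def)
  then have "b \<le> t" "t \<le> (SUP k. s k)"
    using SUP_upper[of _ UNIV s] by simp_all
  then have b: "b \<le> (SUP k. s k)" by (rule order_trans)
  have inc: "incseq s" using s by (intro incseq_SucI) blast
  show "\<forall>\<^sub>F k in sequentially. a \<le> s k"
  proof (cases "a = 0")
    case False
    then have "a < (SUP k. s k)" using assms b by (auto intro: less_le_trans)
    then obtain k where "a < s k" by (auto simp: less_SUP_iff)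
    then have "a \<le> s j" if "k \<le> j" for j
      using incseqD[OF inc that] by auto
    then show ?thesis by (rule eventually_sequentiallyI)
  qed simp
qed

lemma not_compactly_contained_self_ennreal:
  fixes d :: ennreal
  assumes "0 < d"
  shows "\<not> compactly_contained UNIV (\<le>) d d"
proof
  assume cc: "compactly_contained UNIV (\<le>) d d"
  \<comment> \<open>The order of [0,\<infinity>] is dense, so \<open>Sup {..<d}\<close> equals
    \<open>d\<close>, and a sequence of values below \<open>d\<close> approaches it without ever
    reaching it.\<close>
  obtain s where s: "incseq s" "range s \<subseteq> {..<d}" "Sup {..<d} = (SUP k. s k)"
    using ennreal_Sup_countable_SUP[of "{..<d}"] assms by auto
  have "is_supremum UNIV (\<le>) s (SUP k. s k)"
    unfolding is_supremum_def by (auto intro: SUP_upper SUP_least)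
  moreover have "d \<le> (SUP k. s k)"
    using s(3) by simp
  moreover have "\<forall>k. s k \<in> UNIV \<and> s k \<le> s (Suc k)"
    using incseq_SucD[OF s(1)] by simp
  ultimately have "\<forall>\<^sub>F k in sequentially. d \<le> s k"
    using cc unfolding compactly_contained_def by blast
  then obtain k where "d \<le> s k" by (auto simp: eventually_sequentially)
  moreover have "s k < d" using s(2) by auto
  ultimately show False by simp
qed

lemma compactin_imp_sigma_compactin: "compactin X K \<Longrightarrow> sigma_compactin X K"
  unfolding sigma_compactin_def by (rule exI[of _ "{K}"]) auto

lemma sigma_compactin_UN:
  assumes "\<And>k::nat. sigma_compactin X (S k)"
  shows "sigma_compactin X (\<Union>k. S k)"
proof -
  obtain \<C> where "\<And>k. countable (\<C> k)" "\<And>k K. K \<in> \<C> k \<Longrightarrow> compactin X K" "\<And>k. S k = \<Union>(\<C> k)"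
    using assms unfolding sigma_compactin_def by metis
  then show ?thesis
    unfolding sigma_compactin_def by (intro exI[of _ "\<Union>k. \<C> k"]) auto
qed

text \<open>Compact sets are closed in a Hausdorff space, so the pairwise intersections are compact
  and there are countably many of them.\<close>

lemma sigma_compactin_Int:
  assumes X: "Hausdorff_space X" and "sigma_compactin X S" "sigma_compactin X T"
  shows "sigma_compactin X (S \<inter> T)"
proof -
  obtain \<C> \<D> where \<C>: "countable \<C>" "\<And>K. K \<in> \<C> \<Longrightarrow> compactin X K" "S = \<Union>\<C>"
    and \<D>: "countable \<D>" "\<And>K. K \<in> \<D> \<Longrightarrow> compactin X K" "T = \<Union>\<D>"
    using assms(2,3) unfolding sigma_compactin_def by metis
  have "compactin X (K \<inter> L)" if "K \<in> \<C>" "L \<in> \<D>" for K L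
    using that by (intro closed_Int_compactin compactin_imp_closedin[OF X] \<C> \<D>)
  then show ?thesis
    unfolding sigma_compactin_def using \<C> \<D>
    by (intro exI[of _ "(\<lambda>(K, L). K \<inter> L) ` (\<C> \<times> \<D>)"]) auto
qed

lemma openin_superlevel:
  assumes "g \<in> C0_nonneg X"
  shows "openin X {x \<in> topspace X. e < g x}"
  using openin_continuous_map_preimage[OF vanishing_at_infinity_continuous[OF C0_nonneg_vanishing[OF assms]], of "{e<..}"]
  by simp

text \<open>A countable union of the sets where \<open>g\<close> is at least
  \<open>e + inverse (real (Suc k))\<close>. These thresholds are positive even for
  \<open>e = 0\<close>, which makes the sets compact.\<close>

lemma sigma_compactin_superlevel:
  assumes g: "g \<in> C0_nonneg X" and e: "0 \<le> e"
  shows "sigma_compactin X {x \<in> topspace X. e < g x}"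
proof -
  have "{x \<in> topspace X. e < g x} = (\<Union>k. {x \<in> topspace X. e + inverse (real (Suc k)) \<le> norm (g x)})"
  proof (intro set_eqI iffI)
    fix x assume x: "x \<in> {x \<in> topspace X. e < g x}"
    then obtain k where "inverse (real (Suc k)) < g x - e"
      using reals_Archimedean[of "g x - e"] by auto
    then have "e + inverse (real (Suc k)) \<le> norm (g x)" by simp
    then show "x \<in> (\<Union>k. {x \<in> topspace X. e + inverse (real (Suc k)) \<le> norm (g x)})"
      using x by blast
  next
    fix x assume "x \<in> (\<Union>k. {x \<in> topspace X. e + inverse (real (Suc k)) \<le> norm (g x)})"
    then obtain k where k: "x \<in> topspace X" "e + inverse (real (Suc k)) \<le> g x"
      using C0_nonneg_nonneg[OF g, of x] by auto
    have "e < e + inverse (real (Suc k))" by simp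
    from less_le_trans[OF this k(2)] show "x \<in> {x \<in> topspace X. e < g x}" using k(1) by simp
  qed
  moreover have "compactin X {x \<in> topspace X. e + inverse (real (Suc k)) \<le> norm (g x)}" for k
    using e by (intro vanishing_at_infinity_compactin C0_nonneg_vanishing g) (simp add: add_nonneg_pos)
  ultimately show ?thesis
    by (simp only:) (intro sigma_compactin_UN compactin_imp_sigma_compactin)
qed

lemma enat_le_iff_levels: "a \<le> b \<longleftrightarrow> (\<forall>i. enat i < a \<longrightarrow> enat i < b)"
proof
  assume *: "\<forall>i. enat i < a \<longrightarrow> enat i < b"
  show "a \<le> b"
  proof (rule ccontr)
    assume "\<not> a \<le> b"
    then have "b < a" by simp
    then show False using * by (cases b) auto
  qed
qed (auto intro: less_le_trans)

text \<open>The pointwise norm of a contractive representative. The bound by 1 places it below the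
  rank function, which is at least 1 wherever it is not 0.\<close>

lemma Cu_supporting_function:
  assumes C: "C \<in> Cu X"
  obtains h where "h \<in> C0_nonneg X" "\<And>x. h x \<le> 1" "\<And>x. 0 < h x \<longleftrightarrow> rank_map X C x \<noteq> 0"
proof -
  obtain a where a: "a \<in> C" "\<And>x. norm (a x) \<le> 1"
    by (rule Cu_contractive_representative[OF C]) blast
  have pos: "a \<in> C0K_pos X" by (rule Cu_member_C0K_pos[OF C a(1)])
  show ?thesis
  proof (rule that)
    show "(\<lambda>x. norm (a x)) \<in> C0_nonneg X"
      by (rule C0_nonneg_compose[OF C0K_pos_vanishing[OF pos]]) (auto intro!: continuous_intros)
    show "norm (a x) \<le> 1" for x by (rule a(2))
    show "0 < norm (a x) \<longleftrightarrow> rank_map X C x \<noteq> 0" for x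
      using rank_op_eq_0_iff[OF pos_op_clinear[OF C0K_pos_pos_op[OF pos]], of x] by (simp add: rank_map_eq[OF C a(1)])
  qed
qed

text \<open>Faithfulness speaks about absolute squares; it is applied to the square root of
  \<open>g\<close>.\<close>

lemma real_trace_pos:
  assumes faithful: "faithful_trace X \<mu>" and g: "g \<in> C0_nonneg X" and x: "g x \<noteq> 0"
  shows "0 < real_trace \<mu> g"
proof -
  have "g = (\<lambda>x. 0)" if "real_trace \<mu> g = 0"
  proof -
    have "(\<lambda>x. complex_of_real (g x)) = (\<lambda>x. cnj (complex_of_real (sqrt (g x))) * complex_of_real (sqrt (g x)))"
      by (intro ext of_real_sqrt_square[symmetric] C0_nonneg_nonneg[OF g])
    then have zero: "(\<lambda>x. complex_of_real (sqrt (g x))) = (\<lambda>x. 0)"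
      using that faithful sqrt_C0_nonneg[OF g] by (simp add: faithful_trace_def real_trace_def)
    show ?thesis
      by (rule ext) (use fun_cong[OF zero] in simp)
  qed
  then show ?thesis using x by (auto simp: zero_less_iff_neq_zero)
qed

text \<open>Dense definedness yields an element of finite trace within \<open>e / 2\<close> of
  \<open>h\<close>. It is at least \<open>e / 2\<close> on the set where \<open>h\<close> exceeds
  \<open>e\<close>, so a multiple of it dominates everything that competes below
  \<open>F\<close>.\<close>

lemma trace_lsc_less_top:
  assumes trace: "is_trace X \<mu>" and dense: "densely_defined_trace X \<mu>"
    and h: "h \<in> C0_nonneg X" and e: "0 < e" and F: "\<And>x. F x \<le> (if e < h x then of_nat k else 0)"
  shows "trace_lsc X \<mu> F < top"
proof -
  have "0 < e / 2" using e by simp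
  then obtain b where b: "b \<in> C0_pos X" "\<mu> b < \<infinity>" "\<And>x. x \<in> topspace X \<Longrightarrow> cmod (b x - complex_of_real (h x)) < e / 2"
    using dense of_real_C0_nonneg_in_C0_pos[OF h] unfolding densely_defined_trace_def by meson
  obtain q where q: "q \<in> C0_nonneg X" "b = (\<lambda>x. complex_of_real (q x))"
    by (rule C0_pos_cases[OF b(1)])
  \<comment> \<open>\<open>2 * real k / e\<close> lifts the level \<open>e / 2\<close> to
    \<open>k\<close>; the added 1 keeps \<open>t\<close> positive when \<open>k = 0\<close>, as
    \<open>real_trace_scale\<close> demands.\<close>
  define t where "t = 2 * real k / e + 1"
  have t: "0 < t" using e by (simp add: t_def add_nonneg_pos)
  have bound: "\<phi> x \<le> t * q x" if \<phi>: "\<phi> \<in> C0_nonneg X" "\<And>x. ennreal (\<phi> x) \<le> F x" for \<phi> x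
  proof (cases "e < h x")
    case True
    then have "x \<in> topspace X"
      using e vanishing_at_infinity_outside[OF C0_nonneg_vanishing[OF h], of x] by force
    then have "\<bar>q x - h x\<bar> < e / 2"
      using b(3)[of x] by (simp add: q(2) flip: of_real_diff)
    then have "e / 2 \<le> q x" using True unfolding abs_less_iff by linarith
    then have "t * (e / 2) \<le> t * q x" using t by (intro mult_left_mono) auto
    moreover have "real k \<le> t * (e / 2)" using e by (simp add: t_def field_simps)
    moreover have "ennreal (\<phi> x) \<le> ennreal (real k)"
      using order_trans[OF \<phi>(2) F, of x] True by (simp add: ennreal_of_nat_eq_real_of_nat)
    then have "\<phi> x \<le> real k" by (simp add: ennreal_le_iff)
    ultimately show ?thesis by linarith
  next
    case False
    then have "\<phi> x \<le> 0" using order_trans[OF \<phi>(2) F, of x] by (simp add: ennreal_eq_0_iff)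
    then show ?thesis using t C0_nonneg_nonneg[OF q(1), of x] by (smt (verit) mult_nonneg_nonneg)
  qed
  have tq: "(\<lambda>x. t * q x) \<in> C0_nonneg X" using t by (intro C0_nonneg_scale q) simp
  have "trace_lsc X \<mu> F \<le> real_trace \<mu> (\<lambda>x. t * q x)"
    unfolding trace_lsc_def by (rule SUP_least) (use bound in \<open>auto intro!: real_trace_mono[OF trace] tq\<close>)
  also have "\<dots> = ennreal t * real_trace \<mu> q" by (rule real_trace_scale[OF trace q(1) t])
  also have "\<dots> < top"
    using b(2) by (simp add: real_trace_def q(2) ennreal_mult_less_top)
  finally show ?thesis .
qed

text \<open>Adding \<open>w\<close> to any competitor for \<open>F\<close> gives a competitor for
  \<open>G\<close>, so additivity on continuous functions is enough.\<close>

lemma trace_lsc_add_le: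
  assumes trace: "is_trace X \<mu>" and w: "w \<in> C0_nonneg X"
    and le: "\<And>\<phi> x. \<phi> \<in> C0_nonneg X \<Longrightarrow> (\<And>x. ennreal (\<phi> x) \<le> F x) \<Longrightarrow> ennreal (\<phi> x + w x) \<le> G x"
  shows "trace_lsc X \<mu> F + real_trace \<mu> w \<le> trace_lsc X \<mu> G"
proof -
  let ?A = "{h \<in> C0_nonneg X. \<forall>x. ennreal (h x) \<le> F x}"
  have "(\<lambda>x. 0) \<in> ?A" by (simp add: C0_nonneg_0)
  then have "trace_lsc X \<mu> F + real_trace \<mu> w = (SUP \<phi>\<in>?A. real_trace \<mu> \<phi> + real_trace \<mu> w)"
    unfolding trace_lsc_def by (intro ennreal_SUP_add_left[symmetric]) blast
  also have "\<dots> \<le> trace_lsc X \<mu> G"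
  proof (rule SUP_least)
    fix \<phi> assume \<phi>: "\<phi> \<in> ?A"
    have "real_trace \<mu> \<phi> + real_trace \<mu> w = real_trace \<mu> (\<lambda>x. \<phi> x + w x)"
      using \<phi> by (intro real_trace_add[OF trace, symmetric] w) simp
    also have "\<dots> \<le> trace_lsc X \<mu> G"
      unfolding trace_lsc_def using \<phi> le by (intro SUP_upper CollectI conjI allI C0_nonneg_add w) auto
    finally show "real_trace \<mu> \<phi> + real_trace \<mu> w \<le> trace_lsc X \<mu> G" .
  qed
  finally show ?thesis .
qed

section \<open>Compact containment under the rank isomorphism\<close>

context
  fixes X :: "'a topology"
  assumes Hausdorff: "Hausdorff_space X" and iso: "rank_map_is_isomorphism X"
begin

lemma Cu_le_iff: "C \<in> Cu X \<Longrightarrow> D \<in> Cu X \<Longrightarrow> Cu_le X C D \<longleftrightarrow> rank_map X C \<le> rank_map X D"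
  using iso by (simp add: rank_map_is_isomorphism_def)

lemma rank_map_in_Lsc_sigma: "C \<in> Cu X \<Longrightarrow> rank_map X C \<in> Lsc_sigma X"
  using iso by (auto simp: rank_map_is_isomorphism_def bij_betw_def)

lemma rank_map_surj: "f \<in> Lsc_sigma X \<Longrightarrow> \<exists>C\<in>Cu X. rank_map X C = f"
proof -
  assume "f \<in> Lsc_sigma X"
  moreover have "rank_map X ` Cu X = Lsc_sigma X"
    using iso by (simp add: rank_map_is_isomorphism_def bij_betw_def)
  ultimately have "f \<in> rank_map X ` Cu X" by simp
  then show ?thesis by (rule imageE) blast
qed

lemma truncation_in_Lsc_sigma:
  assumes g: "g \<in> Lsc_sigma X" and h: "h \<in> C0_nonneg X" and e: "0 \<le> e"
  shows "(\<lambda>x. if e < h x then min (g x) (enat k) else 0) \<in> Lsc_sigma X"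
proof -
  have level: "{x \<in> topspace X. enat i < (if e < h x then min (g x) (enat k) else 0)}
      = (if i < k then {x \<in> topspace X. e < h x} \<inter> {x \<in> topspace X. enat i < g x} else {})" for i
    by auto
  have "sigma_compactin X {}" by (rule compactin_imp_sigma_compactin) simp
  then show ?thesis
    using g h e vanishing_at_infinity_outside[OF C0_nonneg_vanishing[OF h]]
    unfolding Lsc_sigma_def mem_Collect_eq level
    by (auto intro!: openin_Int openin_superlevel sigma_compactin_Int[OF Hausdorff] sigma_compactin_superlevel)
qed

text \<open>The truncated rank functions of \<open>D\<close> lie in \<open>Lsc_sigma X\<close>, so
  by surjectivity they come from classes, which increase with \<open>k\<close>. The order embedding
  makes \<open>D\<close> their supremum in the Cuntz semigroup, and compact containment places
  \<open>C\<close> below one of them.\<close>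

lemma compactly_contained_truncation:
  assumes C: "C \<in> Cu X" and D: "D \<in> Cu X" and cc: "compactly_contained (Cu X) (Cu_le X) C D"
    and h: "h \<in> C0_nonneg X" "\<And>x. 0 < h x \<longleftrightarrow> rank_map X D x \<noteq> 0"
  obtains k where
    "\<And>x. rank_map X C x \<le> (if inverse (real (Suc k)) < h x then min (rank_map X D x) (enat k) else 0)"
proof -
  define g where "g k x = (if inverse (real (Suc k)) < h x then min (rank_map X D x) (enat k) else 0)" for k x
  have "g k \<in> Lsc_sigma X" for k
    unfolding g_def[abs_def] by (rule truncation_in_Lsc_sigma[OF rank_map_in_Lsc_sigma[OF D] h(1)]) simp
  then have "\<forall>k. \<exists>C. C \<in> Cu X \<and> rank_map X C = g k"
    using rank_map_surj[of "g _"] by blast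
  from choice[OF this] obtain s where s: "\<And>k. s k \<in> Cu X" "\<And>k. rank_map X (s k) = g k"
    by blast
  have "g k x \<le> g (Suc k) x" for k x
  proof -
    have le: "inverse (real (Suc (Suc k))) \<le> inverse (real (Suc k))" by (simp add: le_imp_inverse_le)
    have min_le: "min (rank_map X D x) (enat k) \<le> min (rank_map X D x) (enat (Suc k))"
      by (intro min.mono) auto
    show ?thesis
    proof (cases "inverse (real (Suc k)) < h x")
      case True
      with le have "inverse (real (Suc (Suc k))) < h x" by (rule le_less_trans)
      with True min_le show ?thesis by (simp only: g_def if_True)
    qed (simp only: g_def if_False zero_le)
  qed
  then have inc: "Cu_le X (s k) (s (Suc k))" for k
    by (simp add: Cu_le_iff s le_fun_def)
  have "is_supremum (Cu X) (Cu_le X) s D"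
    unfolding is_supremum_def
  proof (intro conjI ballI allI impI D)
    show "Cu_le X (s k) D" for k
      by (simp add: Cu_le_iff s D le_fun_def g_def)
    fix u assume u: "u \<in> Cu X" "\<forall>k. Cu_le X (s k) u"
    then have ub: "g k x \<le> rank_map X u x" for k x
      by (simp add: Cu_le_iff s le_fun_def)
    have "rank_map X D x \<le> rank_map X u x" for x
      unfolding enat_le_iff_levels
    proof (intro allI impI)
      fix i assume i: "enat i < rank_map X D x"
      then have "0 < h x" using h(2)[of x] by auto
      then obtain m where m: "inverse (real (Suc m)) < h x" using reals_Archimedean by blast
      \<comment> \<open>\<open>Suc i\<close> ensures that the truncation at height \<open>k\<close>
        does not cut away level \<open>i\<close>, and \<open>m\<close> that \<open>x\<close> already
        lies in the truncated support.\<close>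
      define k where "k = max (Suc i) m"
      have "inverse (real (Suc k)) \<le> inverse (real (Suc m))"
        by (intro le_imp_inverse_le) (auto simp: k_def)
      then have "inverse (real (Suc k)) < h x" using m by (rule le_less_trans)
      then have "g k x = min (rank_map X D x) (enat k)" by (simp only: g_def if_True)
      moreover have "enat i < min (rank_map X D x) (enat k)" using i by (simp add: k_def)
      ultimately have "enat i < g k x" by (simp only:)
      then show "enat i < rank_map X u x" using ub by (rule less_le_trans)
    qed
    then show "Cu_le X D u" by (simp add: Cu_le_iff D u le_fun_def)
  qed
  moreover have "Cu_le X D D" by (simp add: Cu_le_iff D)
  ultimately have "\<forall>\<^sub>F k in sequentially. Cu_le X C (s k)"
    using cc s(1) inc unfolding compactly_contained_def by blast
  then obtain k where "Cu_le X C (s k)" by (auto simp: eventually_sequentially)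
  then have "rank_map X C x \<le> g k x" for x
    by (simp add: Cu_le_iff C s le_fun_def)
  then show ?thesis unfolding g_def by (rule that)
qed

text \<open>The supremum \<open>t\<close> is known only through the order. The pointwise supremum
  \<open>F\<close> of the ranks lies in \<open>Lsc_sigma X\<close>, so it belongs to a class
  \<open>u\<close> above all \<open>s k\<close> and hence above \<open>t\<close>; thus
  \<open>F\<close> is positive on \<open>U\<close>. Compactness makes a single rank function
  positive on all of \<open>U\<close>, and positive values in \<open>enat\<close> are at least
  1.\<close>

lemma indicator_compactly_contained_self:
  assumes C: "C \<in> Cu X" and rank: "\<And>x. rank_map X C x = (if x \<in> U then 1 else 0)" and U: "compactin X U"
  shows "compactly_contained (Cu X) (Cu_le X) C C"
  unfolding compactly_contained_def
proof (intro allI impI)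
  fix s t assume st: "(\<forall>k. s k \<in> Cu X \<and> Cu_le X (s k) (s (Suc k))) \<and> is_supremum (Cu X) (Cu_le X) s t \<and> Cu_le X C t"
  then have s: "s k \<in> Cu X" for k by blast
  have inc: "rank_map X (s j) x \<le> rank_map X (s k) x" if "j \<le> k" for j k x
    using that
  proof (induction rule: dec_induct)
    case (step n)
    have "rank_map X (s n) \<le> rank_map X (s (Suc n))"
      using st Cu_le_iff[OF s s] by blast
    then show ?case using step.IH by (auto simp: le_fun_def intro: order_trans)
  qed simp
  define F where "F x = (SUP k. rank_map X (s k) x)" for x
  have level: "{x \<in> topspace X. enat i < F x} = (\<Union>k. {x \<in> topspace X. enat i < rank_map X (s k) x})" for i
    by (auto simp: F_def less_SUP_iff)
  have "F \<in> Lsc_sigma X"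
    using rank_map_in_Lsc_sigma[OF s] unfolding Lsc_sigma_def mem_Collect_eq level
    by (auto intro!: sigma_compactin_UN simp: F_def)
  then obtain u where u: "u \<in> Cu X" "rank_map X u = F" using rank_map_surj by blast
  have "Cu_le X (s k) u" for k
    unfolding Cu_le_iff[OF s u(1)] u(2) by (auto simp: le_fun_def F_def intro: SUP_upper)
  then have t: "t \<in> Cu X" "Cu_le X t u"
    using st u unfolding is_supremum_def by blast+
  have le_F: "rank_map X C x \<le> F x" for x
    using st Cu_le_iff[OF C t(1)] Cu_le_iff[OF t(1) u(1)] t(2) unfolding u(2)
    by (auto simp: le_fun_def intro: order_trans)
  have "enat 0 < F x" if "x \<in> U" for x
  proof -
    have "1 \<le> F x" using le_F[of x] that by (simp add: rank)
    then have "0 < F x" by (rule less_le_trans[rotated]) simp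
    then show ?thesis by (simp add: enat_0)
  qed
  then have cover: "U \<subseteq> (\<Union>k. {x \<in> topspace X. enat 0 < rank_map X (s k) x})"
    using compactin_subset_topspace[OF U] unfolding level[symmetric] by blast
  have "\<exists>k. U \<subseteq> {x \<in> topspace X. enat 0 < rank_map X (s k) x}"
  proof (rule compactin_incseq_cover[OF U _ _ cover])
    show "openin X {x \<in> topspace X. enat 0 < rank_map X (s k) x}" for k
      using rank_map_in_Lsc_sigma[OF s] by (simp add: Lsc_sigma_def)
    show "incseq (\<lambda>k. {x \<in> topspace X. enat 0 < rank_map X (s k) x})"
      by (intro monoI) (auto intro: order_less_le_trans inc)
  qed
  then obtain k where k: "U \<subseteq> {x \<in> topspace X. enat 0 < rank_map X (s k) x}" by blast
  have "Cu_le X C (s j)" if "k \<le> j" for j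
  proof -
    have "1 \<le> rank_map X (s j) x" if "x \<in> U" for x
    proof -
      have "0 < rank_map X (s k) x" using k that by (auto simp: enat_0)
      then show ?thesis
        using ileI1[of 0 "rank_map X (s k) x"] inc[OF \<open>k \<le> j\<close>, of x] by (simp add: one_eSuc)
    qed
    then show ?thesis unfolding Cu_le_iff[OF C s] by (auto simp: le_fun_def rank)
  qed
  then show "\<forall>\<^sub>F k in sequentially. Cu_le X C (s k)" by (rule eventually_sequentiallyI)
qed

end

theorem theorem2p1:
  fixes X :: "'a topology" and \<mu> :: "('a \<Rightarrow> complex) \<Rightarrow> ennreal"
  assumes "locally_compact_space X" and "Hausdorff_space X"
    and "rank_map_is_isomorphism X"
    and "is_trace X \<mu>" and "faithful_trace X \<mu>" and "densely_defined_trace X \<mu>"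
  shows "preserves_compact_containment (Cu X) (Cu_le X) (UNIV :: ennreal set) (\<le>) (d_functional X \<mu>)
    \<longleftrightarrow> \<not> (\<exists>U. U \<noteq> {} \<and> openin X U \<and> compactin X U)"
proof
  assume preserves: "preserves_compact_containment (Cu X) (Cu_le X) (UNIV :: ennreal set) (\<le>) (d_functional X \<mu>)"
  show "\<not> (\<exists>U. U \<noteq> {} \<and> openin X U \<and> compactin X U)"
  proof
    assume "\<exists>U. U \<noteq> {} \<and> openin X U \<and> compactin X U"
    then obtain U where U: "U \<noteq> {}" "openin X U" "compactin X U" by blast
    have sub: "U \<subseteq> topspace X" by (rule compactin_subset_topspace[OF U(3)])
    define f :: "'a \<Rightarrow> enat" where "f x = (if x \<in> U then 1 else 0)" for x
    have "{x \<in> topspace X. enat i < f x} = (if i = 0 then U else {})" for i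
      using sub by (auto simp: f_def one_enat_def zero_enat_def)
    then have "f \<in> Lsc_sigma X"
      using U sub by (auto simp: Lsc_sigma_def f_def intro!: compactin_imp_sigma_compactin)
    then obtain C where C: "C \<in> Cu X" "rank_map X C = f" using rank_map_surj[OF assms(2,3)] by blast
    have "compactly_contained (Cu X) (Cu_le X) C C"
      by (rule indicator_compactly_contained_self[OF assms(2,3) C(1) _ U(3)]) (simp add: C(2) f_def)
    then have "compactly_contained UNIV (\<le>) (d_functional X \<mu> C) (d_functional X \<mu> C)"
      using preserves C(1) by (simp add: preserves_compact_containment_def)
    moreover have "0 < d_functional X \<mu> C"
    proof -
      obtain h where h: "h \<in> C0_nonneg X" "\<And>x. h x \<le> 1" "\<And>x. 0 < h x \<longleftrightarrow> rank_map X C x \<noteq> 0"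
        by (rule Cu_supporting_function[OF C(1)]) blast
      obtain x where "x \<in> U" using U(1) by blast
      then have "h x \<noteq> 0" using h(3)[of x] by (auto simp: C(2) f_def)
      then have "0 < real_trace \<mu> h" by (rule real_trace_pos[OF assms(5) h(1)])
      also have "real_trace \<mu> h \<le> d_functional X \<mu> C"
        unfolding d_functional_eq[OF assms(4) C(1)] trace_lsc_def
      proof (intro SUP_upper CollectI conjI allI h(1))
        fix x
        show "ennreal (h x) \<le> ennreal_of_enat (rank_map X C x)"
          using h(2)[of x] h(3)[of x] by (auto simp: C(2) f_def not_less ennreal_neg)
      qed
      finally show ?thesis .
    qed
    ultimately show False using not_compactly_contained_self_ennreal by blast
  qed
next
  assume no_compact_open: "\<not> (\<exists>U. U \<noteq> {} \<and> openin X U \<and> compactin X U)"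
  show "preserves_compact_containment (Cu X) (Cu_le X) (UNIV :: ennreal set) (\<le>) (d_functional X \<mu>)"
    unfolding preserves_compact_containment_def
  proof (intro ballI impI)
    fix C D assume C: "C \<in> Cu X" and D: "D \<in> Cu X" and cc: "compactly_contained (Cu X) (Cu_le X) C D"
    obtain h where h: "h \<in> C0_nonneg X" "\<And>x. h x \<le> 1" "\<And>x. 0 < h x \<longleftrightarrow> rank_map X D x \<noteq> 0"
      by (rule Cu_supporting_function[OF D]) blast
    obtain k where k: "\<And>x. rank_map X C x
        \<le> (if inverse (real (Suc k)) < h x then min (rank_map X D x) (enat k) else 0)"
      by (rule compactly_contained_truncation[OF assms(2,3) C D cc h(1,3)]) blast
    define e where "e = inverse (real (Suc k))"
    have e: "0 < e" by (simp add: e_def)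
    have rank_off: "rank_map X C x = 0" if "h x \<le> e" for x
      using k[of x] that by (simp add: e_def)
    note d_eq = d_functional_eq[OF assms(4)]
    have "d_functional X \<mu> C = 0 \<or> d_functional X \<mu> C < d_functional X \<mu> D"
    proof (cases "\<exists>x. 0 < h x \<and> h x < e")
      case False
      \<comment> \<open>As \<open>h\<close> takes no value strictly between 0 and \<open>e\<close>,
        its support is also a superlevel set at a positive threshold, and therefore both open and
        compact.\<close>
      have "{x \<in> topspace X. 0 < h x} = {x \<in> topspace X. e \<le> norm (h x)}"
        using False e C0_nonneg_nonneg[OF h(1)] by force
      then have "compactin X {x \<in> topspace X. 0 < h x}"
        using vanishing_at_infinity_compactin[OF C0_nonneg_vanishing[OF h(1)] e] by (simp only:)
      with openin_superlevel[OF h(1), of 0]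
      have "{x \<in> topspace X. 0 < h x} \<noteq> {} \<Longrightarrow> \<exists>U. U \<noteq> {} \<and> openin X U \<and> compactin X U"
        by (intro exI conjI)
      with no_compact_open have empty: "{x \<in> topspace X. 0 < h x} = {}"
        by argo
      have "h x \<le> e" for x
        using empty e vanishing_at_infinity_outside[OF C0_nonneg_vanishing[OF h(1)], of x]
        by (cases "x \<in> topspace X") auto
      then have "rank_map X C = (\<lambda>x. 0)" by (intro ext rank_off)
      then have "d_functional X \<mu> C = trace_lsc X \<mu> (\<lambda>x. ennreal 0)"
        by (simp add: d_eq[OF C])
      also have "\<dots> = 0"
        using trace_lsc_real[OF assms(4) C0_nonneg_0] real_trace_0[OF assms(4)] by simp
      finally show ?thesis by blast
    next
      case True
      then obtain x0 where x0: "0 < h x0" "h x0 < e" by blast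
      \<comment> \<open>A tent over the values of \<open>h\<close> between 0 and \<open>e\<close>.
        It vanishes where \<open>h\<close> is 0 or at least \<open>e\<close>, so it avoids the
        support of the rank function of \<open>C\<close>, and it is bounded by \<open>h\<close>,
        hence by 1.\<close>
      define w where "w x = max 0 (min (h x) (e - h x))" for x
      have w: "w \<in> C0_nonneg X"
        unfolding w_def
        by (rule C0_nonneg_compose[OF C0_nonneg_vanishing[OF h(1)], of "\<lambda>t. max 0 (min t (e - t))"])
          (use e in \<open>auto intro!: continuous_intros\<close>)
      have "0 < real_trace \<mu> w"
        by (rule real_trace_pos[OF assms(5) w, of x0]) (use x0 in \<open>simp add: w_def\<close>)
      moreover have "d_functional X \<mu> C < top"
        unfolding d_eq[OF C]
      proof (rule trace_lsc_less_top[OF assms(4,6) h(1) e])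
        fix x
        have "rank_map X C x \<le> (if e < h x then enat k else 0)"
          using k[of x] by (auto simp: e_def split: if_splits)
        then have "ennreal_of_enat (rank_map X C x) \<le> ennreal_of_enat (if e < h x then enat k else 0)"
          by simp
        then show "ennreal_of_enat (rank_map X C x) \<le> (if e < h x then of_nat k else 0)"
          by (simp del: ennreal_of_enat_le_iff split: if_splits)
      qed
      moreover have "d_functional X \<mu> C + real_trace \<mu> w \<le> d_functional X \<mu> D"
        unfolding d_eq[OF C] d_eq[OF D]
      proof (rule trace_lsc_add_le[OF assms(4) w])
        fix \<phi> x assume \<phi>: "\<phi> \<in> C0_nonneg X" and le: "\<And>x. ennreal (\<phi> x) \<le> ennreal_of_enat (rank_map X C x)"
        show "ennreal (\<phi> x + w x) \<le> ennreal_of_enat (rank_map X D x)"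
        \<comment> \<open>At every point one of the two summands is 0, so each can be compared with
          the rank of \<open>D\<close> separately.\<close>
        proof (cases "e < h x")
          case True
          then have "rank_map X C x \<le> rank_map X D x" using k[of x] by (simp add: e_def)
          moreover have "w x = 0" using True by (simp add: w_def)
          ultimately show ?thesis
            using order_trans[OF le[of x]] by simp
        next
          case False
          then have "\<phi> x = 0"
            using le[of x] rank_off[of x] C0_nonneg_nonneg[OF \<phi>, of x] by (simp add: ennreal_eq_0_iff)
          moreover have "ennreal (w x) \<le> ennreal_of_enat (rank_map X D x)"
          proof (cases "rank_map X D x = 0")
            case True
            then have "h x = 0" using h(3)[of x] C0_nonneg_nonneg[OF h(1), of x] by auto
            then show ?thesis by (simp add: w_def)
          next
            case False
            have "ennreal (w x) \<le> ennreal 1"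
              using h(2)[of x] by (intro ennreal_leI) (auto simp: w_def)
            also have "\<dots> \<le> ennreal_of_enat (rank_map X D x)"
              using False ennreal_of_enat_le_iff[of 1 "rank_map X D x"] by (simp add: ileI1 one_eSuc)
            finally show ?thesis .
          qed
          ultimately show ?thesis by simp
        qed
      qed
      \<comment> \<open>A positive summand makes the sum strictly larger only because
        \<open>d_functional X \<mu> C\<close> is finite.\<close>
      moreover have "d_functional X \<mu> C + 0 < d_functional X \<mu> C + real_trace \<mu> w"
        using calculation(1,2) unfolding ennreal_add_left_cancel_less by simp
      ultimately have "d_functional X \<mu> C + 0 < d_functional X \<mu> D"
        by (simp only: less_le_trans)
      then show ?thesis by simp
    qed
    then show "compactly_contained UNIV (\<le>) (d_functional X \<mu> C) (d_functional X \<mu> D)"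
      by (rule compactly_contained_ennreal)
  qed
qed

end
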